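(* Consider a piecewise-deterministic Markov process on $E$ satisfying the assumptions listed in the context, let $A\in\mathcal{C}_2$, let $\{B_1,\dots,B_p\}$ be an admissible family and let $1\le k\le p$. Let $0<r_1<r_2<t<t^\star(A)$ and $x\in E$. There exists a sequence $(\beta_n(A,B_k))_{n\ge0}$ of positive (possibly random) bandwidths (depending on $t$) which almost surely tends to $0$, such that $$\sup_{r_1\le s\le r_2}\left|\widehat{\widetilde l}_{n,\beta_n(A,B_k),t}(A,B_k,s)-\widetilde l(A,B_k,s)\right|\longrightarrow0\quad\text{in }\mathbf{P}_x\text{-probability as }n\to+\infty.$$
   Context: **Process.** $E$ is a nonempty open subset of a separable metric space $(\mathcal{E},d)$; all functions and kernels are Borel measurable. $\Phi:E\times\mathbf{R}_+\to\overline{E}$ is a flow: $\Phi(\xi,t+s)=\Phi(\Phi(\xi,t),s)$ (whenever the right side is defined), and $t^\star(\xi)=\inf\{t>0:\Phi(\xi,t)\in\partial E\}$. The jump rate $\lambda:\overline{E}\to\mathbf{R}_+$ satisfies: for all $\xi\in E$ there is $\varepsilon>0$ with $\int_0^\varepsilon\lambda(\Phi(\xi,s))\,ds<\infty$. $Q$ is a Markov kernel on $\overline{E}$ with $Q(\xi,\overline{E}\setminus\{\xi\})=1$ and $Q(\xi,E)=1$ for all $\xi\in\overline E$. Put $\overline\lambda(\xi,t)=\lambda(\Phi(\xi,t))$, $\overline Q(\xi,t,B)=Q(\Phi(\xi,t),B)$, $G(\xi,t)=\exp(-\int_0^t\overline\lambda(\xi,s)\,ds)$, $f(\xi,t)=\overline\lambda(\xi,t)G(\xi,t)$.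 The embedded chain $(Z_n,S_n)_{n\ge0}$ ($Z_n$ post-jump locations, $S_n$ interarrival times, $S_0=0$) satisfies: for every $n\ge 0$, conditionally on the past up to index $n$ with $Z_n=x$, $\mathbf{P}(S_{n+1}>t)=G(x,t)\mathbf{1}_{\{0\le t<t^\star(x)\}}$, and, given moreover $S_{n+1}=s$, $Z_{n+1}$ has law $\overline Q(x,s,\cdot)$. $\mathbf{P}_x$ is the probability when $Z_0=x$. **Assumptions.** Let $\mathcal{C}_1$ be the set of Borel subsets of $E$ with non-empty interior, and $\mathcal{C}_2$ the set of relatively compact $A\in\mathcal{C}_1$ with $\overline{A}\cap\partial E=\emptyset$. For $A\in\mathcal{C}_2$, $t^\star(A)=\inf_{\xi\in A}t^\star(\xi)$. Let $d_2((x,y),(u,v))=d(x,u)+d(y,v)$. (1a) $\overline Q(\xi,s,B)=\int_B\widetilde Q(\xi,s,y)\,\mu(dy)$, where $\mu$ is a measure on $E$ with $\mu(B)>0$ for every measurable $B$ with non-empty interior. (1b) $\widetilde Q(x,\cdot,y)$ is continuous for all $x,y\in E$. (1c) There is $m>0$ with $\widetilde Q(x,s,y)\ge m$ for all $x,y\in E,s\ge0$. (1d) For any $e>0$ there exist $p\ge2$ and pairwise non-overlapping (disjoint) sets $B_1,\dots,B_p\in\mathcal{C}_1$ with $\max_k\operatorname{diam}B_k<e$ and $\sum_{k=1}^p\overline Q(x,t,B_k)=1$ for all $x\in E,t\ge0$; $B_1$ is taken to have the largest diameter. A family as in (1d), for some $e>0$, is called admissible. (2a) $f(\xi,\cdot)$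 is strictly positive and continuous for every $\xi\in E$. (2b) There is a locally integrable $M:\mathbf{R}_+\to\mathbf{R}_+$ with $\overline\lambda(\xi,t)\le M(t)$ for all $\xi\in E$, $t\geq 0$. (2c) $t^\star:E\to\mathbf{R}_+$ is bounded. (2d) There is a constant $[f\widetilde Q]_{Lip}$ with $|f(x,t)\widetilde Q(x,t,y)-f(u,t)\widetilde Q(u,t,v)|\le[f\widetilde Q]_{Lip}\,d_2((x,y),(u,v))$ for all $x,y,u,v\in E$, $0\le t<t^\star(x)\wedge t^\star(u)$. (2e) There is a constant $[f]_{Lip}$ with $|f(x,t)-f(y,t)|\le[f]_{Lip}\,d(x,y)$ for all $x,y\in E$, $t\ge0$. (2f) There is a constant $[G\widetilde Q]_{Lip}$ with $|G(x,t^\star(x))\widetilde Q(x,t^\star(x),y)-G(u,t^\star(u))\widetilde Q(u,t^\star(u),v)|\le[G\widetilde Q]_{Lip}\,d_2((x,y),(u,v))$ for all $x,y,u,v\in E$. The functions $f$ and $\widetilde Q$ are bounded. **Notation.** $R(x,B)=\mathbf{P}_x(Z_1\in B)$ is the transition kernel of $(Z_n)$; under the assumptions it has a unique invariant probability measure $\nu$. $\widetilde\nu(dx\times dy)=\nu(dx)R(x,dy)$. For $x,y\in E$, $0\le t\le t^\star(x)$, $$\widetilde\lambda(x,y,t)=\frac{f(x,t)\widetilde Q(x,t,y)}{\int_t^{t^\star(x)}f(x,s)\widetilde Q(x,s,y)\,ds+G(x,t^\star(x))\widetilde Q(x,t^\star(x),y)},\qquad \widetilde G(x,y,t)=\exp\Big(-\int_0^t\widetilde\lambda(x,y,s)\,ds\Big),$$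 and, for $0\le t<t^\star(A)$, $$\widetilde l(A,B_k,t)=\frac{\int_{A\times B_k}\widetilde\lambda(u,v,t)\widetilde G(u,v,t)\,\widetilde\nu(du\times dv)}{\int_{A\times B_k}\widetilde G(u,v,t)\,\widetilde\nu(du\times dv)}.$$ **Estimator.** $Y_n(A,B_k,t)=\sum_{i=0}^{n-1}\mathbf{1}_{\{S_{i+1}\ge t\}}\mathbf{1}_{\{Z_i\in A\}}\mathbf{1}_{\{Z_{i+1}\in B_k\}}$, and $Y_n(A,B_k,t)^+=1/Y_n(A,B_k,t)$ if $Y_n(A,B_k,t)\neq0$, $0$ otherwise. Let $K$ be a continuous kernel (a function with integral $1$) with support $[-1,1]$. For $b>0$, $0<t<t^\star(A)$ and $0\le s\le t$, $$\widehat{\widetilde l}_{n,b,t}(A,B_k,s)=\frac1b\sum_{i=0}^{n-1}K\Big(\frac{s-S_{i+1}}{b}\Big)Y_n(A,B_k,S_{i+1})^+\mathbf{1}_{\{S_{i+1}\le t\}}\mathbf{1}_{\{Z_i\in A\}}\mathbf{1}_{\{Z_{i+1}\in B_k\}}.$$ *)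

theory Defs
  imports "HOL-Probability.Probability"
begin

text \<open>The ambient separable metric space is the whole type \<open>'a\<close>; for metric spaces
  separability is the class \<open>second_countable_topology\<close>.\<close>

locale pdmp =
  fixes E :: "'a :: {metric_space, second_countable_topology} set"
    and \<Phi> :: "'a \<Rightarrow> real \<Rightarrow> 'a"
    and rate :: "'a \<Rightarrow> real"
    and Q :: "'a \<Rightarrow> 'a measure"
  assumes E_open: "open E" and E_nonempty: "E \<noteq> {}"
    and flow_measurable:
      "(\<lambda>(\<xi>, t). \<Phi> \<xi> t) \<in> borel_measurable (restrict_space borel (E \<times> {0..}))"
    and flow_closure: "\<xi> \<in> E \<Longrightarrow> 0 \<le> t \<Longrightarrow> \<Phi> \<xi> t \<in> closure E"
    and flow_add:
      "\<xi> \<in> E \<Longrightarrow> 0 \<le> t \<Longrightarrow> 0 \<le> s \<Longrightarrow> \<Phi> \<xi> t \<in> E \<Longrightarrow> \<Phi> \<xi> (t + s) = \<Phi> (\<Phi> \<xi> t) s"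
    and rate_measurable: "rate \<in> borel_measurable (restrict_space borel (closure E))"
    and rate_nonneg: "\<xi> \<in> closure E \<Longrightarrow> 0 \<le> rate \<xi>"
    and rate_integrable:
      "\<xi> \<in> E \<Longrightarrow> \<exists>\<epsilon>>0. set_integrable lborel {0..\<epsilon>} (\<lambda>s. rate (\<Phi> \<xi> s))"
    and Q_kernel:
      "Q \<in> restrict_space borel (closure E) \<rightarrow>\<^sub>M prob_algebra (restrict_space borel (closure E))"
    and Q_jump: "\<xi> \<in> closure E \<Longrightarrow> measure (Q \<xi>) (closure E - {\<xi>}) = 1"
    and Q_E: "\<xi> \<in> closure E \<Longrightarrow> measure (Q \<xi>) E = 1"
begin

text \<open>Extended real valued, so that the infimum of the empty set is \<open>\<infinity>\<close>.\<close>

definition exit_time :: "'a \<Rightarrow> ereal" where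
  "exit_time \<xi> = Inf (ereal ` {t. 0 < t \<and> \<Phi> \<xi> t \<in> frontier E})"

definition exit_time_real :: "'a \<Rightarrow> real" where
  "exit_time_real \<xi> = real_of_ereal (exit_time \<xi>)"

definition exit_time_set :: "'a set \<Rightarrow> ereal" where
  "exit_time_set A = (INF \<xi>\<in>A. exit_time \<xi>)"

definition rate_flow :: "'a \<Rightarrow> real \<Rightarrow> real" where
  "rate_flow \<xi> t = rate (\<Phi> \<xi> t)"

definition Q_flow :: "'a \<Rightarrow> real \<Rightarrow> 'a measure" where
  "Q_flow \<xi> t = Q (\<Phi> \<xi> t)"

text \<open>The integral is a Bochner integral; it is only meaningful where the rate is integrable
  along the flow, which \<open>regular_pdmp\<close> below guarantees on every \<open>{0..t}\<close>.\<close>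

definition G :: "'a \<Rightarrow> real \<Rightarrow> real" where
  "G \<xi> t = exp (- (LINT s:{0..t}|lborel. rate_flow \<xi> s))"

definition f :: "'a \<Rightarrow> real \<Rightarrow> real" where
  "f \<xi> t = rate_flow \<xi> t * G \<xi> t"

definition C1 :: "'a set set" where
  "C1 = {B. B \<in> sets borel \<and> B \<subseteq> E \<and> interior B \<noteq> {}}"

definition C2 :: "'a set set" where
  "C2 = {A \<in> C1. compact (closure A) \<and> closure A \<inter> frontier E = {}}"

text \<open>\<open>diameter\<close> is unspecified for unbounded sets, hence the conjunct \<open>bounded (B k)\<close>.\<close>

definition fine_family :: "real \<Rightarrow> nat \<Rightarrow> (nat \<Rightarrow> 'a set) \<Rightarrow> bool" where
  "fine_family e p B \<longleftrightarrow>
     2 \<le> p \<and>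
     (\<forall>k\<in>{1..p}. B k \<in> C1 \<and> bounded (B k) \<and> diameter (B k) < e
        \<and> diameter (B k) \<le> diameter (B 1)) \<and>
     disjoint_family_on B {1..p} \<and>
     (\<forall>x\<in>E. \<forall>t\<ge>0. (\<Sum>k=1..p. measure (Q_flow x t) (B k)) = 1)"

definition admissible :: "nat \<Rightarrow> (nat \<Rightarrow> 'a set) \<Rightarrow> bool" where
  "admissible p B \<longleftrightarrow> (\<exists>e>0. fine_family e p B)"

end

locale regular_pdmp = pdmp E \<Phi> rate Q
  for E :: "'a :: {metric_space, second_countable_topology} set" and \<Phi> rate Q +
  fixes \<mu> :: "'a measure"
    and Qd :: "'a \<Rightarrow> real \<Rightarrow> 'a \<Rightarrow> real"
  assumes exit_time_measurable: "exit_time \<in> borel_measurable (restrict_space borel E)"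
    and sets_\<mu>: "sets \<mu> = sets (restrict_space borel E)"
    and \<mu>_pos: "B \<in> sets \<mu> \<Longrightarrow> interior B \<noteq> {} \<Longrightarrow> 0 < emeasure \<mu> B"
    and Qd_measurable:
      "(\<lambda>(\<xi>, s, y). Qd \<xi> s y) \<in> borel_measurable (restrict_space borel (E \<times> {0..} \<times> E))"
    and Qd_density:
      "\<xi> \<in> E \<Longrightarrow> 0 \<le> s \<Longrightarrow> B \<in> sets \<mu> \<Longrightarrow>
         emeasure (Q_flow \<xi> s) B = (\<integral>\<^sup>+ y\<in>B. ennreal (Qd \<xi> s y) \<partial>\<mu>)"
    and Qd_continuous: "x \<in> E \<Longrightarrow> y \<in> E \<Longrightarrow> continuous_on {0..} (\<lambda>s. Qd x s y)"
    and Qd_lower_bound: "\<exists>m>0. \<forall>x\<in>E. \<forall>s\<ge>0. \<forall>y\<in>E. m \<le> Qd x s y"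
    and fine_families: "\<forall>e>0. \<exists>p B. fine_family e p B"
    and f_pos: "\<xi> \<in> E \<Longrightarrow> 0 \<le> t \<Longrightarrow> 0 < f \<xi> t"
    and f_continuous: "\<xi> \<in> E \<Longrightarrow> continuous_on {0..} (f \<xi>)"
    and rate_dominated:
      "\<exists>M. (\<forall>t\<ge>0. 0 \<le> M t) \<and> (\<forall>T\<ge>0. set_integrable lborel {0..T} M) \<and>
           (\<forall>\<xi>\<in>E. \<forall>t\<ge>0. rate_flow \<xi> t \<le> M t)"
    and exit_time_bounded: "\<exists>C. \<forall>\<xi>\<in>E. exit_time \<xi> \<le> ereal C"
    and fQd_Lipschitz:
      "\<exists>L. \<forall>x\<in>E. \<forall>y\<in>E. \<forall>u\<in>E. \<forall>v\<in>E. \<forall>t\<ge>0.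
         ereal t < min (exit_time x) (exit_time u) \<longrightarrow>
         \<bar>f x t * Qd x t y - f u t * Qd u t v\<bar> \<le> L * (dist x u + dist y v)"
    and f_Lipschitz: "\<exists>L. \<forall>x\<in>E. \<forall>y\<in>E. \<forall>t\<ge>0. \<bar>f x t - f y t\<bar> \<le> L * dist x y"
    and GQd_Lipschitz:
      "\<exists>L. \<forall>x\<in>E. \<forall>y\<in>E. \<forall>u\<in>E. \<forall>v\<in>E.
         \<bar>G x (exit_time_real x) * Qd x (exit_time_real x) y
            - G u (exit_time_real u) * Qd u (exit_time_real u) v\<bar> \<le> L * (dist x u + dist y v)"
    and f_bounded: "\<exists>C. \<forall>\<xi>\<in>E. \<forall>t\<ge>0. \<bar>f \<xi> t\<bar> \<le> C"
    and Qd_bounded: "\<exists>C. \<forall>x\<in>E. \<forall>s\<ge>0. \<forall>y\<in>E. \<bar>Qd x s y\<bar> \<le> C"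
begin

definition hazard :: "'a \<Rightarrow> 'a \<Rightarrow> real \<Rightarrow> real" where
  "hazard x y t =
     f x t * Qd x t y /
     ((LINT s:{t..exit_time_real x}|lborel. f x s * Qd x s y)
        + G x (exit_time_real x) * Qd x (exit_time_real x) y)"

definition survival :: "'a \<Rightarrow> 'a \<Rightarrow> real \<Rightarrow> real" where
  "survival x y t = exp (- (LINT s:{0..t}|lborel. hazard x y s))"

end

text \<open>The \<open>\<sigma>\<close>-algebra generated by \<open>(Z\<^sub>0, S\<^sub>0), \<dots>, (Z\<^sub>n, S\<^sub>n)\<close>,
  and the one generated by these and \<open>S\<^sub>n\<^sub>+\<^sub>1\<close>.\<close>

definition past ::
  "'w measure \<Rightarrow> (nat \<Rightarrow> 'w \<Rightarrow> 'a :: topological_space) \<Rightarrow> (nat \<Rightarrow> 'w \<Rightarrow> real) \<Rightarrow> nat \<Rightarrow> 'w measure"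
where
  "past M Z S n =
     vimage_algebra (space M) (\<lambda>\<omega>. \<lambda>i\<in>{..n}. (Z i \<omega>, S i \<omega>)) (\<Pi>\<^sub>M i\<in>{..n}. borel \<Otimes>\<^sub>M borel)"

definition past_next_time ::
  "'w measure \<Rightarrow> (nat \<Rightarrow> 'w \<Rightarrow> 'a :: topological_space) \<Rightarrow> (nat \<Rightarrow> 'w \<Rightarrow> real) \<Rightarrow> nat \<Rightarrow> 'w measure"
where
  "past_next_time M Z S n =
     vimage_algebra (space M) (\<lambda>\<omega>. (\<lambda>i\<in>{..n}. (Z i \<omega>, S i \<omega>), S (Suc n) \<omega>))
       ((\<Pi>\<^sub>M i\<in>{..n}. borel \<Otimes>\<^sub>M borel) \<Otimes>\<^sub>M borel)"

text \<open>\<open>P x\<close> is the law under which the embedded chain starts from \<open>x\<close>.\<close>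

locale embedded_chain = regular_pdmp E \<Phi> rate Q \<mu> Qd
  for E :: "'a :: {metric_space, second_countable_topology} set" and \<Phi> rate Q \<mu> Qd +
  fixes P :: "'a \<Rightarrow> 'w measure"
    and Z :: "nat \<Rightarrow> 'w \<Rightarrow> 'a"
    and S :: "nat \<Rightarrow> 'w \<Rightarrow> real"
  assumes P_prob: "x \<in> E \<Longrightarrow> prob_space (P x)"
    and Z_measurable: "x \<in> E \<Longrightarrow> Z n \<in> P x \<rightarrow>\<^sub>M restrict_space borel E"
    and S_measurable: "x \<in> E \<Longrightarrow> S n \<in> borel_measurable (P x)"
    and S_nonneg: "x \<in> E \<Longrightarrow> \<omega> \<in> space (P x) \<Longrightarrow> 0 \<le> S n \<omega>"
    and Z_initial: "x \<in> E \<Longrightarrow> AE \<omega> in P x. Z 0 \<omega> = x"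
    and S_initial: "x \<in> E \<Longrightarrow> AE \<omega> in P x. S 0 \<omega> = 0"
    and S_cond_law:
      "x \<in> E \<Longrightarrow> 0 \<le> t \<Longrightarrow>
         AE \<omega> in P x.
           real_cond_exp (P x) (past (P x) Z S n) (indicator {\<omega> \<in> space (P x). t < S (Suc n) \<omega>}) \<omega>
           = (if ereal t < exit_time (Z n \<omega>) then G (Z n \<omega>) t else 0)"
    and Z_cond_law:
      "x \<in> E \<Longrightarrow> B \<in> sets (restrict_space borel E) \<Longrightarrow>
         AE \<omega> in P x.
           real_cond_exp (P x) (past_next_time (P x) Z S n)
             (indicator {\<omega> \<in> space (P x). Z (Suc n) \<omega> \<in> B}) \<omega>
           = measure (Q_flow (Z n \<omega>) (S (Suc n) \<omega>)) B"
begin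

definition R :: "'a \<Rightarrow> 'a measure" where
  "R x = distr (P x) (restrict_space borel E) (Z 1)"

definition invariant_prob :: "'a measure \<Rightarrow> bool" where
  "invariant_prob \<eta> \<longleftrightarrow>
     sets \<eta> = sets (restrict_space borel E) \<and> prob_space \<eta> \<and>
     (\<forall>B\<in>sets \<eta>. emeasure \<eta> B = (\<integral>\<^sup>+ x. emeasure (R x) B \<partial>\<eta>))"

text \<open>The locale assumptions imply that exactly one invariant probability exists.\<close>

definition \<nu> :: "'a measure" where
  "\<nu> = (THE \<eta>. invariant_prob \<eta>)"

text \<open>The measure \<open>\<nu>(dx) R(x, dy)\<close> on \<open>E \<times> E\<close>.\<close>

definition \<nu>2 :: "('a \<times> 'a) measure" where
  "\<nu>2 = \<nu> \<bind> (\<lambda>x. distr (R x) (restrict_space borel E \<Otimes>\<^sub>M restrict_space borel E) (\<lambda>y. (x, y)))"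

definition l :: "'a set \<Rightarrow> 'a set \<Rightarrow> real \<Rightarrow> real" where
  "l A B t =
     (LINT (u, v):A \<times> B|\<nu>2. hazard u v t * survival u v t) / (LINT (u, v):A \<times> B|\<nu>2. survival u v t)"

end

definition at_risk ::
  "(nat \<Rightarrow> 'w \<Rightarrow> 'a) \<Rightarrow> (nat \<Rightarrow> 'w \<Rightarrow> real) \<Rightarrow> nat \<Rightarrow> 'a set \<Rightarrow> 'a set \<Rightarrow> real \<Rightarrow> 'w \<Rightarrow> real"
where
  "at_risk Z S n A B t \<omega> =
     (\<Sum>i<n. of_bool (t \<le> S (Suc i) \<omega>) * of_bool (Z i \<omega> \<in> A) * of_bool (Z (Suc i) \<omega> \<in> B))"

definition at_risk_inv ::
  "(nat \<Rightarrow> 'w \<Rightarrow> 'a) \<Rightarrow> (nat \<Rightarrow> 'w \<Rightarrow> real) \<Rightarrow> nat \<Rightarrow> 'a set \<Rightarrow> 'a set \<Rightarrow> real \<Rightarrow> 'w \<Rightarrow> real"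
where
  "at_risk_inv Z S n A B t \<omega> =
     (if at_risk Z S n A B t \<omega> \<noteq> 0 then 1 / at_risk Z S n A B t \<omega> else 0)"

definition l_hat ::
  "(real \<Rightarrow> real) \<Rightarrow> (nat \<Rightarrow> 'w \<Rightarrow> 'a) \<Rightarrow> (nat \<Rightarrow> 'w \<Rightarrow> real) \<Rightarrow> nat \<Rightarrow> real \<Rightarrow> real \<Rightarrow>
     'a set \<Rightarrow> 'a set \<Rightarrow> real \<Rightarrow> 'w \<Rightarrow> real"
where
  "l_hat K Z S n b t A B s \<omega> =
     1 / b * (\<Sum>i<n. K ((s - S (Suc i) \<omega>) / b) * at_risk_inv Z S n A B (S (Suc i) \<omega>) \<omega>
        * of_bool (S (Suc i) \<omega> \<le> t) * of_bool (Z i \<omega> \<in> A) * of_bool (Z (Suc i) \<omega> \<in> B))"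

definition smoothing_kernel :: "(real \<Rightarrow> real) \<Rightarrow> bool" where
  "smoothing_kernel K \<longleftrightarrow>
     continuous_on UNIV K \<and> (\<forall>u. u \<notin> {-1..1} \<longrightarrow> K u = 0) \<and>
     integrable lborel K \<and> (LINT u|lborel. K u) = 1"

text \<open>Extended real valued random variables are allowed so that suprema need no boundedness proviso.
  Measurability is part of the notion, since \<open>measure\<close> vanishes on non-measurable sets.\<close>

definition tendsto_zero_in_prob :: "'w measure \<Rightarrow> (nat \<Rightarrow> 'w \<Rightarrow> ereal) \<Rightarrow> bool" where
  "tendsto_zero_in_prob M X \<longleftrightarrow>
     (\<forall>n. X n \<in> borel_measurable M) \<and>
     (\<forall>\<epsilon>>0. (\<lambda>n. measure M {\<omega> \<in> space M. ereal \<epsilon> < \<bar>X n \<omega>\<bar>}) \<longlonglongrightarrow> 0)"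

end

theory Submission
  imports Defs
begin

text \<open>
  The lower bound on the density of \<open>Q\<close> gives the embedded chain a transition density that is bounded
  below, so that the Poisson equation is solved by a geometric series. Every additive functional of
  the triples \<open>(Z\<^sub>i, S\<^sub>i\<^sub>+\<^sub>1, Z\<^sub>i\<^sub>+\<^sub>1)\<close> is therefore a martingale up to a bounded error, and its averages
  converge in probability to their stationary mean.

  Let \<open>r x y\<close> be the density of \<open>R\<close>. The conditional survival function times \<open>r x y\<close> is the joint
  density of \<open>S\<^sub>1 \<ge> u\<close> and \<open>Z\<^sub>1 = y\<close>. Hence \<open>l A B = n / Y\<close>, where \<open>Y u\<close> is the stationary
  probability of \<open>Z\<^sub>0 \<in> A, Z\<^sub>1 \<in> B, S\<^sub>1 \<ge> u\<close> and \<open>n\<close> is the corresponding density of \<open>S\<^sub>1\<close>.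
  For a fixed bandwidth \<open>b\<close>, the at-risk process divided by the sample size converges uniformly to
  \<open>Y\<close> by monotonicity, and the estimator converges uniformly to the convolution of \<open>l A B\<close> with the
  rescaled kernel, because the kernel is uniformly continuous and finitely many evaluation points
  suffice. The convolution tends to \<open>l A B\<close> as \<open>b\<close> tends to zero, and a bandwidth that decreases
  slowly enough combines the two limits.
\<close>

section \<open>Conditional laws\<close>

text \<open>The obstacle is the law of the first jump time: it has an atom at the exit time, so
  together with the next location it has no density for Lebesgue measure times \<open>\<mu>\<close>.
  Spreading the atom over an interval of length one and folding it back with
  \<open>min s (exit x)\<close> restores a density, after which expectations over one step are
  ordinary integrals and Fubini applies. Since \<open>t\<close> precedes every exit time on
  \<open>A\<close>, the atom adds to the at-risk mean only a term constant in time on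
  \<open>{0..t}\<close> and never meets the smoothing kernel. The chain starts at a fixed
  \<open>x\<close>, not in equilibrium; the martingale from the Poisson equation has bounded
  orthogonal increments whatever the start, so Chebyshev's inequality suffices. The estimator
  divides by a random count. The stationary at-risk mean is decreasing and positive at
  \<open>t\<close>, because \<open>A\<close> and \<open>B\<close> have interior, and this lower
  bound on \<open>{0..t}\<close> controls the division uniformly. No rate is tracked for fixed
  bandwidths, so the final bandwidth comes from a diagonal choice and is deterministic.\<close>

lemma (in prob_space) nn_integral_cond_law:
  assumes sub: "subalgebra M F" and X: "X \<in> F \<rightarrow>\<^sub>M N1" and Y: "Y \<in> M \<rightarrow>\<^sub>M N2"
    and \<kappa>: "\<kappa> \<in> N1 \<rightarrow>\<^sub>M prob_algebra N2"
    and gen: "sets N2 = sigma_sets (space N2) \<G>" "\<G> \<subseteq> Pow (space N2)" "Int_stable \<G>" "space N2 \<in> \<G>"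
    and cond: "\<And>C. C \<in> \<G> \<Longrightarrow>
      AE \<omega> in M. real_cond_exp M F (indicator {\<omega> \<in> space M. Y \<omega> \<in> C}) \<omega> = measure (\<kappa> (X \<omega>)) C"
    and B: "B \<in> sets F" and h[measurable]: "h \<in> borel_measurable (N1 \<Otimes>\<^sub>M N2)"
  shows "(\<integral>\<^sup>+\<omega>\<in>B. h (X \<omega>, Y \<omega>) \<partial>M) = (\<integral>\<^sup>+\<omega>\<in>B. (\<integral>\<^sup>+y. h (X \<omega>, y) \<partial>\<kappa> (X \<omega>)) \<partial>M)"
proof -
  interpret F: finite_measure_subalgebra M F
    using sub by unfold_locales
  have BM[measurable]: "B \<in> sets M" using sub B by (auto simp: subalgebra_def)
  have XM[measurable]: "X \<in> M \<rightarrow>\<^sub>M N1"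
    using X sub by (rule measurable_from_subalg[rotated])
  note Y[measurable]
  have \<kappa>'[measurable]: "\<kappa> \<in> N1 \<rightarrow>\<^sub>M subprob_algebra N2"
    using \<kappa> by (rule measurable_prob_algebraD)
  have sets_\<kappa>: "sets (\<kappa> x) = sets N2" if "x \<in> space N1" for x
    using \<kappa>' that by (rule sets_kernel)
  \<comment> \<open>The event \<open>B\<close> is absorbed into the measure: it need not be a
    function of \<open>X\<close>, so it cannot be encoded in \<open>h\<close>.\<close>
  define MB where "MB = density M (indicator B)"
  have [measurable_cong, simp]: "sets MB = sets M" and [simp]: "space MB = space M"
    by (auto simp: MB_def)
  define K where "K = (\<lambda>x. distr (\<kappa> x) (N1 \<Otimes>\<^sub>M N2) (Pair x))"
  have K[measurable]: "K \<in> N1 \<rightarrow>\<^sub>M subprob_algebra (N1 \<Otimes>\<^sub>M N2)"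
    unfolding K_def by (rule measurable_distr2[OF _ \<kappa>']) simp
  define m1 where "m1 = distr MB (N1 \<Otimes>\<^sub>M N2) (\<lambda>\<omega>. (X \<omega>, Y \<omega>))"
  define m2 where "m2 = distr MB N1 X \<bind> K"
  have ne: "space N1 \<noteq> {}"
    using not_empty measurable_space[OF XM] by auto
  have rect1: "emeasure m1 (A \<times> C) = emeasure M (B \<inter> X -` A \<inter> Y -` C \<inter> space M)"
    if [measurable]: "A \<in> sets N1" "C \<in> sets N2" for A C
  proof -
    have "emeasure m1 (A \<times> C) = emeasure MB ((\<lambda>\<omega>. (X \<omega>, Y \<omega>)) -` (A \<times> C) \<inter> space M)"
      unfolding m1_def by (subst emeasure_distr) auto
    also have "\<dots> = (\<integral>\<^sup>+\<omega>. indicator B \<omega> * indicator ((\<lambda>\<omega>. (X \<omega>, Y \<omega>)) -` (A \<times> C) \<inter> space M) \<omega> \<partial>M)"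
      unfolding MB_def by (subst emeasure_density) auto
    also have "\<dots> = (\<integral>\<^sup>+\<omega>. indicator (B \<inter> X -` A \<inter> Y -` C \<inter> space M) \<omega> \<partial>M)"
      by (intro nn_integral_cong) (auto split: split_indicator)
    also have "\<dots> = emeasure M (B \<inter> X -` A \<inter> Y -` C \<inter> space M)"
      by (rule nn_integral_indicator) (use BM in \<open>auto intro!: sets.Int simp: Int_assoc[symmetric]\<close>, measurable)
    finally show ?thesis .
  qed
  have rect2: "emeasure m2 (A \<times> C) = (\<integral>\<^sup>+\<omega>. indicator (B \<inter> X -` A) \<omega> * emeasure (\<kappa> (X \<omega>)) C \<partial>M)"
    if [measurable]: "A \<in> sets N1" "C \<in> sets N2" for A C
  proof -
    have Kx: "emeasure (K x) (A \<times> C) = indicator A x * emeasure (\<kappa> x) C" if "x \<in> space N1" for x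
    proof -
      have [simp]: "space (\<kappa> x) = space N2" using sets_\<kappa>[OF that] by (rule sets_eq_imp_space_eq)
      have [measurable_cong]: "sets (\<kappa> x) = sets N2" by (rule sets_\<kappa>[OF that])
      have "emeasure (K x) (A \<times> C) = emeasure (\<kappa> x) (Pair x -` (A \<times> C) \<inter> space (\<kappa> x))"
        unfolding K_def using that by (subst emeasure_distr) auto
      also have "Pair x -` (A \<times> C) \<inter> space (\<kappa> x) = (if x \<in> A then C else {})"
        using sets.sets_into_space[OF \<open>C \<in> sets N2\<close>] by auto
      finally show ?thesis by auto
    qed
    have "emeasure m2 (A \<times> C) = (\<integral>\<^sup>+x. emeasure (K x) (A \<times> C) \<partial>distr MB N1 X)"
      unfolding m2_def using ne by (intro emeasure_bind[where N="N1 \<Otimes>\<^sub>M N2"]) auto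
    also have "\<dots> = (\<integral>\<^sup>+\<omega>. emeasure (K (X \<omega>)) (A \<times> C) \<partial>MB)"
      by (subst nn_integral_distr) auto
    also have "\<dots> = (\<integral>\<^sup>+\<omega>. indicator B \<omega> * emeasure (K (X \<omega>)) (A \<times> C) \<partial>M)"
      unfolding MB_def by (subst nn_integral_density) auto
    also have "\<dots> = (\<integral>\<^sup>+\<omega>. indicator (B \<inter> X -` A) \<omega> * emeasure (\<kappa> (X \<omega>)) C \<partial>M)"
      using measurable_space[OF XM] by (intro nn_integral_cong) (auto simp: Kx split: split_indicator)
    finally show ?thesis .
  qed
  \<comment> \<open>The null sets in \<open>cond\<close> depend on \<open>C\<close>, so an almost
    sure identity of whole kernels is not at hand; the two laws of the pair are compared on
    rectangles over a pi-system instead. As \<open>space N2\<close> belongs to \<open>\<G>\<close>,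
    the full rectangle is itself a generator, and its finite mass gives uniqueness.\<close>
  have m12: "m1 = m2"
  proof (rule measure_eqI_generator_eq[where E="{a \<times> b | a b. a \<in> sets N1 \<and> b \<in> \<G>}"
        and \<Omega>="space N1 \<times> space N2" and A="\<lambda>_. space N1 \<times> space N2"])
    show "Int_stable {a \<times> b |a b. a \<in> sets N1 \<and> b \<in> \<G>}"
      using gen(3) unfolding Int_stable_def
      by (auto simp: Times_Int_Times) (metis sets.Int)
    show sub': "{a \<times> b |a b. a \<in> sets N1 \<and> b \<in> \<G>} \<subseteq> Pow (space N1 \<times> space N2)"
      using gen(2) by (auto dest: sets.sets_into_space)
    have "sets (N1 \<Otimes>\<^sub>M N2) = sets (sigma (space N1 \<times> space N2) {a \<times> b | a b. a \<in> sets N1 \<and> b \<in> \<G>})"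
      by (rule sets_pair_eq[where Ca="{space N1}" and Cb="{space N2}"])
        (use gen in \<open>auto simp: sets.sigma_sets_eq dest: sets.sets_into_space\<close>)
    then have *: "sets (N1 \<Otimes>\<^sub>M N2) = sigma_sets (space N1 \<times> space N2) {a \<times> b | a b. a \<in> sets N1 \<and> b \<in> \<G>}"
      using sub' by (simp add: sets_measure_of)
    show "sets m1 = sigma_sets (space N1 \<times> space N2) {a \<times> b | a b. a \<in> sets N1 \<and> b \<in> \<G>}"
      using * by (simp add: m1_def)
    have "sets m2 = sets (N1 \<Otimes>\<^sub>M N2)"
      unfolding m2_def using ne by (intro sets_bind) (auto simp: K_def)
    then show "sets m2 = sigma_sets (space N1 \<times> space N2) {a \<times> b | a b. a \<in> sets N1 \<and> b \<in> \<G>}"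
      using * by simp
    show "range (\<lambda>_::nat. space N1 \<times> space N2) \<subseteq> {a \<times> b |a b. a \<in> sets N1 \<and> b \<in> \<G>}"
      using gen(4) by auto
    show "emeasure m1 (space N1 \<times> space N2) \<noteq> \<infinity>"
      by (subst rect1) auto
    fix U assume "U \<in> {a \<times> b |a b. a \<in> sets N1 \<and> b \<in> \<G>}"
    then obtain A C where U: "U = A \<times> C" and A[measurable]: "A \<in> sets N1" and C: "C \<in> \<G>" by auto
    have [measurable]: "C \<in> sets N2" using C gen(1) by auto
    \<comment> \<open>Because \<open>X\<close> is measurable for \<open>F\<close>, the set
      \<open>?B\<close> is an event of \<open>F\<close>, so the conditional expectation of the
      indicator may be integrated over it.\<close>
    let ?B = "B \<inter> X -` A \<inter> space M" let ?I = "{\<omega> \<in> space M. Y \<omega> \<in> C}"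
    have spF: "space F = space M" using sub by (simp add: subalgebra_def)
    have BF: "?B \<in> sets F"
      using B measurable_sets[OF X A] spF by (metis Int_assoc sets.Int)
    have BM': "?B \<in> sets M" using BF sub by (auto simp: subalgebra_def)
    have IM[measurable]: "?I \<in> sets M" by measurable
    have e: "AE \<omega> in M. real_cond_exp M F (indicator ?I) \<omega> = measure (\<kappa> (X \<omega>)) C"
      using cond[OF C] .
    have int: "integrable M (indicator ?I :: _ \<Rightarrow> real)"
      using IM by (auto simp: emeasure_eq_measure)
    have prob: "prob_space (\<kappa> (X \<omega>))" if "\<omega> \<in> space M" for \<omega>
      using measurable_space[OF \<kappa> measurable_space[OF XM that]] by (simp add: space_prob_algebra)
    have "ennreal (measure M (?B \<inter> ?I)) = ennreal (\<integral>\<omega>\<in>?B. indicator ?I \<omega> \<partial>M)"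
      using BM' IM by (simp add: set_lebesgue_integral_def indicator_inter_arith[symmetric] inf_commute Int_assoc)
    also have "(\<integral>\<omega>\<in>?B. indicator ?I \<omega> \<partial>M) = (\<integral>\<omega>\<in>?B. real_cond_exp M F (indicator ?I) \<omega> \<partial>M)"
      by (rule F.real_cond_exp_intA[OF int BF])
    also have "\<dots> = (\<integral>\<omega>. indicator ?B \<omega> * measure (\<kappa> (X \<omega>)) C \<partial>M)"
      unfolding set_lebesgue_integral_def using e BM' by (intro integral_cong_AE) auto
    also have "ennreal \<dots> = (\<integral>\<^sup>+\<omega>. ennreal (indicator ?B \<omega> * measure (\<kappa> (X \<omega>)) C) \<partial>M)"
    proof (rule nn_integral_eq_integral[symmetric])
      have "(\<lambda>\<omega>. measure (\<kappa> (X \<omega>)) C) \<in> borel_measurable M"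
        unfolding measure_def by measurable
      then show "integrable M (\<lambda>\<omega>. indicator ?B \<omega> * measure (\<kappa> (X \<omega>)) C)"
        using BM' prob by (intro integrable_const_bound[where B=1])
          (auto simp: prob_space.prob_le_1 split: split_indicator)
    qed auto
    also have "\<dots> = (\<integral>\<^sup>+\<omega>. indicator (B \<inter> X -` A) \<omega> * emeasure (\<kappa> (X \<omega>)) C \<partial>M)"
      using prob by (intro nn_integral_cong)
        (auto simp: finite_measure.emeasure_eq_measure prob_space.finite_measure split: split_indicator)
    also have "\<dots> = emeasure m2 U"
      using U rect2 by simp
    finally show "emeasure m1 U = emeasure m2 U"
      unfolding U by (subst rect1) (auto simp: emeasure_eq_measure Int_assoc Int_def conj_commute conj_left_commute intro!: arg_cong[where f="measure M"])
  qed simp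
  have "(\<integral>\<^sup>+\<omega>\<in>B. h (X \<omega>, Y \<omega>) \<partial>M) = (\<integral>\<^sup>+\<omega>. h (X \<omega>, Y \<omega>) \<partial>MB)"
    unfolding MB_def by (subst nn_integral_density) (auto simp: mult.commute)
  also have "\<dots> = (\<integral>\<^sup>+p. h p \<partial>m1)"
    unfolding m1_def by (subst nn_integral_distr) auto
  also have "\<dots> = (\<integral>\<^sup>+x. \<integral>\<^sup>+p. h p \<partial>K x \<partial>distr MB N1 X)"
    unfolding m12 m2_def by (rule nn_integral_bind[where B="N1 \<Otimes>\<^sub>M N2"]) auto
  also have "\<dots> = (\<integral>\<^sup>+\<omega>. \<integral>\<^sup>+p. h p \<partial>K (X \<omega>) \<partial>MB)"
    by (subst nn_integral_distr) auto
  also have "\<dots> = (\<integral>\<^sup>+\<omega>. \<integral>\<^sup>+y. h (X \<omega>, y) \<partial>\<kappa> (X \<omega>) \<partial>MB)"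
  proof (intro nn_integral_cong)
    fix \<omega> assume "\<omega> \<in> space MB"
    then have *: "X \<omega> \<in> space N1" using measurable_space[OF XM] by simp
    have [measurable_cong]: "sets (\<kappa> (X \<omega>)) = sets N2" by (rule sets_\<kappa>[OF *])
    show "(\<integral>\<^sup>+p. h p \<partial>K (X \<omega>)) = (\<integral>\<^sup>+y. h (X \<omega>, y) \<partial>\<kappa> (X \<omega>))"
      unfolding K_def using * by (subst nn_integral_distr) auto
  qed
  also have "\<dots> = (\<integral>\<^sup>+\<omega>\<in>B. (\<integral>\<^sup>+y. h (X \<omega>, y) \<partial>\<kappa> (X \<omega>)) \<partial>M)"
  proof -
    have "(\<lambda>x. \<integral>\<^sup>+y. h (x, y) \<partial>\<kappa> x) \<in> borel_measurable N1"
      by (rule nn_integral_measurable_subprob_algebra2[OF _ \<kappa>']) simp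
    then have "(\<lambda>\<omega>. \<integral>\<^sup>+y. h (X \<omega>, y) \<partial>\<kappa> (X \<omega>)) \<in> borel_measurable M"
      by (rule measurable_compose[OF XM])
    then show ?thesis
      unfolding MB_def by (subst nn_integral_density) (auto simp: mult.commute)
  qed
  finally show ?thesis .
qed

section \<open>Transition densities bounded below\<close>

text \<open>Doeblin's condition: every row dominates the same measure, \<open>m\<close> times
  \<open>\<mu>\<close>, so that each step forgets a fixed fraction of its starting point.\<close>

locale minorized_kernel = finite_measure \<mu> for \<mu> :: "'b measure" +
  fixes r :: "'b \<Rightarrow> 'b \<Rightarrow> real" and m :: real
  assumes kernel_measurable: "case_prod r \<in> borel_measurable (\<mu> \<Otimes>\<^sub>M \<mu>)"
    and m_pos: "0 < m"
    and kernel_lower: "x \<in> space \<mu> \<Longrightarrow> y \<in> space \<mu> \<Longrightarrow> m \<le> r x y"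
    and kernel_total: "x \<in> space \<mu> \<Longrightarrow> (\<integral>\<^sup>+y. ennreal (r x y) \<partial>\<mu>) = 1"
    and space_nonempty: "space \<mu> \<noteq> {}"
begin

lemma measurable_kernel[measurable (raw)]:
  assumes "X \<in> N \<rightarrow>\<^sub>M \<mu>" "Y \<in> N \<rightarrow>\<^sub>M \<mu>"
  shows "(\<lambda>\<omega>. r (X \<omega>) (Y \<omega>)) \<in> borel_measurable N"
  using measurable_compose[OF measurable_Pair[OF assms] kernel_measurable] by simp

lemma kernel_nonneg: "x \<in> space \<mu> \<Longrightarrow> y \<in> space \<mu> \<Longrightarrow> 0 \<le> r x y"
  using kernel_lower m_pos by (meson less_imp_le order_trans)

lemma kernel_integrable: "x \<in> space \<mu> \<Longrightarrow> integrable \<mu> (r x)"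
  using kernel_total[of x] kernel_nonneg
  by (intro integrableI_nonneg) (auto simp: AE_I2)

lemma kernel_integral: "x \<in> space \<mu> \<Longrightarrow> (\<integral>y. r x y \<partial>\<mu>) = 1"
  using kernel_total[of x] kernel_nonneg
  by (subst integral_eq_nn_integral) (auto simp: AE_I2)

text \<open>What a row keeps after the common part \<open>m\<close> is removed. It is the same for
  all rows because each has mass one, and it is the norm of the residual kernel on bounded
  functions.\<close>

definition contraction :: real where
  "contraction = 1 - m * measure \<mu> (space \<mu>)"

lemma residual_integral: "x \<in> space \<mu> \<Longrightarrow> (\<integral>y. r x y - m \<partial>\<mu>) = contraction"
  unfolding contraction_def using kernel_integrable kernel_integral by (simp add: mult.commute)

lemma measure_space_pos: "0 < measure \<mu> (space \<mu>)"
proof (rule ccontr)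
  assume "\<not> 0 < measure \<mu> (space \<mu>)"
  then have "emeasure \<mu> (space \<mu>) = 0"
    using measure_nonneg[of \<mu> "space \<mu>"] by (simp add: emeasure_eq_measure)
  then have "AE y in \<mu>. False"
    by (intro AE_I[of _ _ "space \<mu>"]) auto
  moreover obtain x where "x \<in> space \<mu>" using space_nonempty by auto
  ultimately have "(\<integral>\<^sup>+y. ennreal (r x y) \<partial>\<mu>) = (\<integral>\<^sup>+y. 0 \<partial>\<mu>)"
    by (intro nn_integral_cong_AE) auto
  then show False using kernel_total[OF \<open>x \<in> space \<mu>\<close>] by simp
qed

lemma contraction_nonneg: "0 \<le> contraction"
proof -
  obtain x where x: "x \<in> space \<mu>" using space_nonempty by auto
  show ?thesis
    unfolding residual_integral[OF x, symmetric] using kernel_lower x by (intro Bochner_Integration.integral_nonneg) auto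
qed

lemma contraction_less_1: "contraction < 1"
  unfolding contraction_def using m_pos measure_space_pos by simp

lemma integrable_residual_mult:
  assumes "x \<in> space \<mu>" and [measurable]: "g \<in> borel_measurable \<mu>"
    and g: "\<And>y. y \<in> space \<mu> \<Longrightarrow> \<bar>g y\<bar> \<le> C"
  shows "integrable \<mu> (\<lambda>y. (r x y - m) * g y)"
    and "\<bar>\<integral>y. (r x y - m) * g y \<partial>\<mu>\<bar> \<le> contraction * C"
proof -
  have b: "\<bar>(r x y - m) * g y\<bar> \<le> (r x y - m) * C" if "y \<in> space \<mu>" for y
    using g[OF that] kernel_lower[OF assms(1) that] by (simp add: abs_mult mult_left_mono)
  have i: "integrable \<mu> (\<lambda>y. (r x y - m) * C)"
    using kernel_integrable[OF assms(1)] by simp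
  show int: "integrable \<mu> (\<lambda>y. (r x y - m) * g y)"
    by (rule Bochner_Integration.integrable_bound[OF i])
      (use assms(1) b in \<open>auto intro!: AE_I2 order_trans[OF _ abs_ge_self]\<close>)
  have "\<bar>\<integral>y. (r x y - m) * g y \<partial>\<mu>\<bar> \<le> (\<integral>y. \<bar>(r x y - m) * g y\<bar> \<partial>\<mu>)"
    by (rule integral_abs_bound)
  also have "\<dots> \<le> (\<integral>y. (r x y - m) * C \<partial>\<mu>)"
    using int i b by (intro integral_mono) auto
  also have "\<dots> = contraction * C"
    using residual_integral[OF assms(1)] by simp
  finally show "\<bar>\<integral>y. (r x y - m) * g y \<partial>\<mu>\<bar> \<le> contraction * C" .
qed

lemma integrable_bounded:
  assumes [measurable]: "g \<in> borel_measurable \<mu>" and "\<And>y. y \<in> space \<mu> \<Longrightarrow> \<bar>g y\<bar> \<le> (C::real)"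
  shows "integrable \<mu> g"
  using assms by (intro integrable_const_bound[where B=C]) auto

section \<open>Neumann series of the residual kernel and the Poisson equation\<close>

primrec residual_iterate :: "('b \<Rightarrow> real) \<Rightarrow> nat \<Rightarrow> 'b \<Rightarrow> real" where
  "residual_iterate H 0 = H"
| "residual_iterate H (Suc k) = (\<lambda>x. \<integral>y. (r x y - m) * residual_iterate H k y \<partial>\<mu>)"

lemma residual_iterate:
  assumes [measurable]: "H \<in> borel_measurable \<mu>" and H: "\<And>x. x \<in> space \<mu> \<Longrightarrow> \<bar>H x\<bar> \<le> C"
  shows "residual_iterate H k \<in> borel_measurable \<mu>
    \<and> (\<forall>x\<in>space \<mu>. \<bar>residual_iterate H k x\<bar> \<le> contraction ^ k * C)"
proof (induction k)
  case 0
  then show ?case using H by simp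
next
  case (Suc k)
  then have [measurable]: "residual_iterate H k \<in> borel_measurable \<mu>" by simp
  have "residual_iterate H (Suc k) \<in> borel_measurable \<mu>"
    by simp
  moreover have "\<bar>residual_iterate H (Suc k) x\<bar> \<le> contraction ^ Suc k * C" if "x \<in> space \<mu>" for x
    using integrable_residual_mult(2)[OF that, of "residual_iterate H k"] Suc by (simp add: mult.assoc)
  ultimately show ?case by blast
qed

text \<open>The Neumann series of the residual kernel \<open>r - m\<close>, whose norm is less than one, solves the
  Poisson equation up to the constant \<open>m \<integral> g d\<mu>\<close>.\<close>

lemma poisson_equation:
  assumes H[measurable]: "H \<in> borel_measurable \<mu>" and bnd: "\<And>x. x \<in> space \<mu> \<Longrightarrow> \<bar>H x\<bar> \<le> C"
  shows "\<exists>g D c. g \<in> borel_measurable \<mu> \<and> (\<forall>x\<in>space \<mu>. \<bar>g x\<bar> \<le> D)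
    \<and> (\<forall>x\<in>space \<mu>. H x - c = g x - (\<integral>y. r x y * g y \<partial>\<mu>))"
proof -
  let ?h = "residual_iterate H"
  let ?\<rho> = "contraction"
  have \<rho>: "0 \<le> ?\<rho>" "?\<rho> < 1" by (rule contraction_nonneg contraction_less_1)+
  note h = residual_iterate[OF H bnd]
  have [measurable]: "?h k \<in> borel_measurable \<mu>" for k using h by blast
  have C: "0 \<le> C" using bnd space_nonempty by fastforce
  have geo: "summable (\<lambda>k. ?\<rho> ^ k * C)"
    using \<rho> by (intro summable_mult2 summable_geometric) auto
  have summ: "summable (\<lambda>k. \<bar>?h k x\<bar>)" if "x \<in> space \<mu>" for x
    using h that by (intro summable_comparison_test'[OF geo, of 0]) auto
  have summ': "summable (\<lambda>k. ?h k x)" if "x \<in> space \<mu>" for x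
    using summ[OF that] by (rule summable_rabs_cancel)
  define g where "g x = (\<Sum>k. ?h k x)" for x
  define D where "D = (\<Sum>k. ?\<rho> ^ k * C)"
  have gm[measurable]: "g \<in> borel_measurable \<mu>"
    unfolding g_def by measurable
  have gb: "\<bar>g x\<bar> \<le> D" if "x \<in> space \<mu>" for x
  proof -
    have "\<bar>g x\<bar> \<le> (\<Sum>k. \<bar>?h k x\<bar>)"
      unfolding g_def by (rule summable_rabs[OF summ[OF that]])
    also have "\<dots> \<le> D"
      unfolding D_def using h that by (intro suminf_le summ geo) auto
    finally show ?thesis .
  qed
  have "H x - m * (\<integral>y. g y \<partial>\<mu>) = g x - (\<integral>y. r x y * g y \<partial>\<mu>)" if x: "x \<in> space \<mu>" for x
  proof -
    have i: "integrable \<mu> (\<lambda>y. (r x y - m) * ?h k y)" for k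
      using h by (intro integrable_residual_mult(1)[OF x, where C="?\<rho> ^ k * C"]) auto
    have eq: "(\<integral>y. (r x y - m) * g y \<partial>\<mu>) = (\<integral>y. (\<Sum>k. (r x y - m) * ?h k y) \<partial>\<mu>)"
      unfolding g_def using summ' by (intro Bochner_Integration.integral_cong) (auto simp: suminf_mult)
    also have "\<dots> = (\<Sum>k. \<integral>y. (r x y - m) * ?h k y \<partial>\<mu>)"
    proof (rule integral_suminf)
      show "AE y in \<mu>. summable (\<lambda>k. norm ((r x y - m) * ?h k y))"
        using summ by (auto intro!: AE_I2 summable_mult simp: abs_mult)
      have "\<bar>\<integral>y. norm ((r x y - m) * ?h k y) \<partial>\<mu>\<bar> \<le> ?\<rho> ^ k * C * ?\<rho>" for k
      proof -
        have "(\<integral>y. norm ((r x y - m) * ?h k y) \<partial>\<mu>) = (\<integral>y. (r x y - m) * \<bar>?h k y\<bar> \<partial>\<mu>)"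
          using kernel_lower[OF x] by (intro Bochner_Integration.integral_cong) (auto simp: abs_mult)
        then show ?thesis
          using integrable_residual_mult(2)[OF x, of "\<lambda>y. \<bar>?h k y\<bar>" "?\<rho> ^ k * C"] h
          by (simp add: mult.commute)
      qed
      then show "summable (\<lambda>k. \<integral>y. norm ((r x y - m) * ?h k y) \<partial>\<mu>)"
        by (intro summable_comparison_test'[OF summable_mult2[OF geo], of 0]) simp
    qed (rule i)
    \<comment> \<open>Integrating an iterate against the residual kernel gives the next one, so what
      remains is the series of \<open>g\<close> without its first term \<open>H\<close>.\<close>
    also have "\<dots> = (\<Sum>k. ?h (Suc k) x)" by simp
    also have "\<dots> = g x - H x"
      unfolding g_def using suminf_minus_initial_segment[OF summ'[OF x], of 1] by simp
    finally have 1: "(\<integral>y. (r x y - m) * g y \<partial>\<mu>) = g x - H x" .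
    have "(\<integral>y. r x y * g y \<partial>\<mu>) = (\<integral>y. (r x y - m) * g y + m * g y \<partial>\<mu>)"
      by (simp add: algebra_simps)
    also have "\<dots> = (\<integral>y. (r x y - m) * g y \<partial>\<mu>) + m * (\<integral>y. g y \<partial>\<mu>)"
      using integrable_residual_mult(1)[OF x gm gb] integrable_bounded[OF gm gb] by simp
    finally show ?thesis using 1 by simp
  qed
  with gm gb show ?thesis by blast
qed

text \<open>An invariant law of mass one satisfies \<open>\<nu> = m \<mu> + \<nu> (r - m)\<close>;
  these are the densities of the terms obtained by iterating this equation. Values in
  \<open>ennreal\<close> allow every exchange of sum and integral without a convergence
  check.\<close>

primrec residual_density :: "nat \<Rightarrow> 'b \<Rightarrow> ennreal" where
  "residual_density 0 = (\<lambda>_. ennreal m)"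
| "residual_density (Suc k) = (\<lambda>y. \<integral>\<^sup>+x. residual_density k x * ennreal (r x y - m) \<partial>\<mu>)"

lemma measurable_residual_density[measurable]: "residual_density k \<in> borel_measurable \<mu>"
  by (induction k) simp_all

lemma nn_integral_residual: "x \<in> space \<mu> \<Longrightarrow> (\<integral>\<^sup>+y. ennreal (r x y - m) \<partial>\<mu>) = ennreal contraction"
  using residual_integral[of x] kernel_integrable[of x] kernel_lower
  by (subst nn_integral_eq_integral) auto

text \<open>The starting mass \<open>m * measure \<mu> (space \<mu>)\<close> is
  \<open>1 - contraction\<close>, and each step multiplies by \<open>contraction\<close>. The masses
  therefore sum to one, and the series needs no normalization.\<close>

lemma nn_integral_residual_density:
  "(\<integral>\<^sup>+y. residual_density k y \<partial>\<mu>) = ennreal (contraction ^ k * (1 - contraction))"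
proof (induction k)
  case 0
  then show ?case
    using m_pos by (simp add: contraction_def emeasure_eq_measure ennreal_mult)
next
  case (Suc k)
  interpret pair_sigma_finite \<mu> \<mu> ..
  have "(\<integral>\<^sup>+y. residual_density (Suc k) y \<partial>\<mu>)
      = (\<integral>\<^sup>+x. \<integral>\<^sup>+y. residual_density k x * ennreal (r x y - m) \<partial>\<mu> \<partial>\<mu>)"
    unfolding residual_density.simps by (rule Fubini') measurable
  also have "\<dots> = (\<integral>\<^sup>+x. residual_density k x * ennreal contraction \<partial>\<mu>)"
    by (intro nn_integral_cong) (simp add: nn_integral_cmult nn_integral_residual)
  also have "\<dots> = ennreal (contraction ^ Suc k * (1 - contraction))"
    using contraction_nonneg contraction_less_1
    by (subst nn_integral_multc) (simp_all add: Suc.IH ennreal_mult''[symmetric] mult_ac del: residual_density.simps)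
  finally show ?case .
qed

definition invariant_density :: "'b \<Rightarrow> ennreal" where
  "invariant_density y = (\<Sum>k. residual_density k y)"

lemma measurable_invariant_density[measurable]: "invariant_density \<in> borel_measurable \<mu>"
  unfolding invariant_density_def by measurable

lemma nn_integral_invariant_density: "(\<integral>\<^sup>+y. invariant_density y \<partial>\<mu>) = 1"
proof -
  have "(\<integral>\<^sup>+y. invariant_density y \<partial>\<mu>) = (\<Sum>k. ennreal (contraction ^ k * (1 - contraction)))"
    unfolding invariant_density_def by (subst nn_integral_suminf) (auto simp: nn_integral_residual_density)
  also have "\<dots> = ennreal (\<Sum>k. contraction ^ k * (1 - contraction))"
    using contraction_nonneg contraction_less_1
    by (intro suminf_ennreal2) (auto intro!: summable_mult2 summable_geometric)
  also have "(\<Sum>k. contraction ^ k * (1 - contraction)) = 1"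
    using contraction_nonneg contraction_less_1
    by (subst suminf_mult2[symmetric]) (auto intro!: summable_geometric simp: suminf_geometric)
  finally show ?thesis by simp
qed

text \<open>The zeroth term of the series alone. This bound later gives the stationary law positive
  mass on sets charged by \<open>\<mu>\<close>.\<close>

lemma invariant_density_lower: "ennreal m \<le> invariant_density y"
proof -
  have "(\<Sum>k\<in>{0}. residual_density k y) \<le> invariant_density y"
    unfolding invariant_density_def by (intro sum_le_suminf) auto
  then show ?thesis by simp
qed

text \<open>Split \<open>r\<close> into \<open>m\<close> and the residual: the first part returns
  \<open>m\<close> because the total mass is one, the second shifts the series by one place.\<close>

lemma invariant_density_step:
  assumes y: "y \<in> space \<mu>"
  shows "(\<integral>\<^sup>+x. invariant_density x * ennreal (r x y) \<partial>\<mu>) = invariant_density y"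
proof -
  have "(\<integral>\<^sup>+x. invariant_density x * ennreal (r x y) \<partial>\<mu>)
      = (\<integral>\<^sup>+x. ennreal m * invariant_density x
          + (\<Sum>k. residual_density k x * ennreal (r x y - m)) \<partial>\<mu>)"
  proof (intro nn_integral_cong)
    fix x assume x: "x \<in> space \<mu>"
    have "ennreal (r x y) = ennreal m + ennreal (r x y - m)"
      using kernel_lower[OF x y] m_pos by (simp flip: ennreal_plus)
    then show "invariant_density x * ennreal (r x y)
        = ennreal m * invariant_density x + (\<Sum>k. residual_density k x * ennreal (r x y - m))"
      by (simp add: distrib_left mult.commute invariant_density_def)
  qed
  also have "\<dots> = ennreal m * (\<integral>\<^sup>+x. invariant_density x \<partial>\<mu>)
      + (\<integral>\<^sup>+x. (\<Sum>k. residual_density k x * ennreal (r x y - m)) \<partial>\<mu>)"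
    using y by (subst nn_integral_add) (auto simp: nn_integral_cmult)
  also have "\<dots> = residual_density 0 y + (\<Sum>k. residual_density (Suc k) y)"
    using y by (subst nn_integral_suminf) (auto simp: nn_integral_invariant_density)
  also have "\<dots> = invariant_density y"
    unfolding invariant_density_def
    using suminf_offset[OF summableI, of "\<lambda>k. residual_density k y" 1] by (simp add: add.commute)
  finally show ?thesis .
qed

definition invariant_law :: "'b measure \<Rightarrow> bool" where
  "invariant_law \<eta> \<longleftrightarrow> sets \<eta> = sets \<mu> \<and> prob_space \<eta> \<and>
     (\<forall>B\<in>sets \<mu>. emeasure \<eta> B = (\<integral>\<^sup>+x. (\<integral>\<^sup>+y\<in>B. ennreal (r x y) \<partial>\<mu>) \<partial>\<eta>))"

lemma invariant_law_density: "invariant_law (density \<mu> invariant_density)"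
  unfolding invariant_law_def
proof (intro conjI ballI)
  show "prob_space (density \<mu> invariant_density)"
    by (intro prob_spaceI) (simp add: emeasure_density nn_integral_invariant_density)
  fix B assume B[measurable]: "B \<in> sets \<mu>"
  interpret pair_sigma_finite \<mu> \<mu> ..
  have "(\<integral>\<^sup>+x. (\<integral>\<^sup>+y\<in>B. ennreal (r x y) \<partial>\<mu>) \<partial>density \<mu> invariant_density)
      = (\<integral>\<^sup>+x. \<integral>\<^sup>+y. invariant_density x * (ennreal (r x y) * indicator B y) \<partial>\<mu> \<partial>\<mu>)"
    by (subst nn_integral_density) (auto intro!: nn_integral_cong simp: nn_integral_cmult)
  also have "\<dots> = (\<integral>\<^sup>+y. \<integral>\<^sup>+x. invariant_density x * (ennreal (r x y) * indicator B y) \<partial>\<mu> \<partial>\<mu>)"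
    by (rule Fubini'[symmetric]) measurable
  also have "\<dots> = (\<integral>\<^sup>+y. invariant_density y * indicator B y \<partial>\<mu>)"
  proof (intro nn_integral_cong)
    fix y assume y: "y \<in> space \<mu>"
    have "(\<integral>\<^sup>+x. invariant_density x * (ennreal (r x y) * indicator B y) \<partial>\<mu>)
        = (\<integral>\<^sup>+x. invariant_density x * ennreal (r x y) \<partial>\<mu>) * indicator B y"
      using y by (subst nn_integral_multc[symmetric]) (auto simp: mult.assoc)
    then show "(\<integral>\<^sup>+x. invariant_density x * (ennreal (r x y) * indicator B y) \<partial>\<mu>)
        = invariant_density y * indicator B y"
      by (simp add: invariant_density_step[OF y])
  qed
  finally show "emeasure (density \<mu> invariant_density) B
      = (\<integral>\<^sup>+x. (\<integral>\<^sup>+y\<in>B. ennreal (r x y) \<partial>\<mu>) \<partial>density \<mu> invariant_density)"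
    by (simp add: emeasure_density)
qed simp

text \<open>Writing \<open>\<eta>\<close> as its own composition with the kernel turns invariance on
  sets into invariance on bounded functions, through the integral of a bind.\<close>

lemma invariant_law_integral:
  assumes inv: "invariant_law \<eta>"
    and [measurable]: "g \<in> borel_measurable \<mu>" and bnd: "\<And>x. x \<in> space \<mu> \<Longrightarrow> \<bar>g x\<bar> \<le> (C::real)"
  shows "(\<integral>x. (\<integral>y. r x y * g y \<partial>\<mu>) \<partial>\<eta>) = (\<integral>x. g x \<partial>\<eta>)"
proof -
  have sets[measurable_cong]: "sets \<eta> = sets \<mu>" and "prob_space \<eta>"
    and emeas: "\<And>B. B \<in> sets \<mu> \<Longrightarrow> emeasure \<eta> B = (\<integral>\<^sup>+x. (\<integral>\<^sup>+y\<in>B. ennreal (r x y) \<partial>\<mu>) \<partial>\<eta>)"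
    using inv by (auto simp: invariant_law_def)
  interpret \<eta>: prob_space \<eta> by fact
  have sp[simp]: "space \<eta> = space \<mu>" using sets by (rule sets_eq_imp_space_eq)
  define K where "K x = density \<mu> (\<lambda>y. ennreal (r x y))" for x
  have Kp: "prob_space (K x)" if "x \<in> space \<mu>" for x
    unfolding K_def using that kernel_total by (intro prob_spaceI) (simp add: emeasure_density)
  have K[measurable]: "K \<in> \<eta> \<rightarrow>\<^sub>M subprob_algebra \<mu>"
  proof (rule measurable_subprob_algebra)
    fix B assume [measurable]: "B \<in> sets \<mu>"
    have "(\<lambda>x. \<integral>\<^sup>+y. ennreal (r x y) * indicator B y \<partial>\<mu>) \<in> borel_measurable \<mu>"
      by measurable
    then show "(\<lambda>x. emeasure (K x) B) \<in> borel_measurable \<eta>"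
      unfolding K_def by (subst measurable_cong_sets[OF sets refl])
        (subst measurable_cong[OF emeasure_density], auto)
  qed (auto simp: K_def intro: prob_space_imp_subprob_space Kp[unfolded K_def])
  have \<eta>_eq: "\<eta> = \<eta> \<bind> K"
  proof (rule measure_eqI)
    show "sets \<eta> = sets (\<eta> \<bind> K)"
      using space_nonempty sets by (simp add: sets_bind_measurable[OF K])
    fix B assume "B \<in> sets \<eta>"
    then have [measurable]: "B \<in> sets \<mu>" by (simp add: sets)
    have "emeasure (\<eta> \<bind> K) B = (\<integral>\<^sup>+x. emeasure (K x) B \<partial>\<eta>)"
      using space_nonempty by (intro emeasure_bind[OF _ K]) auto
    also have "\<dots> = (\<integral>\<^sup>+x. (\<integral>\<^sup>+y\<in>B. ennreal (r x y) \<partial>\<mu>) \<partial>\<eta>)"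
      unfolding K_def by (intro nn_integral_cong emeasure_density) auto
    also have "\<dots> = emeasure \<eta> B" by (simp add: emeas)
    finally show "emeasure \<eta> B = emeasure (\<eta> \<bind> K) B" by simp
  qed
  have "(\<integral>x. g x \<partial>\<eta>) = (\<integral>x. g x \<partial>(\<eta> \<bind> K))"
    using \<eta>_eq by simp
  also have "\<dots> = (\<integral>x. (\<integral>y. g y \<partial>K x) \<partial>\<eta>)"
  proof (rule integral_bind[where K=\<mu> and B'=1 and B=C])
    show "AE x in \<eta>. emeasure (K x) (space (K x)) \<le> ennreal 1"
      using Kp by (auto intro!: AE_I2 simp: prob_space.emeasure_space_1)
  qed (use bnd space_nonempty \<eta>.finite_measure_axioms in auto)
  also have "\<dots> = (\<integral>x. (\<integral>y. r x y * g y \<partial>\<mu>) \<partial>\<eta>)"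
    unfolding K_def
    by (rule Bochner_Integration.integral_cong[OF refl], subst integral_density)
      (auto simp: kernel_nonneg)
  finally show ?thesis by simp
qed

text \<open>Integrating the Poisson equation against an invariant law cancels both terms in
  \<open>g\<close>. This identifies the limit in the law of large numbers.\<close>

lemma poisson_constant:
  assumes inv: "invariant_law \<eta>"
    and [measurable]: "H \<in> borel_measurable \<mu>" "g \<in> borel_measurable \<mu>"
    and bnd: "\<And>x. x \<in> space \<mu> \<Longrightarrow> \<bar>H x\<bar> \<le> C" "\<And>x. x \<in> space \<mu> \<Longrightarrow> \<bar>g x\<bar> \<le> D"
    and eq: "\<And>x. x \<in> space \<mu> \<Longrightarrow> H x - c = g x - (\<integral>y. r x y * g y \<partial>\<mu>)"
  shows "c = (\<integral>x. H x \<partial>\<eta>)"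
proof -
  have sets[measurable_cong]: "sets \<eta> = sets \<mu>" and "prob_space \<eta>"
    using inv by (auto simp: invariant_law_def)
  interpret \<eta>: prob_space \<eta> by fact
  have sp[simp]: "space \<eta> = space \<mu>" using sets by (rule sets_eq_imp_space_eq)
  have i: "integrable \<eta> H" "integrable \<eta> g"
    using bnd by (auto intro!: \<eta>.integrable_const_bound AE_I2)
  have "integrable \<eta> (\<lambda>x. g x - (H x - c))"
    using i by simp
  then have i': "integrable \<eta> (\<lambda>x. \<integral>y. r x y * g y \<partial>\<mu>)"
    by (rule Bochner_Integration.integrable_cong[THEN iffD1, rotated -1]) (use eq in \<open>auto simp: algebra_simps\<close>)
  have "(\<integral>x. H x \<partial>\<eta>) - c = (\<integral>x. H x - c \<partial>\<eta>)"
    using i by (simp add: \<eta>.prob_space[unfolded sp])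
  also have "\<dots> = (\<integral>x. g x - (\<integral>y. r x y * g y \<partial>\<mu>) \<partial>\<eta>)"
    using eq by (intro Bochner_Integration.integral_cong refl) auto
  also have "\<dots> = 0"
    using i i' invariant_law_integral[OF inv, of g D] bnd by simp
  finally show ?thesis by simp
qed

text \<open>The constant in the Poisson equation of \<open>indicator B\<close> is produced by the
  kernel alone, and for every invariant law it equals the mass of \<open>B\<close>.\<close>

lemma invariant_law_unique:
  assumes "invariant_law \<eta>" "invariant_law \<eta>'"
  shows "\<eta> = \<eta>'"
proof (rule measure_eqI)
  show s: "sets \<eta> = sets \<eta>'" using assms by (simp add: invariant_law_def)
  fix B assume "B \<in> sets \<eta>"
  then have B[measurable]: "B \<in> sets \<mu>" using assms by (simp add: invariant_law_def)
  let ?H = "indicator B :: 'b \<Rightarrow> real"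
  have H: "?H \<in> borel_measurable \<mu>" "\<And>x. x \<in> space \<mu> \<Longrightarrow> \<bar>?H x\<bar> \<le> 1" by auto
  obtain g D c where "g \<in> borel_measurable \<mu>" "\<forall>x\<in>space \<mu>. \<bar>g x\<bar> \<le> D"
    "\<forall>x\<in>space \<mu>. ?H x - c = g x - (\<integral>y. r x y * g y \<partial>\<mu>)"
    using poisson_equation[OF H] by meson
  then have g: "g \<in> borel_measurable \<mu>" "\<And>x. x \<in> space \<mu> \<Longrightarrow> \<bar>g x\<bar> \<le> D"
    "\<And>x. x \<in> space \<mu> \<Longrightarrow> ?H x - c = g x - (\<integral>y. r x y * g y \<partial>\<mu>)"
    by auto
  have "c = measure \<theta> B" if "invariant_law \<theta>" for \<theta>
  proof -
    interpret \<theta>: prob_space \<theta> using that by (simp add: invariant_law_def)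
    have "B \<in> sets \<theta>" using that by (simp add: invariant_law_def)
    then show ?thesis
      using poisson_constant[OF that H(1) g(1) H(2) g(2,3)] by simp
  qed
  from this[OF assms(1)] this[OF assms(2)] have "measure \<eta> B = measure \<eta>' B" by simp
  moreover have "finite_measure \<eta>" "finite_measure \<eta>'"
    using assms by (auto simp: invariant_law_def prob_space.finite_measure)
  ultimately show "emeasure \<eta> B = emeasure \<eta>' B"
    by (simp add: finite_measure.emeasure_eq_measure)
qed

end

section \<open>Approximation\<close>

lemma finite_bracketing_grid:
  fixes a b \<eta> :: real
  assumes "a \<le> b" "0 < \<eta>"
  obtains U where "finite U" "U \<subseteq> {a..b}"
    "\<And>u. u \<in> {a..b} \<Longrightarrow> \<exists>v\<in>U. \<exists>w\<in>U. v \<le> u \<and> u \<le> w \<and> w - v < \<eta>"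
proof -
  \<comment> \<open>Spacing of half the allowed gap makes the required inequality strict. The index
    range of \<open>U\<close> goes one past the ceiling, so that the right neighbour of every point
    is present, and \<open>min b\<close> keeps the extra points inside the interval.\<close>
  define h where "h = \<eta> / 2"
  define U where "U = (\<lambda>j. min b (a + real j * h)) ` {..Suc (nat \<lceil>(b - a) / h\<rceil>)}"
  have h: "0 < h" "h < \<eta>" using assms by (auto simp: h_def)
  have "\<exists>v\<in>U. \<exists>w\<in>U. v \<le> u \<and> u \<le> w \<and> w - v < \<eta>" if u: "u \<in> {a..b}" for u
  proof -
    define j where "j = nat \<lfloor>(u - a) / h\<rfloor>"
    have nn: "0 \<le> (u - a) / h" using u h by simp
    have j: "real j \<le> (u - a) / h" "(u - a) / h < real j + 1"
      using nn by (auto simp: j_def)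
    have "(u - a) / h \<le> (b - a) / h" using u h by (intro divide_right_mono) auto
    then have "real j \<le> (b - a) / h" using j by linarith
    then have jle: "j \<le> nat \<lceil>(b - a) / h\<rceil>" by linarith
    have lo: "a + real j * h \<le> u" and hi: "u < a + real (Suc j) * h"
      using j h by (auto simp: field_simps)
    have in_U: "min b (a + real i * h) \<in> U" if "i \<le> Suc j" for i
      unfolding U_def using jle that by (intro imageI) auto
    have "min b (a + real j * h) \<in> U" "min b (a + real (Suc j) * h) \<in> U"
      by (rule in_U, simp)+
    moreover have "min b (a + real j * h) \<le> u" "u \<le> min b (a + real (Suc j) * h)"
      using lo hi u by auto
    moreover have "min b (a + real (Suc j) * h) - min b (a + real j * h) < \<eta>"
      using h by (auto simp: min_def algebra_simps)
    ultimately show ?thesis by blast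
  qed
  moreover have "finite U" "U \<subseteq> {a..b}"
    using assms h by (auto simp: U_def)
  ultimately show ?thesis using that by blast
qed

text \<open>A decreasing function is trapped between its values at two neighbouring grid points, and
  \<open>Y\<close> varies by less than \<open>\<delta>\<close> between them. The grid is fixed
  before \<open>y\<close>, so that one finite set of times serves every sample size and every
  outcome.\<close>

lemma antimono_uniform_approx:
  fixes Y :: "real \<Rightarrow> real"
  assumes cont: "continuous_on {0..t} Y" and t: "0 \<le> t" and \<delta>: "0 < \<delta>"
  obtains U where "finite U" "U \<subseteq> {0..t}"
    "\<And>y u. antimono y \<Longrightarrow> (\<And>v. v \<in> U \<Longrightarrow> \<bar>y v - Y v\<bar> \<le> \<delta>) \<Longrightarrow> u \<in> {0..t} \<Longrightarrow> \<bar>y u - Y u\<bar> \<le> 2 * \<delta>"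
proof -
  have "uniformly_continuous_on {0..t} Y"
    using cont by (intro compact_uniformly_continuous) auto
  then obtain \<eta> where \<eta>: "0 < \<eta>" "\<And>u v. u \<in> {0..t} \<Longrightarrow> v \<in> {0..t} \<Longrightarrow> \<bar>u - v\<bar> < \<eta> \<Longrightarrow> \<bar>Y u - Y v\<bar> < \<delta>"
    using \<delta> unfolding uniformly_continuous_on_def dist_real_def by metis
  obtain U where U: "finite U" "U \<subseteq> {0..t}"
    "\<And>u. u \<in> {0..t} \<Longrightarrow> \<exists>v\<in>U. \<exists>w\<in>U. v \<le> u \<and> u \<le> w \<and> w - v < \<eta>"
    using finite_bracketing_grid[OF t \<eta>(1)] by blast
  have "\<bar>y u - Y u\<bar> \<le> 2 * \<delta>"
    if y: "antimono y" and yU: "\<And>v. v \<in> U \<Longrightarrow> \<bar>y v - Y v\<bar> \<le> \<delta>" and u: "u \<in> {0..t}" for y u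
  proof -
    obtain v w where vw: "v \<in> U" "w \<in> U" "v \<le> u" "u \<le> w" "w - v < \<eta>" using U(3)[OF u] by blast
    have "\<bar>Y u - Y v\<bar> < \<delta>" "\<bar>Y u - Y w\<bar> < \<delta>"
      using vw u U(2) by (auto intro!: \<eta>(2))
    moreover have "y w \<le> y u" "y u \<le> y v"
      using y vw by (auto dest: antimonoD)
    ultimately show ?thesis
      using yU[OF vw(1)] yU[OF vw(2)] by linarith
  qed
  with U(1,2) show ?thesis using that by blast
qed

lemma smoothing_kernel_uniformly_continuous:
  assumes "smoothing_kernel K"
  shows "uniformly_continuous_on UNIV K"
  unfolding uniformly_continuous_on_def
proof (intro allI impI)
  fix \<epsilon> :: real assume \<epsilon>: "0 < \<epsilon>"
  \<comment> \<open>The margin between 1 and 2: if two points are closer than 1 and one lies outside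
    \<open>{-2..2}\<close>, both lie outside the support.\<close>
  have "uniformly_continuous_on {-2..2} K"
    using assms by (intro compact_uniformly_continuous) (auto simp: smoothing_kernel_def intro: continuous_on_subset)
  then obtain \<delta> where \<delta>: "0 < \<delta>" "\<And>x y. x \<in> {-2..2} \<Longrightarrow> y \<in> {-2..2} \<Longrightarrow> dist y x < \<delta> \<Longrightarrow> dist (K y) (K x) < \<epsilon>"
    using \<epsilon> unfolding uniformly_continuous_on_def by metis
  have "dist (K y) (K x) < \<epsilon>" if "dist y x < min \<delta> 1" for x y
  proof (cases "x \<in> {-2..2} \<and> y \<in> {-2..2}")
    case True
    then show ?thesis using \<delta>(2) that by auto
  next
    case False
    then have "x \<notin> {-1..1}" "y \<notin> {-1..1}" using that by (auto simp: dist_real_def)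
    then have "K x = 0" "K y = 0" using assms by (auto simp: smoothing_kernel_def)
    then show ?thesis using \<epsilon> by simp
  qed
  then show "\<exists>d>0. \<forall>x\<in>UNIV. \<forall>x'\<in>UNIV. dist x' x < d \<longrightarrow> dist (K x') (K x) < \<epsilon>"
    using \<delta>(1) by (intro exI[of _ "min \<delta> 1"]) auto
qed

lemma smoothing_kernel_bounded:
  assumes "smoothing_kernel K"
  obtains \<kappa> where "0 < \<kappa>" "\<And>u. \<bar>K u\<bar> \<le> \<kappa>"
proof -
  have "compact (K ` {-1..1})"
    using assms by (intro compact_continuous_image) (auto simp: smoothing_kernel_def intro: continuous_on_subset)
  then obtain \<kappa> where "\<forall>x\<in>K ` {-1..1}. norm x \<le> \<kappa>"
    using compact_imp_bounded bounded_iff by blast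
  then have \<kappa>: "\<And>u. u \<in> {-1..1} \<Longrightarrow> \<bar>K u\<bar> \<le> \<kappa>" by auto
  have "\<bar>K u\<bar> \<le> max \<kappa> 1" for u
    using \<kappa>[of u] assms by (cases "u \<in> {-1..1}") (auto simp: smoothing_kernel_def)
  then show ?thesis by (intro that[of "max \<kappa> 1"]) auto
qed

text \<open>The kernel may change sign, so the modulus of continuity of \<open>l\<close> is weighted
  with the integral \<open>I\<close> of the absolute value of \<open>K\<close>, not with its total
  mass one.\<close>

lemma kernel_smoothing_converges:
  assumes K: "smoothing_kernel K" and l: "continuous_on {0..t} l"
    and r: "0 < r1" "r2 < t" and \<epsilon>: "0 < \<epsilon>"
  obtains b0 where "0 < b0" "\<And>b s. 0 < b \<Longrightarrow> b < b0 \<Longrightarrow> s \<in> {r1..r2} \<Longrightarrow>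
    \<bar>(\<integral>u. of_bool (0 \<le> u \<and> u \<le> t) * (K ((s - u) / b) / b) * l u \<partial>lborel) - l s\<bar> \<le> \<epsilon>"
proof -
  have Kc: "continuous_on UNIV K" and K0: "\<And>u. u \<notin> {-1..1} \<Longrightarrow> K u = 0"
    and Ki: "integrable lborel K" and K1: "(\<integral>u. K u \<partial>lborel) = 1"
    using K by (auto simp: smoothing_kernel_def)
  have [measurable]: "K \<in> borel_measurable borel" using Kc by (rule borel_measurable_continuous_onI)
  define I where "I = (\<integral>u. \<bar>K u\<bar> \<partial>lborel)"
  have I: "0 \<le> I" by (simp add: I_def)
  define \<omega> where "\<omega> = \<epsilon> / (I + 1)"
  have \<omega>: "0 < \<omega>" using \<epsilon> I by (simp add: \<omega>_def)
  have "uniformly_continuous_on {0..t} l"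
    using l by (intro compact_uniformly_continuous) auto
  then obtain \<eta> where \<eta>: "0 < \<eta>" "\<And>u v. u \<in> {0..t} \<Longrightarrow> v \<in> {0..t} \<Longrightarrow> \<bar>u - v\<bar> < \<eta> \<Longrightarrow> \<bar>l u - l v\<bar> < \<omega>"
    using \<omega> unfolding uniformly_continuous_on_def dist_real_def by metis
  \<comment> \<open>A bandwidth below \<open>r1\<close> and \<open>t - r2\<close> keeps the window
    around \<open>s\<close> inside \<open>{0..t}\<close>: the cut-off removes nothing and there is
    no boundary bias.\<close>
  define b0 where "b0 = min \<eta> (min r1 (t - r2))"
  have "\<bar>(\<integral>u. of_bool (0 \<le> u \<and> u \<le> t) * (K ((s - u) / b) / b) * l u \<partial>lborel) - l s\<bar> \<le> \<epsilon>"
    if b: "0 < b" "b < b0" and s: "s \<in> {r1..r2}" for b s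
  proof -
    define k where "k u = K ((s - u) / b) / b" for u
    have k0: "k u = 0" if "\<not> \<bar>s - u\<bar> \<le> b" for u
      unfolding k_def using b that by (subst K0) (auto simp: field_simps abs_le_iff)
    have aff: "(\<integral>u. F ((s - u) / b) / b \<partial>lborel) = (\<integral>u. F u \<partial>lborel)"
      and aff_i: "integrable lborel F \<Longrightarrow> integrable lborel (\<lambda>u. F ((s - u) / b) / b)" for F :: "real \<Rightarrow> real"
    proof -
      have arg: "s / b + - (1 / b) * u = (s - u) / b" for u
        by (simp add: diff_divide_distrib)
      have "(\<integral>u. F u \<partial>lborel) = \<bar>- (1 / b)\<bar> *\<^sub>R (\<integral>u. F ((s - u) / b) \<partial>lborel)"
        using lborel_integral_real_affine[of "- (1 / b)" F "s / b"] b unfolding arg by simp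
      then show "(\<integral>u. F ((s - u) / b) / b \<partial>lborel) = (\<integral>u. F u \<partial>lborel)"
        using b by simp
      show "integrable lborel (\<lambda>u. F ((s - u) / b) / b)" if "integrable lborel F"
        using lborel_integrable_real_affine[OF that, of "- (1 / b)" "s / b"] b unfolding arg by simp
    qed
    have ki: "integrable lborel k" and k1: "(\<integral>u. k u \<partial>lborel) = 1"
      unfolding k_def using aff[of K] aff_i[OF Ki] K1 by auto
    have kI: "(\<integral>u. \<bar>k u\<bar> \<partial>lborel) = I"
      unfolding k_def I_def using aff[of "\<lambda>u. \<bar>K u\<bar>"] b by (simp add: abs_divide)
    have in_t: "u \<in> {0..t}" if "\<bar>s - u\<bar> \<le> b" for u
      using that s b by (auto simp: b0_def)
    \<comment> \<open>Continuity of \<open>l\<close> is known on \<open>{0..t}\<close> only; the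
      clamped version is continuous on the whole line and equals \<open>l\<close> wherever
      \<open>k\<close> does not vanish.\<close>
    define l' where "l' u = l (max 0 (min t u))" for u
    have "continuous_on UNIV l'"
      unfolding l'_def using in_t[of s] b
      by (intro continuous_on_compose2[OF l] continuous_intros) auto
    then have [measurable]: "l' \<in> borel_measurable borel" by (rule borel_measurable_continuous_onI)
    have [measurable]: "k \<in> borel_measurable borel" unfolding k_def by measurable
    have e: "of_bool (0 \<le> u \<and> u \<le> t) * k u * l u - k u * l s = k u * (l' u - l s)" for u
      using in_t[of u] k0[of u] by (cases "\<bar>s - u\<bar> \<le> b") (auto simp: l'_def algebra_simps)
    have bd: "\<bar>k u * (l' u - l s)\<bar> \<le> \<bar>k u\<bar> * \<omega>" for u
    proof (cases "\<bar>s - u\<bar> \<le> b")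
      case True
      have "\<bar>l u - l s\<bar> < \<omega>"
        using True in_t[of u] in_t[of s] b by (intro \<eta>(2)) (auto simp: b0_def)
      moreover have "l' u = l u" using in_t[OF True] by (auto simp: l'_def)
      ultimately show ?thesis by (auto simp: abs_mult intro!: mult_left_mono)
    qed (use k0 in auto)
    have i1: "integrable lborel (\<lambda>u. \<bar>k u\<bar> * \<omega>)" using ki by simp
    have i2: "integrable lborel (\<lambda>u. k u * (l' u - l s))"
      by (rule Bochner_Integration.integrable_bound[OF i1]) (use bd in \<open>auto intro!: AE_I2 order_trans[OF _ abs_ge_self]\<close>)
    have i3: "integrable lborel (\<lambda>u. of_bool (0 \<le> u \<and> u \<le> t) * k u * l u)"
    proof -
      have "integrable lborel (\<lambda>u. k u * (l' u - l s) + k u * l s)" using i2 ki by simp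
      then show ?thesis by (simp add: e[symmetric])
    qed
    have "(\<integral>u. of_bool (0 \<le> u \<and> u \<le> t) * k u * l u \<partial>lborel) - l s
        = (\<integral>u. of_bool (0 \<le> u \<and> u \<le> t) * k u * l u - k u * l s \<partial>lborel)"
      using i3 ki k1 by simp
    also have "\<bar>\<dots>\<bar> \<le> (\<integral>u. \<bar>k u * (l' u - l s)\<bar> \<partial>lborel)"
      unfolding e by (rule integral_abs_bound)
    also have "\<dots> \<le> (\<integral>u. \<bar>k u\<bar> * \<omega> \<partial>lborel)"
      using bd i1 i2 by (intro integral_mono) auto
    also have "\<dots> = I * \<omega>" using kI by simp
    also have "\<dots> \<le> \<epsilon>" using I \<epsilon> by (simp add: \<omega>_def field_simps)
    finally show ?thesis unfolding k_def .
  qed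
  then show ?thesis
    using \<eta>(1) r by (intro that[of b0]) (auto simp: b0_def)
qed

text \<open>For positive \<open>n\<close>, put \<open>a = y / n\<close>. Then \<open>a\<close> is at
  least \<open>c / 2\<close> on \<open>{0..t}\<close>, so the default value of the inverse is never
  taken, and \<open>1 / a\<close> differs from \<open>1 / Y\<close> by at most
  \<open>\<eta> / (c / 2 * c)\<close>. Each of the \<open>n\<close> terms carries weight
  \<open>1 / n\<close>. For \<open>n = 0\<close> both expressions are 0.\<close>

lemma nelson_aalen_deviation:
  fixes s w k :: "nat \<Rightarrow> real" and Y y :: "real \<Rightarrow> real"
  assumes w: "\<And>i. 0 \<le> w i" "\<And>i. w i \<le> 1" and s: "\<And>i. 0 \<le> s i"
    and Y: "\<And>u. u \<in> {0..t} \<Longrightarrow> c \<le> Y u" and c: "0 < c" and \<eta>: "0 \<le> \<eta>" "\<eta> \<le> c / 2"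
    and dev: "\<And>u. u \<in> {0..t} \<Longrightarrow> \<bar>y u / real n - Y u\<bar> \<le> \<eta>"
    and k: "\<And>i. \<bar>k i\<bar> \<le> \<kappa>"
  shows "\<bar>(\<Sum>i<n. k i * (if y (s i) \<noteq> 0 then 1 / y (s i) else 0) * of_bool (s i \<le> t) * w i)
    - (\<Sum>i<n. k i / Y (s i) * of_bool (s i \<le> t) * w i) / real n\<bar> \<le> \<kappa> * (2 * \<eta> / c\<^sup>2)"
proof (cases "n = 0")
  case True
  have "0 \<le> \<kappa>" using k[of 0] by linarith
  then show ?thesis using True \<eta> by simp
next
  case False
  then have n: "0 < real n" by simp
  have \<kappa>: "0 \<le> \<kappa>" using k[of 0] by linarith
  let ?d = "\<lambda>i. k i * (if y (s i) \<noteq> 0 then 1 / y (s i) else 0) * of_bool (s i \<le> t) * w i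
    - k i / Y (s i) * of_bool (s i \<le> t) * w i / real n"
  define d where "d i = ?d i" for i
  have "\<bar>?d i\<bar> \<le> \<kappa> * (2 * \<eta> / c\<^sup>2) / real n" if i: "i < n" for i
  proof (cases "s i \<le> t")
    case True
    then have st: "s i \<in> {0..t}" using s by auto
    define a where "a = y (s i) / real n"
    define Z where "Z = Y (s i)"
    have Z: "c \<le> Z" using Y[OF st] by (simp add: Z_def)
    have aZ: "\<bar>a - Z\<bar> \<le> \<eta>" using dev[OF st] by (simp add: a_def Z_def)
    have a: "c / 2 \<le> a" using aZ \<eta>(2) Z by linarith
    have "?d i = k i * w i * ((Z - a) / (a * Z)) / real n"
    proof -
      have "y (s i) = a * real n" using n by (simp add: a_def)
      moreover have "0 < a" "0 < Z" using a Z c by linarith+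
      ultimately have "y (s i) = a * real n \<and> 0 < a \<and> 0 < Z" by blast
      then show ?thesis using True n by (simp add: Z_def[symmetric] field_simps)
    qed
    also have "\<bar>\<dots>\<bar> = \<bar>k i\<bar> * w i * (\<bar>a - Z\<bar> / (a * Z)) / real n"
      using a Z c w n by (simp add: abs_mult abs_divide abs_minus_commute)
    also have "\<dots> \<le> \<kappa> * 1 * (\<eta> / (c / 2 * c)) / real n"
      using k w aZ a Z c \<kappa> n \<eta>(1)
      by (intro divide_right_mono mult_mono frac_le) auto
    also have "\<dots> = \<kappa> * (2 * \<eta> / c\<^sup>2) / real n"
      by (simp add: power2_eq_square field_simps)
    finally show ?thesis .
  next
    case False
    then show ?thesis using \<kappa> \<eta> by simp
  qed
  then have le: "\<bar>d i\<bar> \<le> \<kappa> * (2 * \<eta> / c\<^sup>2) / real n" if "i < n" for i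
    using that unfolding d_def .
  have "\<bar>\<Sum>i<n. d i\<bar> \<le> (\<Sum>i<n. \<bar>d i\<bar>)" by (rule sum_abs)
  also have "\<dots> \<le> of_nat (card {..<n}) * (\<kappa> * (2 * \<eta> / c\<^sup>2) / real n)"
    by (rule sum_bounded_above) (use le in auto)
  also have "\<dots> = \<kappa> * (2 * \<eta> / c\<^sup>2)" using n by simp
  finally show ?thesis
    unfolding d_def by (simp only: sum_subtractf sum_divide_distrib)
qed

text \<open>A supremum over countably many times is measurable, which the notion of convergence in
  probability demands.\<close>

lemma SUP_abs_continuous_rationals:
  fixes g :: "real \<Rightarrow> real"
  assumes "r1 < r2" and g: "continuous_on {r1..r2} g"
  shows "(SUP s\<in>{r1..r2}. ereal \<bar>g s\<bar>) = (SUP s\<in>{r1<..<r2} \<inter> \<rat>. ereal \<bar>g s\<bar>)"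
proof (rule antisym)
  let ?Q = "{r1<..<r2} \<inter> \<rat>"
  have cl: "closure ?Q = {r1..r2}"
    using assms(1) by (subst closure_open_Int_superset) (auto simp: Rats_closure_real)
  show "(SUP s\<in>{r1..r2}. ereal \<bar>g s\<bar>) \<le> (SUP s\<in>?Q. ereal \<bar>g s\<bar>)" (is "_ \<le> ?M")
  proof (rule SUP_least)
    fix s assume s: "s \<in> {r1..r2}"
    have le: "ereal \<bar>g q\<bar> \<le> ?M" if "q \<in> ?Q" for q
      using that by (rule SUP_upper)
    obtain q where "q \<in> ?Q" using Rats_dense_in_real[OF assms(1)] by auto
    then have "0 \<le> ?M" using le[of q] by (auto intro: order_trans[of 0 "ereal \<bar>g q\<bar>"])
    then show "ereal \<bar>g s\<bar> \<le> ?M"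
    proof (cases ?M)
      case (real a)
      have "\<bar>g s\<bar> \<le> a"
      proof (rule continuous_le_on_closure[where f="\<lambda>s. \<bar>g s\<bar>"])
        show "continuous_on (closure ?Q) (\<lambda>s. \<bar>g s\<bar>)"
          unfolding cl using g by (intro continuous_intros)
        show "s \<in> closure ?Q" unfolding cl by (rule s)
        show "\<bar>g q\<bar> \<le> a" if "q \<in> ?Q" for q using le[OF that] real by simp
      qed
      then show ?thesis using real by simp
    qed auto
  qed
  show "?M \<le> (SUP s\<in>{r1..r2}. ereal \<bar>g s\<bar>)"
    by (rule SUP_subset_mono) auto
qed

lemma diagonal_tendsto_zero:
  fixes p :: "nat \<Rightarrow> nat \<Rightarrow> real"
  assumes p: "\<And>j. p j \<longlonglongrightarrow> 0"
  obtains J where "filterlim J at_top sequentially" "(\<lambda>n. p (J n) n) \<longlonglongrightarrow> 0"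
proof -
  have "\<exists>N. \<forall>n\<ge>N. \<bar>p j n\<bar> < 1 / real (Suc j)" for j
    using LIMSEQ_D[OF p[of j], of "1 / real (Suc j)"] by auto
  then obtain N where N: "\<And>j n. N j \<le> n \<Longrightarrow> \<bar>p j n\<bar> < 1 / real (Suc j)" by metis
  \<comment> \<open>The last level whose threshold has been passed. The bound
    \<open>j \<le> n\<close> keeps the set finite, and \<open>insert 0\<close> is a default that
    matters only while \<open>n\<close> is below \<open>N 0\<close>.\<close>
  define J where "J n = Max (insert 0 {j. j \<le> n \<and> N j \<le> n})" for n
  have J_in: "J n \<in> insert 0 {j. j \<le> n \<and> N j \<le> n}" for n
    unfolding J_def by (rule Max_in) auto
  have J_ge: "j \<le> J n" if "max j (N j) \<le> n" for j n
    unfolding J_def using that by (intro Max_ge) auto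
  have lim: "filterlim J at_top sequentially"
    unfolding filterlim_at_top
  proof
    show "\<forall>\<^sub>F n in sequentially. j \<le> J n" for j
      by (rule eventually_sequentiallyI[of "max j (N j)"]) (rule J_ge)
  qed
  have "(\<lambda>n. p (J n) n) \<longlonglongrightarrow> 0"
  proof (rule Lim_null_comparison)
    show "\<forall>\<^sub>F n in sequentially. norm (p (J n) n) \<le> 1 / real (Suc (J n))"
      using eventually_ge_at_top[of "N 0"]
    proof eventually_elim
      case (elim n)
      then have "N (J n) \<le> n" using J_in[of n] by auto
      from N[OF this] show ?case by simp
    qed
    show "(\<lambda>n. 1 / real (Suc (J n))) \<longlonglongrightarrow> 0"
      using filterlim_compose[OF LIMSEQ_inverse_real_of_nat lim] by (simp add: inverse_eq_divide)
  qed
  with lim show ?thesis by (rule that)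
qed

section \<open>The conditional hazard rate\<close>

lemma (in pdmp) exit_time_nonneg: "0 \<le> exit_time x"
  unfolding exit_time_def by (rule Inf_greatest) auto

context regular_pdmp
begin

lemma space_\<mu>[simp]: "space \<mu> = E"
  using sets_eq_imp_space_eq[OF sets_\<mu>] by (simp add: space_restrict_space)

lemma measurable_\<mu>_borel: "X \<in> M \<rightarrow>\<^sub>M \<mu> \<Longrightarrow> X \<in> M \<rightarrow>\<^sub>M borel"
  using measurable_cong_sets[OF refl sets_\<mu>, of M] measurable_restrict_space2_iff[of X M borel E] by auto

lemma measurable_\<mu>_in: "X \<in> M \<rightarrow>\<^sub>M \<mu> \<Longrightarrow> \<omega> \<in> space M \<Longrightarrow> X \<omega> \<in> E"
  using measurable_space[of X M \<mu> \<omega>] by simp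

lemma sets_\<mu>_iff: "A \<in> sets \<mu> \<longleftrightarrow> A \<in> sets borel \<and> A \<subseteq> E"
  using E_open by (auto simp: sets_\<mu> sets_restrict_space_iff)

abbreviation "exit x \<equiv> exit_time_real x"

lemma exit_time_eq: "x \<in> E \<Longrightarrow> exit_time x = ereal (exit x)"
  using exit_time_bounded exit_time_nonneg[of x] unfolding exit_time_real_def
  by (cases "exit_time x") fastforce+

lemma exit_nonneg: "x \<in> E \<Longrightarrow> 0 \<le> exit x"
  using exit_time_nonneg[of x] exit_time_eq[of x] by simp

lemma measurable_exit[measurable (raw)]:
  assumes X: "X \<in> M \<rightarrow>\<^sub>M \<mu>"
  shows "(\<lambda>\<omega>. exit (X \<omega>)) \<in> borel_measurable M"
proof -
  have "exit_time \<in> borel_measurable \<mu>"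
    using exit_time_measurable by (simp add: measurable_cong_sets[OF sets_\<mu> refl])
  from measurable_compose[OF X this] show ?thesis
    unfolding exit_time_real_def by simp
qed

text \<open>The flow, the rate and the density are only controlled for nonnegative times; times are
  clamped by \<open>max 0\<close> so that the functions below are measurable on a full product space.\<close>

lemma measurable_rate_flow[measurable (raw)]:
  assumes X: "X \<in> M \<rightarrow>\<^sub>M \<mu>" and S[measurable]: "S \<in> borel_measurable M"
  shows "(\<lambda>\<omega>. rate_flow (X \<omega>) (max 0 (S \<omega>))) \<in> borel_measurable M"
proof -
  note [measurable] = measurable_\<mu>_borel[OF X]
  have "(\<lambda>\<omega>. (X \<omega>, max 0 (S \<omega>))) \<in> M \<rightarrow>\<^sub>M borel \<Otimes>\<^sub>M borel" by measurable
  then have "(\<lambda>\<omega>. (X \<omega>, max 0 (S \<omega>))) \<in> M \<rightarrow>\<^sub>M restrict_space borel (E \<times> {0..})"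
    using measurable_\<mu>_in[OF X] by (intro measurable_restrict_space2) (auto simp: borel_prod)
  from measurable_compose[OF this flow_measurable]
  have "(\<lambda>\<omega>. \<Phi> (X \<omega>) (max 0 (S \<omega>))) \<in> borel_measurable M" by simp
  then have "(\<lambda>\<omega>. \<Phi> (X \<omega>) (max 0 (S \<omega>))) \<in> M \<rightarrow>\<^sub>M restrict_space borel (closure E)"
    using measurable_\<mu>_in[OF X] flow_closure by (intro measurable_restrict_space2) auto
  from measurable_compose[OF this rate_measurable] show ?thesis
    unfolding rate_flow_def .
qed

lemma measurable_Qd[measurable (raw)]:
  assumes X: "X \<in> M \<rightarrow>\<^sub>M \<mu>" and S[measurable]: "S \<in> borel_measurable M" and Y: "Y \<in> M \<rightarrow>\<^sub>M \<mu>"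
  shows "(\<lambda>\<omega>. Qd (X \<omega>) (max 0 (S \<omega>)) (Y \<omega>)) \<in> borel_measurable M"
proof -
  note [measurable] = measurable_\<mu>_borel[OF X] measurable_\<mu>_borel[OF Y]
  have "(\<lambda>\<omega>. (X \<omega>, max 0 (S \<omega>), Y \<omega>)) \<in> M \<rightarrow>\<^sub>M borel \<Otimes>\<^sub>M (borel \<Otimes>\<^sub>M borel)" by measurable
  then have "(\<lambda>\<omega>. (X \<omega>, max 0 (S \<omega>), Y \<omega>)) \<in> M \<rightarrow>\<^sub>M restrict_space borel (E \<times> {0..} \<times> E)"
    using measurable_\<mu>_in[OF X] measurable_\<mu>_in[OF Y]
    by (intro measurable_restrict_space2) (auto simp: borel_prod)
  from measurable_compose[OF this Qd_measurable] show ?thesis by simp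
qed

lemma rate_flow_nonneg: "x \<in> E \<Longrightarrow> 0 \<le> s \<Longrightarrow> 0 \<le> rate_flow x s"
  unfolding rate_flow_def using rate_nonneg flow_closure by blast

lemma rate_flow_measurable:
  assumes "x \<in> E"
  shows "(\<lambda>s. rate_flow x (max 0 s)) \<in> borel_measurable borel"
  using assms by (intro measurable_rate_flow) auto

lemma rate_flow_set_integrable:
  assumes x: "x \<in> E"
  shows "set_integrable lborel {0..b} (rate_flow x)"
proof (cases "0 \<le> b")
  case True
  obtain M where M: "\<And>t. 0 \<le> t \<Longrightarrow> 0 \<le> M t" "\<And>T. 0 \<le> T \<Longrightarrow> set_integrable lborel {0..T} M"
    "\<And>\<xi> t. \<xi> \<in> E \<Longrightarrow> 0 \<le> t \<Longrightarrow> rate_flow \<xi> t \<le> M t"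
    using rate_dominated by blast
  have "(\<lambda>s. indicator {0..b} s *\<^sub>R rate_flow x s) = (\<lambda>s. indicator {0..b} s *\<^sub>R rate_flow x (max 0 s))"
    by (auto simp: indicator_def)
  then have "set_borel_measurable lborel {0..b} (rate_flow x)"
    unfolding set_borel_measurable_def using rate_flow_measurable[OF x] by simp
  then show ?thesis
    using M(1,3) rate_flow_nonneg[OF x] x
    by (intro set_integrable_bound[OF M(2)[OF True]]) (auto intro!: AE_I2)
qed (simp add: set_integrable_def)

lemma G_eq: "x \<in> E \<Longrightarrow> G x t = exp (- integral {0..t} (rate_flow x))"
  unfolding G_def using set_borel_integral_eq_integral(2)[OF rate_flow_set_integrable] by simp

lemma G_pos: "0 < G x t"
  unfolding G_def by simp

lemma G_0: "x \<in> E \<Longrightarrow> G x 0 = 1"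
  by (simp add: G_eq)

lemma G_continuous: "x \<in> E \<Longrightarrow> continuous_on {0..b} (G x)"
  using indefinite_integral_continuous_1[OF set_borel_integral_eq_integral(1)[OF rate_flow_set_integrable]]
  by (subst continuous_on_cong[OF refl G_eq]) (auto intro!: continuous_intros)

text \<open>Since \<open>f\<close> and \<open>G\<close> are continuous, so is the rate along the flow, whence \<open>G' = - f\<close>.\<close>

lemma rate_flow_continuous:
  assumes x: "x \<in> E"
  shows "continuous_on {0..b} (rate_flow x)"
proof -
  have "continuous_on {0..b} (\<lambda>s. f x s / G x s)"
    using continuous_on_subset[OF f_continuous[OF x], of "{0..b}"] G_continuous[OF x] G_pos
    by (intro continuous_intros) (auto simp: less_imp_neq[symmetric])
  moreover have "f x s / G x s = rate_flow x s" for s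
    using G_pos[of x s] by (simp add: f_def)
  ultimately show ?thesis by simp
qed

lemma G_has_derivative:
  assumes x: "x \<in> E" and t: "t \<in> {0..b}"
  shows "(G x has_real_derivative - f x t) (at t within {0..b})"
proof -
  have "((\<lambda>t. exp (- integral {0..t} (rate_flow x))) has_real_derivative - f x t) (at t within {0..b})"
    using t by (auto intro!: derivative_eq_intros integral_has_real_derivative[OF rate_flow_continuous[OF x]]
        simp: f_def G_eq[OF x])
  moreover have "G x = (\<lambda>t. exp (- integral {0..t} (rate_flow x)))"
    using G_eq[OF x] by (rule ext)
  ultimately show ?thesis by simp
qed

lemma f_FTC:
  assumes x: "x \<in> E" and "0 \<le> a" "a \<le> b"
  shows "has_bochner_integral lborel (\<lambda>s. indicator {a..b} s *\<^sub>R f x s) (G x a - G x b)"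
proof -
  have "has_bochner_integral lborel (\<lambda>s. indicator {a..b} s *\<^sub>R f x s) ((\<lambda>t. - G x t) b - (\<lambda>t. - G x t) a)"
  proof (rule has_bochner_integral_FTC_Icc)
    fix s assume s: "a \<le> s" "s \<le> b"
    have "((\<lambda>t. - G x t) has_real_derivative f x s) (at s within {a..b})"
      using DERIV_subset[OF G_has_derivative[OF x, of s b], of "{a..b}"] s assms
      by (auto intro!: derivative_eq_intros)
    then show "((\<lambda>t. - G x t) has_vector_derivative f x s) (at s within {a..b})"
      by (simp add: has_real_derivative_iff_has_vector_derivative)
  qed (use assms continuous_on_subset[OF f_continuous[OF x], of "{a..b}"] in auto)
  then show ?thesis by simp
qed

lemma measurable_G[measurable (raw)]:
  assumes X: "X \<in> M \<rightarrow>\<^sub>M \<mu>" and S[measurable]: "S \<in> borel_measurable M"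
  shows "(\<lambda>\<omega>. G (X \<omega>) (max 0 (S \<omega>))) \<in> borel_measurable M"
proof -
  note [measurable] = X
  \<comment> \<open>Writing the moving interval as a predicate and clamping the integrand gives an
    integral that is measurable in its parameter.\<close>
  have "G (X \<omega>) (max 0 (S \<omega>))
      = exp (- (\<integral>s. indicator {s. 0 \<le> s \<and> s \<le> max 0 (S \<omega>)} s * rate_flow (X \<omega>) (max 0 s) \<partial>lborel))" for \<omega>
    unfolding G_def set_lebesgue_integral_def
    by (intro arg_cong[where f="\<lambda>i. exp (- i)"] Bochner_Integration.integral_cong) (auto simp: indicator_def)
  then show ?thesis by simp
qed

lemma measurable_f[measurable (raw)]:
  assumes [measurable]: "X \<in> M \<rightarrow>\<^sub>M \<mu>" "S \<in> borel_measurable M"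
  shows "(\<lambda>\<omega>. f (X \<omega>) (max 0 (S \<omega>))) \<in> borel_measurable M"
  unfolding f_def by measurable


text \<open>Under the density \<open>dens x\<close>, whose atom at the exit time has been spread over the unit interval
  \<open>[exit x, exit x + 1]\<close>, the law of \<open>min s (exit x)\<close> is that of the first jump time.\<close>

definition dens :: "'a \<Rightarrow> real \<Rightarrow> real" where
  "dens x s = (if 0 \<le> s \<and> s < exit x then f x (max 0 s)
     else if exit x \<le> s \<and> s \<le> exit x + 1 then G x (max 0 (exit x)) else 0)"

text \<open>Density, for Lebesgue measure times \<open>\<mu>\<close>, of the unfolded first jump
  time together with \<open>Z\<^sub>1\<close> when the start is \<open>x\<close>. The post-jump law
  is taken at the folded time \<open>min s (exit x)\<close>.\<close>

definition joint :: "'a \<Rightarrow> real \<Rightarrow> 'a \<Rightarrow> real" where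
  "joint x s y = dens x s * Qd x (max 0 (min s (exit x))) y"

text \<open>As a function of \<open>y\<close>, the density for \<open>\<mu>\<close> of
  \<open>Z\<^sub>1\<close> on the event that the first jump time is at least \<open>u\<close>. At
  \<open>u = 0\<close> it is the transition density of the chain.\<close>

definition joint_tail :: "'a \<Rightarrow> 'a \<Rightarrow> real \<Rightarrow> real" where
  "joint_tail x y u = (\<integral>s. joint x s y * of_bool (u \<le> min s (exit x)) \<partial>lborel)"

lemma measurable_dens[measurable (raw)]:
  assumes [measurable]: "X \<in> M \<rightarrow>\<^sub>M \<mu>" "S \<in> borel_measurable M"
  shows "(\<lambda>\<omega>. dens (X \<omega>) (S \<omega>)) \<in> borel_measurable M"
  unfolding dens_def by measurable

lemma measurable_joint[measurable (raw)]:
  assumes [measurable]: "X \<in> M \<rightarrow>\<^sub>M \<mu>" "S \<in> borel_measurable M" "Y \<in> M \<rightarrow>\<^sub>M \<mu>"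
  shows "(\<lambda>\<omega>. joint (X \<omega>) (S \<omega>) (Y \<omega>)) \<in> borel_measurable M"
  unfolding joint_def by measurable

lemma measurable_joint_tail[measurable (raw)]:
  assumes [measurable]: "X \<in> M \<rightarrow>\<^sub>M \<mu>" "Y \<in> M \<rightarrow>\<^sub>M \<mu>" "U \<in> borel_measurable M"
  shows "(\<lambda>\<omega>. joint_tail (X \<omega>) (Y \<omega>) (U \<omega>)) \<in> borel_measurable M"
  unfolding joint_tail_def by measurable

lemma dens_nonneg: "x \<in> E \<Longrightarrow> 0 \<le> dens x s"
  using f_pos[of x s] G_pos by (auto simp: dens_def less_imp_le)

text \<open>After folding, \<open>w\<close> is constant on the spread atom, whose interval has
  length one; hence the second summand. Constant \<open>w\<close> yields the tails of the jump time,
  and \<open>w = (\<lambda>s. Qd x s y)\<close> yields \<open>joint_tail\<close>.\<close>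

lemma dens_integral:
  assumes x: "x \<in> E" and u: "0 \<le> u" "u \<le> exit x" and w: "continuous_on {0..exit x} w"
  shows "has_bochner_integral lborel
      (\<lambda>s. dens x s * w (max 0 (min s (exit x))) * of_bool (u \<le> min s (exit x)))
      ((LINT s:{u..exit x}|lborel. f x s * w s) + G x (exit x) * w (exit x))"
proof -
  let ?T = "exit x"
  have [measurable]: "(\<lambda>s. w (max 0 (min s ?T))) \<in> borel_measurable borel"
    using exit_nonneg[OF x]
    by (intro borel_measurable_continuous_onI continuous_on_compose2[OF w] continuous_intros) auto
  have [measurable]: "dens x \<in> borel_measurable borel"
    using x by (intro measurable_dens) auto
  have "continuous_on {u..?T} (\<lambda>s. f x s * w s)"
    using u continuous_on_subset[OF f_continuous[OF x]] continuous_on_subset[OF w]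
    by (intro continuous_on_mult) (auto simp: subset_eq)
  then have i: "set_integrable lborel {u..?T} (\<lambda>s. f x s * w s)"
    by (rule borel_integrable_atLeastAtMost')
  have 1: "has_bochner_integral lborel (\<lambda>s. indicator {u..?T} s *\<^sub>R (f x s * w s))
      (LINT s:{u..?T}|lborel. f x s * w s)"
    using i unfolding set_integrable_def set_lebesgue_integral_def by (rule has_bochner_integral_integrable)
  have 2: "has_bochner_integral lborel (\<lambda>s. indicator {?T..?T+1} s *\<^sub>R (G x ?T * w ?T))
      (measure lborel {?T..?T+1} *\<^sub>R (G x ?T * w ?T))"
    by (rule has_bochner_integral_indicator) auto
  have 3: "has_bochner_integral lborel
      (\<lambda>s. indicator {u..?T} s *\<^sub>R (f x s * w s) + indicator {?T..?T+1} s *\<^sub>R (G x ?T * w ?T))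
      ((LINT s:{u..?T}|lborel. f x s * w s) + G x ?T * w ?T)"
    using has_bochner_integral_add[OF 1 2] by simp
  show ?thesis
  proof (rule has_bochner_integral_cong_AE[THEN iffD1, OF _ _ _ 3])
    \<comment> \<open>At \<open>s = ?T\<close> both indicators are 1 while \<open>dens\<close> keeps
      only the atom; this single point is null.\<close>
    show "AE s in lborel. indicator {u..?T} s *\<^sub>R (f x s * w s) + indicator {?T..?T+1} s *\<^sub>R (G x ?T * w ?T)
        = dens x s * w (max 0 (min s ?T)) * of_bool (u \<le> min s ?T)"
      using AE_lborel_singleton[of ?T]
    proof eventually_elim
      case (elim s)
      then show ?case
        using u by (cases "s < ?T"; cases "s \<le> ?T + 1"; cases "u \<le> s")
          (auto simp: dens_def indicator_def max_def min_def)
    qed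
  qed (use 3 in \<open>auto dest: borel_measurable_has_bochner_integral\<close>)
qed

definition Qd_low :: real where
  "Qd_low = (SOME m. 0 < m \<and> (\<forall>x\<in>E. \<forall>s\<ge>0. \<forall>y\<in>E. m \<le> Qd x s y))"

lemma Qd_low: "0 < Qd_low" "x \<in> E \<Longrightarrow> 0 \<le> s \<Longrightarrow> y \<in> E \<Longrightarrow> Qd_low \<le> Qd x s y"
proof -
  have "0 < Qd_low \<and> (\<forall>x\<in>E. \<forall>s\<ge>0. \<forall>y\<in>E. Qd_low \<le> Qd x s y)"
    unfolding Qd_low_def by (rule someI_ex) (rule Qd_lower_bound)
  then show "0 < Qd_low" "x \<in> E \<Longrightarrow> 0 \<le> s \<Longrightarrow> y \<in> E \<Longrightarrow> Qd_low \<le> Qd x s y" by auto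
qed

lemma Qd_pos: "x \<in> E \<Longrightarrow> 0 \<le> s \<Longrightarrow> y \<in> E \<Longrightarrow> 0 < Qd x s y"
  using Qd_low(1) Qd_low(2)[of x s y] by linarith

lemma joint_nonneg: "x \<in> E \<Longrightarrow> y \<in> E \<Longrightarrow> 0 \<le> joint x s y"
  using Qd_pos[of x "max 0 (min s (exit x))" y] dens_nonneg[of x s] by (simp add: joint_def)

text \<open>The integral of \<open>f\<close> contributes \<open>G x u - G x (exit x)\<close>, and
  the atom returns the subtracted term.\<close>

lemma dens_tail:
  assumes "x \<in> E" "0 \<le> u" "u \<le> exit x"
  shows "has_bochner_integral lborel (\<lambda>s. dens x s * of_bool (u \<le> min s (exit x))) (G x u)"
  using dens_integral[OF assms, of "\<lambda>_. 1"] f_FTC[OF assms]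
  by (simp add: set_lebesgue_integral_def has_bochner_integral_integral_eq)

lemma dens_total:
  assumes x: "x \<in> E"
  shows "has_bochner_integral lborel (dens x) 1"
proof -
  have "(\<lambda>s. dens x s * of_bool (0 \<le> min s (exit x))) = dens x"
    using exit_nonneg[OF x] by (auto simp: dens_def fun_eq_iff)
  then show ?thesis
    using dens_tail[OF x order_refl exit_nonneg[OF x]] G_0[OF x] by simp
qed

text \<open>The second formula is exactly the denominator of \<open>hazard\<close>; this links the
  rate to be estimated with the joint law of time and target.\<close>

lemma joint_tail_eq:
  assumes x: "x \<in> E" and y: "y \<in> E" and u: "0 \<le> u" "u \<le> exit x"
  shows "has_bochner_integral lborel (\<lambda>s. joint x s y * of_bool (u \<le> min s (exit x))) (joint_tail x y u)"
    and "joint_tail x y u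
      = (LINT s:{u..exit x}|lborel. f x s * Qd x s y) + G x (exit x) * Qd x (exit x) y"
  using dens_integral[OF x u, of "\<lambda>s. Qd x s y"] continuous_on_subset[OF Qd_continuous[OF x y], of "{0..exit x}"]
  unfolding joint_tail_def joint_def
  by (auto simp: has_bochner_integral_iff)

lemma joint_tail_pos:
  assumes x: "x \<in> E" and y: "y \<in> E" and u: "0 \<le> u" "u \<le> exit x"
  shows "0 < joint_tail x y u"
proof -
  have "0 \<le> (LINT s:{u..exit x}|lborel. f x s * Qd x s y)"
    unfolding set_lebesgue_integral_def using u x y
    by (intro Bochner_Integration.integral_nonneg)
      (auto simp: indicator_def intro!: mult_nonneg_nonneg less_imp_le[OF f_pos] less_imp_le[OF Qd_pos])
  moreover have "0 < G x (exit x) * Qd x (exit x) y"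
    using G_pos Qd_pos[OF x exit_nonneg[OF x] y] by simp
  ultimately show ?thesis by (simp add: joint_tail_eq(2)[OF assms])
qed

lemma joint_tail_has_derivative:
  assumes x: "x \<in> E" and y: "y \<in> E" and u: "u \<in> {0..exit x}"
  shows "(joint_tail x y has_real_derivative - (f x u * Qd x u y)) (at u within {0..exit x})"
proof -
  let ?T = "exit x"
  have c: "continuous_on {0..} (\<lambda>s. f x s * Qd x s y)"
    by (intro continuous_intros f_continuous Qd_continuous x y)
  then have c': "continuous_on {0..?T} (\<lambda>s. f x s * Qd x s y)"
    by (rule continuous_on_subset) auto
  have eq: "joint_tail x y v = integral {v..?T} (\<lambda>s. f x s * Qd x s y) + G x ?T * Qd x ?T y"
    if "v \<in> {0..?T}" for v
  proof -
    have "set_integrable lborel {v..?T} (\<lambda>s. f x s * Qd x s y)"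
      using that by (intro borel_integrable_atLeastAtMost' continuous_on_subset[OF c]) auto
    from set_borel_integral_eq_integral(2)[OF this] show ?thesis
      using that joint_tail_eq(2)[OF x y] by simp
  qed
  have "((\<lambda>v. integral {v..?T} (\<lambda>s. f x s * Qd x s y) + G x ?T * Qd x ?T y) has_real_derivative
      - (f x u * Qd x u y)) (at u within {0..?T})"
    using integral_has_real_derivative'[OF c' u] by (auto intro!: derivative_eq_intros)
  then show ?thesis
    by (rule has_field_derivative_transform_within[where d=1]) (use u eq in auto)
qed

lemma joint_tail_continuous: "x \<in> E \<Longrightarrow> y \<in> E \<Longrightarrow> continuous_on {0..exit x} (joint_tail x y)"
  by (rule DERIV_continuous_on, rule joint_tail_has_derivative)

lemma hazard_eq:
  "x \<in> E \<Longrightarrow> y \<in> E \<Longrightarrow> u \<in> {0..exit x} \<Longrightarrow> hazard x y u = f x u * Qd x u y / joint_tail x y u"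
  by (simp add: hazard_def joint_tail_eq(2))

text \<open>The conditional hazard rate is the logarithmic derivative of \<open>joint_tail\<close>.\<close>

lemma survival_eq:
  assumes x: "x \<in> E" and y: "y \<in> E" and u: "u \<in> {0..exit x}"
  shows "survival x y u = joint_tail x y u / joint_tail x y 0"
proof -
  let ?T = "exit x"
  have pos: "0 < joint_tail x y v" if "v \<in> {0..?T}" for v
    using joint_tail_pos[OF x y] that by auto
  have hc: "continuous_on {0..?T} (\<lambda>s. f x s * Qd x s y / joint_tail x y s)"
    using pos by (intro continuous_intros joint_tail_continuous x y
        continuous_on_subset[OF f_continuous[OF x]] continuous_on_subset[OF Qd_continuous[OF x y]])
      (auto simp: less_imp_neq[symmetric])
  have "has_bochner_integral lborel (\<lambda>s. indicator {0..u} s *\<^sub>R (f x s * Qd x s y / joint_tail x y s))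
      ((\<lambda>s. - ln (joint_tail x y s)) u - (\<lambda>s. - ln (joint_tail x y s)) 0)"
  proof (rule has_bochner_integral_FTC_Icc)
    fix s assume s: "0 \<le> s" "s \<le> u"
    then have "s \<in> {0..?T}" using u by auto
    then have "((\<lambda>s. - ln (joint_tail x y s)) has_real_derivative f x s * Qd x s y / joint_tail x y s)
        (at s within {0..?T})"
      using pos by (auto intro!: derivative_eq_intros joint_tail_has_derivative x y)
    then show "((\<lambda>s. - ln (joint_tail x y s)) has_vector_derivative f x s * Qd x s y / joint_tail x y s)
        (at s within {0..u})"
      using u by (auto simp flip: has_real_derivative_iff_has_vector_derivative elim: DERIV_subset)
  qed (use u hc in \<open>auto elim: continuous_on_subset\<close>)
  moreover have "indicator {0..u} s *\<^sub>R (f x s * Qd x s y / joint_tail x y s) = indicator {0..u} s *\<^sub>R hazard x y s" for s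
    using u by (auto simp: indicator_def hazard_eq[OF x y])
  ultimately have "(LINT s:{0..u}|lborel. hazard x y s) = ln (joint_tail x y 0) - ln (joint_tail x y u)"
    unfolding set_lebesgue_integral_def by (simp add: has_bochner_integral_iff)
  then show ?thesis
    using pos u exit_nonneg[OF x] by (simp add: survival_def exp_diff)
qed

end

section \<open>The law of one step\<close>

context regular_pdmp
begin

lemma Q_flow_prob: "x \<in> E \<Longrightarrow> 0 \<le> s \<Longrightarrow> emeasure (Q_flow x s) E = 1"
  using Q_E[OF flow_closure] measurable_space[OF Q_kernel, of "\<Phi> x s"] flow_closure[of x s]
  by (auto simp: Q_flow_def space_prob_algebra space_restrict_space
      finite_measure.emeasure_eq_measure[OF prob_space.finite_measure])

lemma Qd_total: 
  assumes "x \<in> E" "0 \<le> s"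
  shows "(\<integral>\<^sup>+y. ennreal (Qd x s y) \<partial>\<mu>) = 1"
proof -
  have "(\<integral>\<^sup>+y\<in>E. ennreal (Qd x s y) \<partial>\<mu>) = 1"
    using Qd_density[OF assms, of E] Q_flow_prob[OF assms] sets.top[of \<mu>] by simp
  also have "(\<integral>\<^sup>+y\<in>E. ennreal (Qd x s y) \<partial>\<mu>) = (\<integral>\<^sup>+y. ennreal (Qd x s y) \<partial>\<mu>)"
    by (intro nn_integral_cong) auto
  finally show ?thesis .
qed

text \<open>A density of total mass one that is at least \<open>Qd_low\<close> forces
  \<open>\<mu>\<close> to have mass at most \<open>1 / Qd_low\<close>. Product measures and Fubini
  depend on this.\<close>

lemma finite_\<mu>: "finite_measure \<mu>"
proof
  obtain x where x: "x \<in> E" using E_nonempty by auto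
  have "ennreal Qd_low * emeasure \<mu> E = (\<integral>\<^sup>+y. ennreal Qd_low \<partial>\<mu>)"
    by simp
  also have "\<dots> \<le> (\<integral>\<^sup>+y. ennreal (Qd x 0 y) \<partial>\<mu>)"
    using Qd_low(2)[OF x] by (intro nn_integral_mono ennreal_leI) auto
  also have "\<dots> = 1" using Qd_total[OF x] by simp
  finally show "emeasure \<mu> (space \<mu>) \<noteq> \<infinity>"
    using Qd_low(1) by (auto simp: top_unique ennreal_mult_top)
qed

sublocale \<mu>: finite_measure \<mu> by (rule finite_\<mu>)

sublocale lborel_\<mu>: pair_sigma_finite "lborel :: real measure" \<mu> ..

definition jump_time_law :: "'a \<Rightarrow> real measure" where
  "jump_time_law x = distr (density lborel (\<lambda>s. ennreal (dens x s))) borel (\<lambda>s. min s (exit x))"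

text \<open>Clamping the time makes this a probability kernel for every real \<open>s\<close>; for
  nonnegative \<open>s\<close> it coincides with \<open>Q_flow x s\<close> on the measurable subsets
  of \<open>E\<close>.\<close>

definition jump_law :: "'a \<times> real \<Rightarrow> 'a measure" where
  "jump_law = (\<lambda>(x, s). density \<mu> (\<lambda>y. ennreal (Qd x (max 0 s) y)))"

lemma nn_integral_jump_time_law:
  assumes x: "x \<in> E" and [measurable]: "h \<in> borel_measurable borel"
  shows "(\<integral>\<^sup>+s. h s \<partial>jump_time_law x) = (\<integral>\<^sup>+s. ennreal (dens x s) * h (min s (exit x)) \<partial>lborel)"
proof -
  have [measurable]: "dens x \<in> borel_measurable borel"
    using x by (intro measurable_dens) auto
  show ?thesis
    unfolding jump_time_law_def by (simp add: nn_integral_distr nn_integral_density)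
qed

lemma nn_integral_jump_law:
  assumes x: "x \<in> E" and [measurable]: "h \<in> borel_measurable \<mu>"
  shows "(\<integral>\<^sup>+y. h y \<partial>jump_law (x, s)) = (\<integral>\<^sup>+y. ennreal (Qd x (max 0 s) y) * h y \<partial>\<mu>)"
proof -
  have [measurable]: "(\<lambda>y. Qd x (max 0 s) y) \<in> borel_measurable \<mu>"
    using x by (intro measurable_Qd) auto
  show ?thesis
    unfolding jump_law_def by (simp add: nn_integral_density)
qed

lemma emeasure_jump_time_law:
  "x \<in> E \<Longrightarrow> B \<in> sets borel \<Longrightarrow>
    emeasure (jump_time_law x) B = (\<integral>\<^sup>+s. ennreal (dens x s) * indicator B (min s (exit x)) \<partial>lborel)"
  using nn_integral_jump_time_law[of x "indicator B"] nn_integral_indicator[of B "jump_time_law x"]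
  by (simp add: jump_time_law_def)

lemma emeasure_jump_law:
  "x \<in> E \<Longrightarrow> B \<in> sets \<mu> \<Longrightarrow>
    emeasure (jump_law (x, s)) B = (\<integral>\<^sup>+y. ennreal (Qd x (max 0 s) y) * indicator B y \<partial>\<mu>)"
  using nn_integral_jump_law[of x "indicator B" s] nn_integral_indicator[of B "jump_law (x, s)"]
  by (simp add: jump_law_def)

lemma dens_nn_total: "x \<in> E \<Longrightarrow> (\<integral>\<^sup>+s. ennreal (dens x s) \<partial>lborel) = 1"
  using dens_total[of x] dens_nonneg[of x]
  by (subst nn_integral_eq_integral) (auto simp: has_bochner_integral_iff)

lemma prob_jump_time_law: "x \<in> E \<Longrightarrow> prob_space (jump_time_law x)"
  using emeasure_jump_time_law[of x UNIV] dens_nn_total[of x]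
  by (intro prob_spaceI) (auto simp: jump_time_law_def)

lemma prob_jump_law: "x \<in> E \<Longrightarrow> prob_space (jump_law (x, s))"
  using emeasure_jump_law[of x E s] Qd_total[of x "max 0 s"] sets.top[of \<mu>]
  by (intro prob_spaceI) (auto simp: jump_law_def intro!: trans[OF _ Qd_total[of x "max 0 s"]] nn_integral_cong)

lemma measurable_jump_time_law: "jump_time_law \<in> \<mu> \<rightarrow>\<^sub>M prob_algebra borel"
proof (intro measurable_prob_algebraI measurable_subprob_algebra)
  fix B :: "real set" assume [measurable]: "B \<in> sets borel"
  have "(\<lambda>x. \<integral>\<^sup>+s. ennreal (dens x s) * indicator B (min s (exit x)) \<partial>lborel) \<in> borel_measurable \<mu>"
    by measurable
  then show "(\<lambda>x. emeasure (jump_time_law x) B) \<in> borel_measurable \<mu>"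
    by (rule measurable_cong[THEN iffD2, rotated]) (simp add: emeasure_jump_time_law)
qed (auto simp: prob_jump_time_law prob_space_imp_subprob_space, auto simp: jump_time_law_def)

lemma measurable_jump_law: "jump_law \<in> \<mu> \<Otimes>\<^sub>M borel \<rightarrow>\<^sub>M prob_algebra \<mu>"
proof (intro measurable_prob_algebraI measurable_subprob_algebra)
  fix B assume [measurable]: "B \<in> sets \<mu>"
  have "(\<lambda>p. \<integral>\<^sup>+y. ennreal (Qd (fst p) (max 0 (snd p)) y) * indicator B y \<partial>\<mu>) \<in> borel_measurable (\<mu> \<Otimes>\<^sub>M borel)"
    by measurable
  then show "(\<lambda>p. emeasure (jump_law p) B) \<in> borel_measurable (\<mu> \<Otimes>\<^sub>M borel)"
    by (rule measurable_cong[THEN iffD2, rotated]) (auto simp: space_pair_measure emeasure_jump_law)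
qed (auto simp: prob_jump_law space_pair_measure prob_space_imp_subprob_space, auto simp: jump_law_def)

lemma jump_law_Q_flow:
  assumes "x \<in> E" "0 \<le> s" "B \<in> sets \<mu>"
  shows "measure (jump_law (x, s)) B = measure (Q_flow x s) B"
  using Qd_density[OF assms] emeasure_jump_law[of x B s] assms by (simp add: measure_def)

text \<open>The right-hand side is the survival function prescribed for the chain. Before the exit
  time, strict and weak inequality differ by one null time, and no folded time exceeds the exit
  time.\<close>

lemma jump_time_law_tail:
  assumes x: "x \<in> E" and t: "0 \<le> t"
  shows "measure (jump_time_law x) {t<..} = (if t < exit x then G x t else 0)"
proof (cases "t < exit x")
  case True
  have "emeasure (jump_time_law x) {t<..} = (\<integral>\<^sup>+s. ennreal (dens x s) * indicator {t<..} (min s (exit x)) \<partial>lborel)"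
    using x by (simp add: emeasure_jump_time_law)
  also have "\<dots> = (\<integral>\<^sup>+s. ennreal (dens x s * of_bool (t \<le> min s (exit x))) \<partial>lborel)"
    using AE_lborel_singleton[of t] True
    by (intro nn_integral_cong_AE) (auto elim!: eventually_mono simp: indicator_def)
  also have "\<dots> = ennreal (G x t)"
    using dens_tail[OF x t] True dens_nonneg[OF x]
    by (subst nn_integral_eq_integral) (auto simp: has_bochner_integral_iff)
  finally show ?thesis using True G_pos[of x t] by (simp add: measure_def)
next
  case False
  then have "emeasure (jump_time_law x) {t<..} = 0"
    using x by (auto simp: emeasure_jump_time_law indicator_def intro!: nn_integral_zero')
  then show ?thesis using False by (simp add: measure_def)
qed

text \<open>The chain prescribes survival probabilities for nonnegative times only, while the
  half-lines generating the Borel sets also have negative endpoints.\<close>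

lemma jump_time_law_tail_neg:
  assumes x: "x \<in> E" and t: "t < 0"
  shows "measure (jump_time_law x) {t<..} = 1"
proof -
  have "emeasure (jump_time_law x) {t<..} = (\<integral>\<^sup>+s. ennreal (dens x s) \<partial>lborel)"
    unfolding emeasure_jump_time_law[OF x borel_open[OF open_greaterThan]]
    using t exit_nonneg[OF x] by (intro nn_integral_cong) (auto simp: dens_def indicator_def)
  then show ?thesis using dens_nn_total[OF x] by (simp add: measure_def)
qed

text \<open>Merges the two successive kernels into one density on a product, so that time and
  location can be integrated in either order.\<close>

lemma nn_integral_joint:
  assumes x: "x \<in> E" and [measurable]: "h \<in> borel_measurable (borel \<Otimes>\<^sub>M \<mu>)"
  shows "(\<integral>\<^sup>+s. \<integral>\<^sup>+y. h (s, y) \<partial>jump_law (x, s) \<partial>jump_time_law x)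
    = (\<integral>\<^sup>+p. ennreal (joint x (fst p) (snd p)) * h (min (fst p) (exit x), snd p) \<partial>(lborel \<Otimes>\<^sub>M \<mu>))"
proof -
  note [measurable] = measurable_const[of x \<mu>]
  have x': "x \<in> space \<mu>" using x by simp
  have [measurable]: "(\<lambda>s. \<integral>\<^sup>+y. ennreal (Qd x (max 0 s) y) * h (s, y) \<partial>\<mu>) \<in> borel_measurable borel"
    using x' by measurable
  have m: "(\<lambda>p. ennreal (joint x (fst p) (snd p)) * h (min (fst p) (exit x), snd p)) \<in> borel_measurable (lborel \<Otimes>\<^sub>M \<mu>)"
    using x' by measurable
  have "(\<integral>\<^sup>+s. \<integral>\<^sup>+y. h (s, y) \<partial>jump_law (x, s) \<partial>jump_time_law x)
      = (\<integral>\<^sup>+s. \<integral>\<^sup>+y. ennreal (Qd x (max 0 s) y) * h (s, y) \<partial>\<mu> \<partial>jump_time_law x)"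
    by (intro nn_integral_cong nn_integral_jump_law x) measurable
  also have "\<dots> = (\<integral>\<^sup>+s. ennreal (dens x s) * (\<integral>\<^sup>+y. ennreal (Qd x (max 0 (min s (exit x))) y) * h (min s (exit x), y) \<partial>\<mu>) \<partial>lborel)"
    by (subst nn_integral_jump_time_law[OF x]) auto
  also have "\<dots> = (\<integral>\<^sup>+s. \<integral>\<^sup>+y. ennreal (joint x s y) * h (min s (exit x), y) \<partial>\<mu> \<partial>lborel)"
  proof (rule nn_integral_cong)
    fix s :: real
    have "ennreal (joint x s y) = ennreal (dens x s) * ennreal (Qd x (max 0 (min s (exit x))) y)" if "y \<in> E" for y
      using dens_nonneg[OF x, of s] Qd_pos[OF x, of "max 0 (min s (exit x))" y] that
      by (simp add: joint_def ennreal_mult)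
    then show "ennreal (dens x s) * (\<integral>\<^sup>+y. ennreal (Qd x (max 0 (min s (exit x))) y) * h (min s (exit x), y) \<partial>\<mu>)
        = (\<integral>\<^sup>+y. ennreal (joint x s y) * h (min s (exit x), y) \<partial>\<mu>)"
      using x' by (subst nn_integral_cmult[symmetric]) (auto intro!: nn_integral_cong simp: mult.assoc)
  qed
  also have "\<dots> = (\<integral>\<^sup>+p. ennreal (joint x (fst p) (snd p)) * h (min (fst p) (exit x), snd p) \<partial>(lborel \<Otimes>\<^sub>M \<mu>))"
    by (subst \<mu>.nn_integral_fst[OF m, symmetric]) simp
  finally show ?thesis .
qed

lemma nn_integral_joint_total:
  assumes x: "x \<in> E"
  shows "(\<integral>\<^sup>+p. ennreal (joint x (fst p) (snd p)) \<partial>(lborel \<Otimes>\<^sub>M \<mu>)) = 1"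
proof -
  have "(\<integral>\<^sup>+s. \<integral>\<^sup>+y. 1 \<partial>jump_law (x, s) \<partial>jump_time_law x) = 1"
    using prob_jump_time_law[OF x] prob_jump_law[OF x]
    by (simp add: prob_space.emeasure_space_1)
  then show ?thesis using nn_integral_joint[OF x, of "\<lambda>_. 1"] by simp
qed

lemma joint_has_integral:
  assumes x: "x \<in> E"
  shows "has_bochner_integral (lborel \<Otimes>\<^sub>M \<mu>) (\<lambda>p. joint x (fst p) (snd p)) 1"
proof -
  have x': "x \<in> space \<mu>" using x by simp
  have [measurable]: "(\<lambda>p. joint x (fst p) (snd p)) \<in> borel_measurable (lborel \<Otimes>\<^sub>M \<mu>)"
    using x' by measurable
  show ?thesis
    using nn_integral_joint_total[OF x] joint_nonneg[OF x]
    by (intro has_bochner_integral_nn_integral) (auto intro!: AE_I2 simp: space_pair_measure)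
qed

lemma joint_tail_0_total:
  assumes x: "x \<in> E"
  shows "(\<integral>\<^sup>+y. ennreal (joint_tail x y 0) \<partial>\<mu>) = 1"
proof -
  have x': "x \<in> space \<mu>" using x by simp
  have m: "(\<lambda>p. ennreal (joint x (fst p) (snd p))) \<in> borel_measurable (lborel \<Otimes>\<^sub>M \<mu>)"
    using x' by measurable
  have "(\<integral>\<^sup>+y. ennreal (joint_tail x y 0) \<partial>\<mu>) = (\<integral>\<^sup>+y. \<integral>\<^sup>+s. ennreal (joint x s y) \<partial>lborel \<partial>\<mu>)"
  proof (rule nn_integral_cong)
    fix y assume "y \<in> space \<mu>"
    then have y: "y \<in> E" by simp
    have "(\<lambda>s. joint x s y * of_bool (0 \<le> min s (exit x))) = (\<lambda>s. joint x s y)"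
      using exit_nonneg[OF x] by (auto simp: joint_def dens_def fun_eq_iff)
    then show "ennreal (joint_tail x y 0) = (\<integral>\<^sup>+s. ennreal (joint x s y) \<partial>lborel)"
      using joint_tail_eq(1)[OF x y order_refl exit_nonneg[OF x]] joint_nonneg[OF x y]
      by (subst nn_integral_eq_integral) (auto simp: has_bochner_integral_iff)
  qed
  also have "\<dots> = (\<integral>\<^sup>+p. ennreal (joint x (fst p) (snd p)) \<partial>(lborel \<Otimes>\<^sub>M \<mu>))"
    using lborel_\<mu>.nn_integral_snd[OF m] by simp
  finally show ?thesis using nn_integral_joint_total[OF x] by simp
qed

text \<open>The lower bound on \<open>Qd\<close> comes out of the time integral, in which
  \<open>dens x\<close> has mass one. Together with total mass one this is Doeblin's condition for
  the embedded chain.\<close>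

lemma joint_tail_0_lower:
  assumes x: "x \<in> E" and y: "y \<in> E"
  shows "Qd_low \<le> joint_tail x y 0"
proof -
  have i: "has_bochner_integral lborel (dens x) 1" by (rule dens_total[OF x])
  have "(\<lambda>s. joint x s y * of_bool (0 \<le> min s (exit x))) = (\<lambda>s. joint x s y)"
    using exit_nonneg[OF x] by (auto simp: joint_def dens_def fun_eq_iff)
  with joint_tail_eq(1)[OF x y order_refl exit_nonneg[OF x]]
  have j: "has_bochner_integral lborel (\<lambda>s. joint x s y) (joint_tail x y 0)" by simp
  have le: "Qd_low * dens x s \<le> joint x s y" for s
    using mult_left_mono[OF Qd_low(2)[OF x _ y, of "max 0 (min s (exit x))"] dens_nonneg[OF x, of s]]
    by (simp add: joint_def mult.commute)
  have "(\<integral>s. Qd_low * dens x s \<partial>lborel) \<le> (\<integral>s. joint x s y \<partial>lborel)"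
    using i j le by (intro integral_mono) (auto simp: has_bochner_integral_iff)
  then show ?thesis using i j by (simp add: has_bochner_integral_iff)
qed

sublocale doeblin: minorized_kernel \<mu> "\<lambda>x y. joint_tail x y 0" Qd_low
proof
  show "(\<lambda>(x, y). joint_tail x y 0) \<in> borel_measurable (\<mu> \<Otimes>\<^sub>M \<mu>)" by measurable
qed (use Qd_low(1) joint_tail_0_lower joint_tail_0_total E_nonempty in auto)

end

section \<open>Expectations over one step of the chain\<close>

context regular_pdmp
begin

abbreviation \<Theta> :: "('a \<times> real \<times> 'a) measure" where
  "\<Theta> \<equiv> \<mu> \<Otimes>\<^sub>M (borel \<Otimes>\<^sub>M \<mu>)"

definition bounded_on_E :: "('a \<times> real \<times> 'a \<Rightarrow> real) \<Rightarrow> real \<Rightarrow> bool" where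
  "bounded_on_E h C \<longleftrightarrow> (\<forall>x\<in>E. \<forall>s. \<forall>y\<in>E. \<bar>h (x, s, y)\<bar> \<le> C)"

text \<open>The expectation of \<open>h (x, S\<^sub>1, Z\<^sub>1)\<close> for the chain started at
  \<open>x\<close>, written as a Bochner integral so that signed functions are covered.\<close>

definition step :: "('a \<times> real \<times> 'a \<Rightarrow> real) \<Rightarrow> 'a \<Rightarrow> real" where
  "step h x = (\<integral>p. joint x (fst p) (snd p) * h (x, min (fst p) (exit x), snd p) \<partial>(lborel \<Otimes>\<^sub>M \<mu>))"

lemma step_integrable:
  assumes x: "x \<in> E" and [measurable]: "h \<in> borel_measurable \<Theta>" and h: "bounded_on_E h C"
  shows "integrable (lborel \<Otimes>\<^sub>M \<mu>) (\<lambda>p. joint x (fst p) (snd p) * h (x, min (fst p) (exit x), snd p))"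
proof -
  have x'[measurable]: "x \<in> space \<mu>" using x by simp
  have i: "integrable (lborel \<Otimes>\<^sub>M \<mu>) (\<lambda>p. joint x (fst p) (snd p) * C)"
    using joint_has_integral[OF x] by (simp add: has_bochner_integral_iff)
  have "\<bar>joint x s y * h (x, min s (exit x), y)\<bar> \<le> \<bar>joint x s y * C\<bar>" if "y \<in> E" for s y
    using h x that joint_nonneg[OF x that, of s] order_trans[OF _ abs_ge_self, of _ C]
    by (auto simp: abs_mult bounded_on_E_def intro!: mult_left_mono)
  then show ?thesis
    using x' by (intro Bochner_Integration.integrable_bound[OF i]) (auto intro!: AE_I2 simp: space_pair_measure)
qed

lemma measurable_step[measurable]:
  assumes [measurable]: "h \<in> borel_measurable \<Theta>"
  shows "step h \<in> borel_measurable \<mu>"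
proof -
  interpret sigma_finite_measure "lborel \<Otimes>\<^sub>M \<mu> :: (real \<times> 'a) measure"
    by (rule lborel_\<mu>.sigma_finite_measure_axioms)
  show ?thesis unfolding step_def by measurable
qed

lemma step_const: "x \<in> E \<Longrightarrow> step (\<lambda>_. c) x = c"
  using joint_has_integral[of x] by (simp add: step_def has_bochner_integral_iff)

lemma step_source: "x \<in> E \<Longrightarrow> step (\<lambda>p. g (fst p)) x = g x"
  using step_const[of x "g x"] by (simp add: step_def)

lemma step_add:
  assumes "x \<in> E" "h \<in> borel_measurable \<Theta>" "bounded_on_E h C" "h' \<in> borel_measurable \<Theta>" "bounded_on_E h' C'"
  shows "step (\<lambda>p. h p + h' p) x = step h x + step h' x"
  unfolding step_def distrib_left
  by (intro Bochner_Integration.integral_add step_integrable[where C=C] step_integrable[where C=C'] assms)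

lemma step_diff:
  assumes "x \<in> E" "h \<in> borel_measurable \<Theta>" "bounded_on_E h C" "h' \<in> borel_measurable \<Theta>" "bounded_on_E h' C'"
  shows "step (\<lambda>p. h p - h' p) x = step h x - step h' x"
  unfolding step_def right_diff_distrib
  by (intro Bochner_Integration.integral_diff step_integrable[where C=C] step_integrable[where C=C'] assms)

lemma step_bound:
  assumes x: "x \<in> E" and h: "h \<in> borel_measurable \<Theta>" "bounded_on_E h C"
  shows "\<bar>step h x\<bar> \<le> C"
proof -
  have i: "integrable (lborel \<Otimes>\<^sub>M \<mu>) (\<lambda>p. joint x (fst p) (snd p) * C)"
    using joint_has_integral[OF x] by (simp add: has_bochner_integral_iff)
  have b: "\<bar>joint x s y * h (x, min s (exit x), y)\<bar> \<le> joint x s y * C" if "y \<in> E" for s y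
    using h(2) x that joint_nonneg[OF x that, of s]
    by (auto simp: abs_mult bounded_on_E_def intro!: mult_left_mono)
  have "\<bar>step h x\<bar> \<le> (\<integral>p. \<bar>joint x (fst p) (snd p) * h (x, min (fst p) (exit x), snd p)\<bar> \<partial>(lborel \<Otimes>\<^sub>M \<mu>))"
    unfolding step_def by (rule integral_abs_bound)
  also have "\<dots> \<le> (\<integral>p. joint x (fst p) (snd p) * C \<partial>(lborel \<Otimes>\<^sub>M \<mu>))"
    using b step_integrable[OF x h] by (intro integral_mono i) (auto simp: space_pair_measure)
  also have "\<dots> = C"
    using joint_has_integral[OF x] by (simp add: has_bochner_integral_iff)
  finally show ?thesis .
qed

lemma ennreal_step:
  assumes x: "x \<in> E" and [measurable]: "h \<in> borel_measurable \<Theta>" and h: "bounded_on_E h C"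
    and nn: "\<And>x s y. 0 \<le> h (x, s, y)"
  shows "ennreal (step h x) = (\<integral>\<^sup>+s. \<integral>\<^sup>+y. ennreal (h (x, s, y)) \<partial>jump_law (x, s) \<partial>jump_time_law x)"
proof -
  have x'[measurable]: "x \<in> space \<mu>" using x by simp
  have "(\<lambda>p. ennreal (h (x, p))) \<in> borel_measurable (borel \<Otimes>\<^sub>M \<mu>)"
    using x' by measurable
  from nn_integral_joint[OF x this]
  have "(\<integral>\<^sup>+s. \<integral>\<^sup>+y. ennreal (h (x, s, y)) \<partial>jump_law (x, s) \<partial>jump_time_law x)
    = (\<integral>\<^sup>+p. ennreal (joint x (fst p) (snd p) * h (x, min (fst p) (exit x), snd p)) \<partial>(lborel \<Otimes>\<^sub>M \<mu>))"
    by (simp add: ennreal_mult'' nn)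
  also have "\<dots> = ennreal (step h x)"
    unfolding step_def using joint_nonneg[OF x] nn
    by (intro nn_integral_eq_integral step_integrable[OF x assms(2) h]) (auto intro!: AE_I2 simp: space_pair_measure)
  finally show ?thesis by simp
qed

text \<open>Integrating out the time leaves the transition density. This carries the Poisson
  equation, which concerns locations, over to functions of triples.\<close>

lemma step_target:
  assumes x: "x \<in> E" and [measurable]: "g \<in> borel_measurable \<mu>" and g: "\<And>y. y \<in> E \<Longrightarrow> \<bar>g y\<bar> \<le> C"
  shows "step (\<lambda>p. g (snd (snd p))) x = (\<integral>y. joint_tail x y 0 * g y \<partial>\<mu>)"
proof -
  have i: "integrable (lborel \<Otimes>\<^sub>M \<mu>) (\<lambda>p. joint x (fst p) (snd p) * g (snd p))"
    using step_integrable[OF x, of "\<lambda>p. g (snd (snd p))" C] g by (simp add: bounded_on_E_def)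
  have "step (\<lambda>p. g (snd (snd p))) x = (\<integral>y. (\<integral>s. joint x s y * g y \<partial>lborel) \<partial>\<mu>)"
    using lborel_\<mu>.integral_snd[of "\<lambda>s y. joint x s y * g y"] i
    by (simp add: step_def case_prod_beta')
  also have "\<dots> = (\<integral>y. joint_tail x y 0 * g y \<partial>\<mu>)"
  proof (rule Bochner_Integration.integral_cong[OF refl])
    fix y
    have "(\<lambda>s. joint x s y * of_bool (0 \<le> min s (exit x))) = (\<lambda>s. joint x s y)"
      using exit_nonneg[OF x] by (auto simp: joint_def dens_def fun_eq_iff)
    then show "(\<integral>s. joint x s y * g y \<partial>lborel) = joint_tail x y 0 * g y"
      by (simp add: joint_tail_def)
  qed
  finally show ?thesis .
qed

end

section \<open>The past of the chain and its one-step conditional expectations\<close>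

context embedded_chain
begin

lemma Z_measurable_\<mu>: "x \<in> E \<Longrightarrow> Z n \<in> P x \<rightarrow>\<^sub>M \<mu>"
  using Z_measurable by (simp add: measurable_cong_sets[OF refl sets_\<mu>])

lemma Z_in_E: "x \<in> E \<Longrightarrow> \<omega> \<in> space (P x) \<Longrightarrow> Z n \<omega> \<in> E"
  using measurable_\<mu>_in[OF Z_measurable_\<mu>] by blast

lemma measurable_into_\<mu>:
  assumes "X \<in> M \<rightarrow>\<^sub>M borel" "\<And>\<omega>. \<omega> \<in> space M \<Longrightarrow> X \<omega> \<in> E"
  shows "X \<in> M \<rightarrow>\<^sub>M \<mu>"
  using measurable_restrict_space2[of X M E borel] assms by (simp add: measurable_cong_sets[OF refl sets_\<mu>])

lemma space_past[simp]: "space (past M Z S n) = space M" "space (past_next_time M Z S n) = space M"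
  by (simp_all add: past_def past_next_time_def)

lemma past_measurable:
  assumes x: "x \<in> E" and i: "i \<le> n"
  shows "Z i \<in> past (P x) Z S n \<rightarrow>\<^sub>M \<mu>" "S i \<in> borel_measurable (past (P x) Z S n)"
proof -
  have "(\<lambda>\<omega>. \<lambda>i\<in>{..n}. (Z i \<omega>, S i \<omega>)) \<in> past (P x) Z S n \<rightarrow>\<^sub>M (\<Pi>\<^sub>M i\<in>{..n}. borel \<Otimes>\<^sub>M borel)"
    unfolding past_def by (rule measurable_vimage_algebra1) (auto simp: space_PiM space_pair_measure)
  from measurable_compose[OF this measurable_component_singleton[of i]] i
  have m[measurable]: "(\<lambda>\<omega>. (Z i \<omega>, S i \<omega>)) \<in> past (P x) Z S n \<rightarrow>\<^sub>M borel \<Otimes>\<^sub>M borel"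
    by simp
  have "Z i \<in> past (P x) Z S n \<rightarrow>\<^sub>M borel"
    using measurable_compose[OF m measurable_fst] by simp
  then show "Z i \<in> past (P x) Z S n \<rightarrow>\<^sub>M \<mu>"
    using Z_in_E[OF x] by (intro measurable_into_\<mu>) auto
  show "S i \<in> borel_measurable (past (P x) Z S n)"
    using measurable_compose[OF m measurable_snd] by simp
qed

lemma past_next_time_measurable:
  assumes x: "x \<in> E"
  shows "i \<le> n \<Longrightarrow> Z i \<in> past_next_time (P x) Z S n \<rightarrow>\<^sub>M \<mu>"
    and "i \<le> Suc n \<Longrightarrow> S i \<in> borel_measurable (past_next_time (P x) Z S n)"
proof -
  let ?F = "past_next_time (P x) Z S n"
  have m: "(\<lambda>\<omega>. (\<lambda>i\<in>{..n}. (Z i \<omega>, S i \<omega>), S (Suc n) \<omega>))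
      \<in> ?F \<rightarrow>\<^sub>M (\<Pi>\<^sub>M i\<in>{..n}. borel \<Otimes>\<^sub>M borel) \<Otimes>\<^sub>M borel"
    unfolding past_next_time_def by (rule measurable_vimage_algebra1) (auto simp: space_PiM space_pair_measure)
  have m1: "(\<lambda>\<omega>. \<lambda>i\<in>{..n}. (Z i \<omega>, S i \<omega>)) \<in> ?F \<rightarrow>\<^sub>M (\<Pi>\<^sub>M i\<in>{..n}. borel \<Otimes>\<^sub>M borel)"
    using measurable_compose[OF m measurable_fst] by simp
  have m2: "(\<lambda>\<omega>. (Z i \<omega>, S i \<omega>)) \<in> ?F \<rightarrow>\<^sub>M borel \<Otimes>\<^sub>M borel" if "i \<le> n" for i
    using measurable_compose[OF m1 measurable_component_singleton[of i]] that by simp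
  show "Z i \<in> ?F \<rightarrow>\<^sub>M \<mu>" if "i \<le> n"
    using measurable_compose[OF m2[OF that] measurable_fst] Z_in_E[OF x]
    by (intro measurable_into_\<mu>) auto
  show "S i \<in> borel_measurable ?F" if "i \<le> Suc n"
  proof (cases "i = Suc n")
    case True
    then show ?thesis using measurable_compose[OF m measurable_snd] by simp
  next
    case False
    then show ?thesis using measurable_compose[OF m2 measurable_snd, of i] that by simp
  qed
qed

lemma subalgebra_past:
  assumes x: "x \<in> E"
  shows "subalgebra (P x) (past (P x) Z S n)" "subalgebra (P x) (past_next_time (P x) Z S n)"
    "sets (past (P x) Z S n) \<subseteq> sets (past_next_time (P x) Z S n)"
proof -
  have [measurable]: "Z i \<in> P x \<rightarrow>\<^sub>M borel" "S i \<in> borel_measurable (P x)" for i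
    using Z_measurable_\<mu>[OF x, THEN measurable_\<mu>_borel] S_measurable[OF x] by auto
  have m: "(\<lambda>\<omega>. \<lambda>i\<in>{..n}. (Z i \<omega>, S i \<omega>)) \<in> M \<rightarrow>\<^sub>M (\<Pi>\<^sub>M i\<in>{..n}. borel \<Otimes>\<^sub>M borel)"
    if "\<And>i. i \<le> n \<Longrightarrow> Z i \<in> M \<rightarrow>\<^sub>M borel" "\<And>i. i \<le> n \<Longrightarrow> S i \<in> borel_measurable M" for M
    using that by (intro measurable_restrict measurable_Pair) auto
  have "(\<lambda>\<omega>. \<lambda>i\<in>{..n}. (Z i \<omega>, S i \<omega>)) \<in> P x \<rightarrow>\<^sub>M (\<Pi>\<^sub>M i\<in>{..n}. borel \<Otimes>\<^sub>M borel)"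
    by (rule m) measurable
  then show "subalgebra (P x) (past (P x) Z S n)"
    unfolding past_def subalgebra_def by (simp add: measurable_iff_sets)
  have "(\<lambda>\<omega>. (\<lambda>i\<in>{..n}. (Z i \<omega>, S i \<omega>), S (Suc n) \<omega>))
      \<in> P x \<rightarrow>\<^sub>M (\<Pi>\<^sub>M i\<in>{..n}. borel \<Otimes>\<^sub>M borel) \<Otimes>\<^sub>M borel"
    using m[of "P x"] by (intro measurable_Pair) auto
  then show "subalgebra (P x) (past_next_time (P x) Z S n)"
    unfolding past_next_time_def subalgebra_def by (simp add: measurable_iff_sets)
  have "(\<lambda>\<omega>. \<lambda>i\<in>{..n}. (Z i \<omega>, S i \<omega>)) \<in> past_next_time (P x) Z S n \<rightarrow>\<^sub>M (\<Pi>\<^sub>M i\<in>{..n}. borel \<Otimes>\<^sub>M borel)"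
    using past_next_time_measurable[OF x] by (intro m) (auto intro: measurable_\<mu>_borel)
  then show "sets (past (P x) Z S n) \<subseteq> sets (past_next_time (P x) Z S n)"
    unfolding past_def by (simp add: measurable_iff_sets)
qed

text \<open>Two conditionings in succession: \<open>Z (Suc n)\<close> given the past and
  \<open>S (Suc n)\<close>, then \<open>S (Suc n)\<close> given the past. An event of the past
  belongs to both conditioning algebras.\<close>

lemma nn_integral_one_step:
  assumes x: "x \<in> E" and F: "F \<in> sets (past (P x) Z S n)" and [measurable]: "h \<in> borel_measurable \<Theta>"
  shows "(\<integral>\<^sup>+\<omega>\<in>F. h (Z n \<omega>, S (Suc n) \<omega>, Z (Suc n) \<omega>) \<partial>P x)
    = (\<integral>\<^sup>+\<omega>\<in>F. (\<integral>\<^sup>+s. \<integral>\<^sup>+y. h (Z n \<omega>, s, y) \<partial>jump_law (Z n \<omega>, s) \<partial>jump_time_law (Z n \<omega>)) \<partial>P x)"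
proof -
  interpret prob_space "P x" using P_prob[OF x] .
  have F': "F \<in> sets (past_next_time (P x) Z S n)"
    using F subalgebra_past(3)[OF x] by auto
  have 1: "(\<integral>\<^sup>+\<omega>\<in>F. (\<lambda>(p, y). h (fst p, snd p, y)) ((Z n \<omega>, S (Suc n) \<omega>), Z (Suc n) \<omega>) \<partial>P x)
    = (\<integral>\<^sup>+\<omega>\<in>F. (\<integral>\<^sup>+y. (\<lambda>(p, y). h (fst p, snd p, y)) ((Z n \<omega>, S (Suc n) \<omega>), y) \<partial>jump_law (Z n \<omega>, S (Suc n) \<omega>)) \<partial>P x)"
  proof (rule nn_integral_cond_law[where \<G>="sets \<mu>", OF subalgebra_past(2)[OF x] _ Z_measurable_\<mu>[OF x] measurable_jump_law])
    show "(\<lambda>\<omega>. (Z n \<omega>, S (Suc n) \<omega>)) \<in> past_next_time (P x) Z S n \<rightarrow>\<^sub>M \<mu> \<Otimes>\<^sub>M borel"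
      using past_next_time_measurable[OF x] by (intro measurable_Pair) auto
    show "sets \<mu> = sigma_sets (space \<mu>) (sets \<mu>)" by (simp only: sets.sigma_sets_eq)
    show "sets \<mu> \<subseteq> Pow (space \<mu>)" by (rule sets.space_closed)
    fix C assume C: "C \<in> sets \<mu>"
    show "AE \<omega> in P x. real_cond_exp (P x) (past_next_time (P x) Z S n)
        (indicator {\<omega> \<in> space (P x). Z (Suc n) \<omega> \<in> C}) \<omega> = measure (jump_law (Z n \<omega>, S (Suc n) \<omega>)) C"
      using Z_cond_law[OF x, of C n] C Z_in_E[OF x] S_nonneg[OF x]
      by (auto simp: sets_\<mu> jump_law_Q_flow elim!: AE_mp intro!: AE_I2)
  qed (use F' sets.top[of \<mu>] in \<open>auto simp: Int_stable_def\<close>)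
  \<comment> \<open>\<open>nn_integral_cond_law\<close> wants the whole space among the generators,
    hence the extra \<open>UNIV\<close>.\<close>
  let ?G = "insert UNIV (range greaterThan) :: real set set"
  have gen: "sets borel = sigma_sets (space borel) ?G"
  proof -
    have "sets borel = sigma_sets UNIV (range (greaterThan :: real \<Rightarrow> _))"
      by (subst borel_Ioi) (simp add: sets_measure_of)
    moreover have "sigma_sets UNIV (range (greaterThan :: real \<Rightarrow> _)) = sigma_sets UNIV ?G"
      by (rule sigma_sets_eqI) (auto intro: sigma_sets_top)
    ultimately show ?thesis by simp
  qed
  have stable: "Int_stable ?G"
  proof -
    have "{a<..} \<inter> {b<..} = {max a b<..}" for a b :: real by auto
    then show ?thesis by (auto simp: Int_stable_def)
  qed
  interpret S: finite_measure_subalgebra "P x" "past (P x) Z S n"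
    using subalgebra_past(1)[OF x] by unfold_locales
  \<comment> \<open>For \<open>UNIV\<close> and for half-lines with negative endpoint the event is
    the whole space, a case that \<open>S_cond_law\<close> does not cover.\<close>
  have one: "AE \<omega> in P x. real_cond_exp (P x) (past (P x) Z S n) (indicator (space (P x))) \<omega> = 1"
  proof -
    have "AE \<omega> in P x. real_cond_exp (P x) (past (P x) Z S n) (indicator (space (P x))) \<omega> = indicator (space (P x)) \<omega>"
      using sets.top[of "past (P x) Z S n"] by (intro S.real_cond_exp_F_meas) (auto simp: emeasure_eq_measure)
    then show ?thesis by (auto elim!: AE_mp intro!: AE_I2)
  qed
  let ?h = "\<lambda>(z, s). \<integral>\<^sup>+y. h (z, s, y) \<partial>jump_law (z, s)"
  have hm: "(\<lambda>p. \<integral>\<^sup>+y. (\<lambda>(p, y). h (fst p, snd p, y)) (p, y) \<partial>jump_law p) \<in> borel_measurable (\<mu> \<Otimes>\<^sub>M borel)"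
    by (rule nn_integral_measurable_subprob_algebra2[OF _ measurable_prob_algebraD[OF measurable_jump_law]]) simp
  then have hm': "?h \<in> borel_measurable (\<mu> \<Otimes>\<^sub>M borel)"
    by (simp add: case_prod_beta')
  have 2: "(\<integral>\<^sup>+\<omega>\<in>F. ?h (Z n \<omega>, S (Suc n) \<omega>) \<partial>P x)
      = (\<integral>\<^sup>+\<omega>\<in>F. (\<integral>\<^sup>+s. ?h (Z n \<omega>, s) \<partial>jump_time_law (Z n \<omega>)) \<partial>P x)"
  proof (rule nn_integral_cond_law[where \<G>="?G", OF subalgebra_past(1)[OF x] past_measurable(1)[OF x order_refl]
        S_measurable[OF x] measurable_jump_time_law gen _ stable _ _ F hm'])
    fix C assume "C \<in> ?G"
    then consider "C = UNIV" | t where "C = {t<..}" "0 \<le> t" | t where "C = {t<..}" "t < 0"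
      by (auto simp: image_iff) (metis linorder_not_le)
    then show "AE \<omega> in P x. real_cond_exp (P x) (past (P x) Z S n)
        (indicator {\<omega> \<in> space (P x). S (Suc n) \<omega> \<in> C}) \<omega> = measure (jump_time_law (Z n \<omega>)) C"
    proof cases
      case 1
      have "measure (jump_time_law (Z n \<omega>)) UNIV = 1" if "\<omega> \<in> space (P x)" for \<omega>
        using prob_space.prob_space[OF prob_jump_time_law[OF Z_in_E[OF x that, of n]]]
        by (simp add: jump_time_law_def)
      then show ?thesis using one 1 by (auto elim!: AE_mp intro!: AE_I2)
    next
      case 2
      show ?thesis
        using S_cond_law[OF x \<open>0 \<le> t\<close>, of n]
      proof (rule AE_mp, intro AE_I2 impI)
        fix \<omega> assume w: "\<omega> \<in> space (P x)" and e: "real_cond_exp (P x) (past (P x) Z S n)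
          (indicator {\<omega> \<in> space (P x). t < S (Suc n) \<omega>}) \<omega> = (if ereal t < exit_time (Z n \<omega>) then G (Z n \<omega>) t else 0)"
        show "real_cond_exp (P x) (past (P x) Z S n)
          (indicator {\<omega> \<in> space (P x). S (Suc n) \<omega> \<in> C}) \<omega> = measure (jump_time_law (Z n \<omega>)) C"
          using e jump_time_law_tail[OF Z_in_E[OF x w, of n] \<open>0 \<le> t\<close>] exit_time_eq[OF Z_in_E[OF x w, of n]]
          by (simp add: 2)
      qed
    next
      case 3
      have "{\<omega> \<in> space (P x). S (Suc n) \<omega> \<in> C} = space (P x)"
        using S_nonneg[OF x, of _ "Suc n"] 3 by (auto intro: less_le_trans)
      then show ?thesis
        using one jump_time_law_tail_neg[OF Z_in_E[OF x] 3(2)] 3 by (auto elim!: AE_mp intro!: AE_I2)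
    qed
  qed auto
  show ?thesis using 1 2 by simp
qed

text \<open>Equality of these integrals over all events of the past is the defining property of a
  conditional expectation; it is reduced to the nonnegative case.\<close>

lemma integral_one_step:
  assumes x: "x \<in> E" and F: "F \<in> sets (past (P x) Z S n)"
    and h[measurable]: "h \<in> borel_measurable \<Theta>" and bnd: "bounded_on_E h C"
  shows "(\<integral>\<omega>\<in>F. h (Z n \<omega>, S (Suc n) \<omega>, Z (Suc n) \<omega>) \<partial>P x) = (\<integral>\<omega>\<in>F. step h (Z n \<omega>) \<partial>P x)"
proof -
  interpret prob_space "P x" using P_prob[OF x] .
  note [measurable] = Z_measurable_\<mu>[OF x] S_measurable[OF x]
  have F'[measurable]: "F \<in> sets (P x)"
    using F subalgebra_past(1)[OF x] by (auto simp: subalgebra_def)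
  have C: "0 \<le> C" using bnd E_nonempty by (fastforce simp: bounded_on_E_def)
  \<comment> \<open>Shifting by a constant makes the integrand nonnegative; truncation by \<open>max 0\<close> then has no effect
    on \<open>E\<close> but gives nonnegativity everywhere.\<close>
  define h' where "h' p = max 0 (min (2 * C) (h p + C))" for p
  have h'm[measurable]: "h' \<in> borel_measurable \<Theta>" unfolding h'_def by measurable
  have h'_eq: "h' (z, s, y) = h (z, s, y) + C" if "z \<in> E" "y \<in> E" for z s y
    using bnd that unfolding h'_def bounded_on_E_def by (smt (verit, best))
  have h'_bnd: "bounded_on_E h' (2 * C)"
    using C by (auto simp: bounded_on_E_def h'_def)
  have h'_nn: "0 \<le> h' p" for p by (simp add: h'_def)
  have h'_le: "\<bar>h' p\<bar> \<le> 2 * C" for p using C by (simp add: h'_def)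
  have step': "step h' z = step h z + C" if "z \<in> E" for z
  proof -
    have "step h' z = step (\<lambda>p. h p + C) z"
      unfolding step_def using that by (intro Bochner_Integration.integral_cong) (auto simp: space_pair_measure h'_eq)
    also have "\<dots> = step h z + C"
      using step_add[OF that h bnd, of "\<lambda>_. C" C] step_const[OF that, of C] C by (simp add: bounded_on_E_def)
    finally show ?thesis .
  qed
  let ?X = "\<lambda>\<omega>. (Z n \<omega>, S (Suc n) \<omega>, Z (Suc n) \<omega>)"
  have step_nn: "0 \<le> step h' z" if "z \<in> E" for z
    unfolding step_def using joint_nonneg[OF that] h'_nn
    by (intro Bochner_Integration.integral_nonneg) (auto simp: space_pair_measure)
  have bX: "\<bar>h (?X \<omega>)\<bar> \<le> C" if "\<omega> \<in> space (P x)" for \<omega>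
    using bnd Z_in_E[OF x that] by (auto simp: bounded_on_E_def)
  have bH: "\<bar>step h (Z n \<omega>)\<bar> \<le> C" if "\<omega> \<in> space (P x)" for \<omega>
    using step_bound[OF Z_in_E[OF x that] h bnd] .
  have i: "integrable (P x) (\<lambda>\<omega>. indicator F \<omega> * h (?X \<omega>))"
    "integrable (P x) (\<lambda>\<omega>. indicator F \<omega> * step h (Z n \<omega>))"
    "integrable (P x) (indicator F :: _ \<Rightarrow> real)"
    using bX bH C
    by (auto intro!: integrable_const_bound[where B=C] AE_I2 simp: indicator_def emeasure_eq_measure)
  have i': "integrable (P x) (\<lambda>\<omega>. indicator F \<omega> * h' (?X \<omega>))"
    "integrable (P x) (\<lambda>\<omega>. indicator F \<omega> * step h' (Z n \<omega>))"
    using h'_le step_bound[OF Z_in_E[OF x] h'm h'_bnd] C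
    by (auto intro!: integrable_const_bound[where B="2 * C"] AE_I2 simp: indicator_def)
  have "ennreal (\<integral>\<omega>. indicator F \<omega> * h' (?X \<omega>) \<partial>P x) = (\<integral>\<^sup>+\<omega>. ennreal (indicator F \<omega> * h' (?X \<omega>)) \<partial>P x)"
    using h'_nn by (intro nn_integral_eq_integral[symmetric] i') auto
  also have "\<dots> = (\<integral>\<^sup>+\<omega>\<in>F. ennreal (h' (?X \<omega>)) \<partial>P x)"
    by (intro nn_integral_cong) (auto simp: indicator_def)
  also have "\<dots> = (\<integral>\<^sup>+\<omega>\<in>F. (\<integral>\<^sup>+s. \<integral>\<^sup>+y. ennreal (h' (Z n \<omega>, s, y)) \<partial>jump_law (Z n \<omega>, s) \<partial>jump_time_law (Z n \<omega>)) \<partial>P x)"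
    by (rule nn_integral_one_step[OF x F]) measurable
  also have "\<dots> = (\<integral>\<^sup>+\<omega>. ennreal (indicator F \<omega> * step h' (Z n \<omega>)) \<partial>P x)"
    using ennreal_step[OF Z_in_E[OF x] h'm h'_bnd h'_nn]
    by (intro nn_integral_cong) (auto simp: indicator_def)
  also have "\<dots> = ennreal (\<integral>\<omega>. indicator F \<omega> * step h' (Z n \<omega>) \<partial>P x)"
    using step_nn[OF Z_in_E[OF x]] by (intro nn_integral_eq_integral i') (auto intro!: AE_I2)
  finally have e: "(\<integral>\<omega>. indicator F \<omega> * h' (?X \<omega>) \<partial>P x) = (\<integral>\<omega>. indicator F \<omega> * step h' (Z n \<omega>) \<partial>P x)"
    using h'_nn step_nn[OF Z_in_E[OF x]]
    by (subst (asm) ennreal_inj) (auto intro!: Bochner_Integration.integral_nonneg)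
  have "(\<integral>\<omega>. indicator F \<omega> * h' (?X \<omega>) \<partial>P x) = (\<integral>\<omega>. indicator F \<omega> * h (?X \<omega>) + C * indicator F \<omega> \<partial>P x)"
    using Z_in_E[OF x] by (intro Bochner_Integration.integral_cong) (auto simp: h'_eq algebra_simps)
  moreover have "(\<integral>\<omega>. indicator F \<omega> * step h' (Z n \<omega>) \<partial>P x) = (\<integral>\<omega>. indicator F \<omega> * step h (Z n \<omega>) + C * indicator F \<omega> \<partial>P x)"
    using Z_in_E[OF x] by (intro Bochner_Integration.integral_cong) (auto simp: step' algebra_simps)
  ultimately show ?thesis
    using e i by (simp add: set_lebesgue_integral_def)
qed

lemma cond_exp_one_step:
  assumes x: "x \<in> E" and h[measurable]: "h \<in> borel_measurable \<Theta>" and bnd: "bounded_on_E h C"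
  shows "AE \<omega> in P x. real_cond_exp (P x) (past (P x) Z S n) (\<lambda>\<omega>. h (Z n \<omega>, S (Suc n) \<omega>, Z (Suc n) \<omega>)) \<omega>
    = step h (Z n \<omega>)"
proof -
  interpret prob_space "P x" using P_prob[OF x] .
  interpret S: finite_measure_subalgebra "P x" "past (P x) Z S n"
    using subalgebra_past(1)[OF x] by unfold_locales
  note [measurable] = Z_measurable_\<mu>[OF x] S_measurable[OF x]
  show ?thesis
  proof (rule S.real_cond_exp_charact)
    show "(\<lambda>\<omega>. step h (Z n \<omega>)) \<in> borel_measurable (past (P x) Z S n)"
      using past_measurable(1)[OF x order_refl] by measurable
    show "integrable (P x) (\<lambda>\<omega>. h (Z n \<omega>, S (Suc n) \<omega>, Z (Suc n) \<omega>))"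
      using bnd Z_in_E[OF x] by (intro integrable_const_bound[where B=C]) (auto simp: bounded_on_E_def)
    show "integrable (P x) (\<lambda>\<omega>. step h (Z n \<omega>))"
      using step_bound[OF Z_in_E[OF x] h bnd] by (intro integrable_const_bound[where B=C]) auto
  qed (rule integral_one_step[OF x _ h bnd])
qed

end

section \<open>Invariant law and weak law of large numbers\<close>

context embedded_chain
begin

lemma sets_R: "sets (R x) = sets \<mu>"
  by (simp add: R_def sets_\<mu>)

text \<open>One step from index 0 over the whole probability space. The start is \<open>x\<close>
  only almost surely, which is enough under the integral.\<close>

lemma R_density:
  assumes x: "x \<in> E"
  shows "R x = density \<mu> (\<lambda>y. ennreal (joint_tail x y 0))"
proof (rule measure_eqI)
  show "sets (R x) = sets (density \<mu> (\<lambda>y. ennreal (joint_tail x y 0)))"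
    by (simp add: sets_R)
  fix B assume "B \<in> sets (R x)"
  then have B[measurable]: "B \<in> sets \<mu>" by (simp add: sets_R)
  interpret prob_space "P x" using P_prob[OF x] .
  note [measurable] = Z_measurable_\<mu>[OF x] S_measurable[OF x]
  have x': "x \<in> space \<mu>" using x by simp
  define h :: "'a \<times> real \<times> 'a \<Rightarrow> real" where "h p = indicator B (snd (snd p))" for p
  have h: "h \<in> borel_measurable \<Theta>" "bounded_on_E h 1"
    unfolding h_def by (auto simp: bounded_on_E_def indicator_def)
  have st: "step h z = (\<integral>y. joint_tail z y 0 * indicator B y \<partial>\<mu>)" if "z \<in> E" for z
    unfolding h_def by (rule step_target[OF that, of _ 1]) auto
  have "measure (P x) (Z 1 -` B \<inter> space (P x)) = (\<integral>\<omega>. indicator B (Z 1 \<omega>) \<partial>P x)"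
  proof -
    have "(\<integral>\<omega>. indicator B (Z 1 \<omega>) \<partial>P x) = (\<integral>\<omega>. indicator (Z 1 -` B \<inter> space (P x)) \<omega> \<partial>P x :: real)"
      by (intro Bochner_Integration.integral_cong) (auto simp: indicator_def)
    then show ?thesis by simp
  qed
  also have "\<dots> = (\<integral>\<omega>\<in>space (P x). h (Z 0 \<omega>, S (Suc 0) \<omega>, Z (Suc 0) \<omega>) \<partial>P x)"
    unfolding set_lebesgue_integral_def h_def by (intro Bochner_Integration.integral_cong) auto
  also have "\<dots> = (\<integral>\<omega>\<in>space (P x). step h (Z 0 \<omega>) \<partial>P x)"
    using integral_one_step[OF x _ h, of "space (P x)" 0] sets.top[of "past (P x) Z S 0"] by simp
  also have "\<dots> = (\<integral>\<omega>. step h x \<partial>P x)"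
    unfolding set_lebesgue_integral_def
  proof (rule integral_cong_AE)
    show "AE \<omega> in P x. indicator (space (P x)) \<omega> *\<^sub>R step h (Z 0 \<omega>) = step h x"
      using Z_initial[OF x] AE_space by eventually_elim simp
  qed (use h in measurable)
  also have "\<dots> = (\<integral>y. joint_tail x y 0 * indicator B y \<partial>\<mu>)"
    by (simp add: prob_space st[OF x])
  finally have m: "measure (P x) (Z 1 -` B \<inter> space (P x)) = (\<integral>y. joint_tail x y 0 * indicator B y \<partial>\<mu>)" .
  have "emeasure (R x) B = ennreal (measure (P x) (Z 1 -` B \<inter> space (P x)))"
    unfolding R_def using B Z_measurable[OF x]
    by (subst emeasure_distr) (auto simp: emeasure_eq_measure sets_\<mu>)
  also have "\<dots> = (\<integral>\<^sup>+y. ennreal (joint_tail x y 0 * indicator B y) \<partial>\<mu>)"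
    unfolding m using doeblin.kernel_nonneg[of x] doeblin.kernel_integrable[of x] x
    by (intro nn_integral_eq_integral[symmetric] integrable_real_mult_indicator) auto
  also have "\<dots> = emeasure (density \<mu> (\<lambda>y. ennreal (joint_tail x y 0))) B"
    using x' by (subst emeasure_density) (auto intro!: nn_integral_cong simp: indicator_def)
  finally show "emeasure (R x) B = emeasure (density \<mu> (\<lambda>y. ennreal (joint_tail x y 0))) B" .
qed

lemma invariant_prob_iff: "invariant_prob \<eta> \<longleftrightarrow> doeblin.invariant_law \<eta>"
proof (cases "sets \<eta> = sets \<mu>")
  case True
  then have sp: "space \<eta> = E" using sets_eq_imp_space_eq[OF True] by simp
  have "emeasure (R z) B = (\<integral>\<^sup>+y\<in>B. ennreal (joint_tail z y 0) \<partial>\<mu>)" if "z \<in> E" "B \<in> sets \<mu>" for z B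
  proof -
    have "z \<in> space \<mu>" using that by simp
    then show ?thesis
      using that by (simp add: R_density emeasure_density)
  qed
  then have "(\<integral>\<^sup>+ z. emeasure (R z) B \<partial>\<eta>) = (\<integral>\<^sup>+z. (\<integral>\<^sup>+y\<in>B. ennreal (joint_tail z y 0) \<partial>\<mu>) \<partial>\<eta>)"
    if "B \<in> sets \<mu>" for B
    using that by (intro nn_integral_cong) (auto simp: sp)
  then show ?thesis
    using True unfolding invariant_prob_def doeblin.invariant_law_def by (auto simp: sets_\<mu>)
next
  case False
  then show ?thesis
    unfolding invariant_prob_def doeblin.invariant_law_def by (auto simp: sets_\<mu>)
qed

lemma \<nu>_eq: "\<nu> = density \<mu> doeblin.invariant_density"
  unfolding \<nu>_def invariant_prob_iff
  using doeblin.invariant_law_density doeblin.invariant_law_unique by (intro the_equality)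

lemma \<nu>_invariant: "doeblin.invariant_law \<nu>"
  unfolding \<nu>_eq by (rule doeblin.invariant_law_density)

lemma sets_\<nu>[measurable_cong, simp]: "sets \<nu> = sets \<mu>" and space_\<nu>[simp]: "space \<nu> = E"
  by (simp_all add: \<nu>_eq)

sublocale \<nu>: prob_space \<nu>
  using \<nu>_invariant by (simp add: doeblin.invariant_law_def)

text \<open>The stationary law dominates \<open>Qd_low\<close> times \<open>\<mu>\<close>, and
  \<open>\<mu>\<close> charges sets with interior.\<close>

lemma \<nu>_pos:
  assumes A: "A \<in> sets \<mu>" and "interior A \<noteq> {}"
  shows "0 < emeasure \<nu> A"
proof -
  have "0 < ennreal Qd_low * emeasure \<mu> A"
    using \<mu>_pos[OF assms] Qd_low(1) by (simp add: ennreal_zero_less_mult_iff)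
  also have "\<dots> = (\<integral>\<^sup>+y. ennreal Qd_low * indicator A y \<partial>\<mu>)"
    using A by (simp add: nn_integral_cmult_indicator)
  also have "\<dots> \<le> (\<integral>\<^sup>+y. doeblin.invariant_density y * indicator A y \<partial>\<mu>)"
    by (intro nn_integral_mono mult_right_mono doeblin.invariant_density_lower) auto
  also have "\<dots> = emeasure \<nu> A"
    unfolding \<nu>_eq using A by (simp add: emeasure_density)
  finally show ?thesis .
qed

text \<open>Increments centred given the past are orthogonal, so the second moment grows like
  \<open>n\<close> and not like its square.\<close>

lemma second_moment_past_differences:
  assumes x: "x \<in> E"
    and D[measurable]: "\<And>i. D i \<in> borel_measurable (past (P x) Z S (Suc i))"
    and bnd: "\<And>i \<omega>. \<omega> \<in> space (P x) \<Longrightarrow> \<bar>D i \<omega>\<bar> \<le> C"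
    and centered: "\<And>i. AE \<omega> in P x. real_cond_exp (P x) (past (P x) Z S i) (D i) \<omega> = 0"
  shows "integrable (P x) (\<lambda>\<omega>. (\<Sum>i<n. D i \<omega>)\<^sup>2)" "(\<integral>\<omega>. (\<Sum>i<n. D i \<omega>)\<^sup>2 \<partial>P x) \<le> real n * C\<^sup>2"
proof -
  interpret prob_space "P x" using P_prob[OF x] .
  have past_mono: "subalgebra (past (P x) Z S j) (past (P x) Z S i)" if "i \<le> j" for i j
  proof -
    have "(\<lambda>\<omega>. \<lambda>i\<in>{..i}. (Z i \<omega>, S i \<omega>)) \<in> past (P x) Z S j \<rightarrow>\<^sub>M (\<Pi>\<^sub>M i\<in>{..i}. borel \<Otimes>\<^sub>M borel)"
      using that past_measurable[OF x]
      by (intro measurable_restrict measurable_Pair) (auto intro: measurable_\<mu>_borel)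
    then show ?thesis
      unfolding subalgebra_def by (subst (2) past_def) (simp add: measurable_iff_sets)
  qed
  have DM[measurable]: "D i \<in> borel_measurable (P x)" for i
    by (rule measurable_from_subalg[OF subalgebra_past(1)[OF x] D])
  have C: "0 \<le> C" using bnd not_empty by fastforce
  have sum_bnd: "\<bar>\<Sum>i<n. D i \<omega>\<bar> \<le> real n * C" if "\<omega> \<in> space (P x)" for n \<omega>
    using sum_bounded_above[of "{..<n}" "\<lambda>i. \<bar>D i \<omega>\<bar>" C] bnd[OF that]
    by (intro order_trans[OF sum_abs]) simp
  have int_sq: "integrable (P x) (\<lambda>\<omega>. (\<Sum>i<n. D i \<omega>)\<^sup>2)" for n
    using sum_bnd power_mono[OF sum_bnd abs_ge_zero, of _ n 2]
    by (intro integrable_const_bound[where B="(real n * C)\<^sup>2"]) (auto simp: power2_abs)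
  have int_D: "integrable (P x) (\<lambda>\<omega>. (D i \<omega>)\<^sup>2)" for i
    using power_mono[OF bnd abs_ge_zero, of _ _ 2]
    by (intro integrable_const_bound[where B="C\<^sup>2"]) (auto simp: power2_abs)
  have int_cross: "integrable (P x) (\<lambda>\<omega>. (\<Sum>i<n. D i \<omega>) * D n \<omega>)" for n
    using mult_mono[OF sum_bnd bnd, of _ _ n n] C
    by (intro integrable_const_bound[where B="(real n * C) * C"]) (auto simp: abs_mult)
  have cross: "(\<integral>\<omega>. (\<Sum>i<n. D i \<omega>) * D n \<omega> \<partial>P x) = 0" for n
  proof -
    interpret S: finite_measure_subalgebra "P x" "past (P x) Z S n"
      using subalgebra_past(1)[OF x] by unfold_locales
    have "(\<lambda>\<omega>. \<Sum>i<n. D i \<omega>) \<in> borel_measurable (past (P x) Z S n)"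
      by (intro borel_measurable_sum measurable_from_subalg[OF past_mono D]) auto
    from S.real_cond_exp_intg(2)[OF int_cross this DM]
    have "(\<integral>\<omega>. (\<Sum>i<n. D i \<omega>) * D n \<omega> \<partial>P x)
        = (\<integral>\<omega>. (\<Sum>i<n. D i \<omega>) * real_cond_exp (P x) (past (P x) Z S n) (D n) \<omega> \<partial>P x)" by simp
    also have "\<dots> = (\<integral>\<omega>. 0 \<partial>P x)"
    proof (rule integral_cong_AE)
      show "AE \<omega> in P x. (\<Sum>i<n. D i \<omega>) * real_cond_exp (P x) (past (P x) Z S n) (D n) \<omega> = 0"
        using centered[of n] by eventually_elim simp
    qed measurable
    finally show ?thesis by simp
  qed
  show "integrable (P x) (\<lambda>\<omega>. (\<Sum>i<n. D i \<omega>)\<^sup>2)" by (rule int_sq)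
  show "(\<integral>\<omega>. (\<Sum>i<n. D i \<omega>)\<^sup>2 \<partial>P x) \<le> real n * C\<^sup>2"
  proof (induction n)
    case (Suc n)
    have "(\<integral>\<omega>. (\<Sum>i<Suc n. D i \<omega>)\<^sup>2 \<partial>P x)
        = (\<integral>\<omega>. (\<Sum>i<n. D i \<omega>)\<^sup>2 + 2 * ((\<Sum>i<n. D i \<omega>) * D n \<omega>) + (D n \<omega>)\<^sup>2 \<partial>P x)"
      by (intro Bochner_Integration.integral_cong) (auto simp: power2_eq_square algebra_simps)
    also have "\<dots> = (\<integral>\<omega>. (\<Sum>i<n. D i \<omega>)\<^sup>2 \<partial>P x) + (\<integral>\<omega>. (D n \<omega>)\<^sup>2 \<partial>P x)"
      using int_sq int_D int_cross cross[of n] by simp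
    also have "(\<integral>\<omega>. (D n \<omega>)\<^sup>2 \<partial>P x) \<le> C\<^sup>2"
      using power_mono[OF bnd abs_ge_zero, of _ n 2]
      by (intro integral_le_const int_D) (auto simp: power2_abs)
    finally show ?case using Suc by (simp add: algebra_simps)
  qed simp
qed

lemma weak_law:
  assumes x: "x \<in> E" and h[measurable]: "h \<in> borel_measurable \<Theta>" and bnd: "bounded_on_E h C" and \<epsilon>: "0 < \<epsilon>"
  shows "(\<lambda>n. measure (P x) {\<omega> \<in> space (P x).
      \<epsilon> < \<bar>(\<Sum>i<n. h (Z i \<omega>, S (Suc i) \<omega>, Z (Suc i) \<omega>)) / real n - (\<integral>z. step h z \<partial>\<nu>)\<bar>}) \<longlonglongrightarrow> 0"
proof -
  interpret prob_space "P x" using P_prob[OF x] .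
  note [measurable] = Z_measurable_\<mu>[OF x] S_measurable[OF x]
  have sb: "\<And>z. z \<in> space \<mu> \<Longrightarrow> \<bar>step h z\<bar> \<le> C" using step_bound[OF _ h bnd] by simp
  obtain g D c where g[measurable]: "g \<in> borel_measurable \<mu>" and gD: "\<forall>z\<in>space \<mu>. \<bar>g z\<bar> \<le> D"
    and poisson: "\<forall>z\<in>space \<mu>. step h z - c = g z - (\<integral>y. joint_tail z y 0 * g y \<partial>\<mu>)"
    using doeblin.poisson_equation[OF measurable_step[OF h] sb] by meson
  have c: "c = (\<integral>z. step h z \<partial>\<nu>)"
    using gD poisson by (intro doeblin.poisson_constant[OF \<nu>_invariant measurable_step[OF h] g sb, where D=D]) auto
  have D: "0 \<le> D" using gD E_nonempty by fastforce
  \<comment> \<open>Given the past, \<open>h\<close> has mean \<open>step h (Z i)\<close> and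
    \<open>g (Z (Suc i))\<close> has mean the kernel average of \<open>g\<close>; by the Poisson
    equation the corrected function has conditional mean 0.\<close>
  define k where "k p = h p + g (snd (snd p)) - (g (fst p) + c)" for p
  have km[measurable]: "k \<in> borel_measurable \<Theta>" unfolding k_def by measurable
  have gE: "\<bar>g z\<bar> \<le> D" if "z \<in> E" for z using gD that by simp
  have hE: "\<bar>h (z, s, y)\<bar> \<le> C" if "z \<in> E" "y \<in> E" for z s y
    using bnd that by (simp add: bounded_on_E_def)
  have gb: "bounded_on_E (\<lambda>p. g (snd (snd p))) D"
    using gE by (simp add: bounded_on_E_def)
  have gb': "bounded_on_E (\<lambda>p. g (fst p) + c) (D + \<bar>c\<bar>)"
    unfolding bounded_on_E_def fst_conv
  proof (intro ballI allI)
    fix z assume "z \<in> E"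
    then show "\<bar>g z + c\<bar> \<le> D + \<bar>c\<bar>" using gE[of z] by linarith
  qed
  have hgb: "bounded_on_E (\<lambda>p. h p + g (snd (snd p))) (C + D)"
    unfolding bounded_on_E_def snd_conv
  proof (intro ballI allI)
    fix z s y assume "z \<in> E" "y \<in> E"
    then show "\<bar>h (z, s, y) + g y\<bar> \<le> C + D" using hE[of z y s] gE[of y] by linarith
  qed
  have kb: "bounded_on_E k (C + D + (D + \<bar>c\<bar>))"
    unfolding bounded_on_E_def k_def fst_conv snd_conv
  proof (intro ballI allI)
    fix z s y assume "z \<in> E" "y \<in> E"
    then show "\<bar>h (z, s, y) + g y - (g z + c)\<bar> \<le> C + D + (D + \<bar>c\<bar>)"
      using hE[of z y s] gE[of y] gE[of z] by linarith
  qed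
  have k0: "step k z = 0" if z: "z \<in> E" for z
  proof -
    have "step k z = step (\<lambda>p. h p + g (snd (snd p))) z - step (\<lambda>p. g (fst p) + c) z"
      unfolding k_def by (rule step_diff[OF z _ hgb _ gb']) measurable
    also have "step (\<lambda>p. h p + g (snd (snd p))) z = step h z + step (\<lambda>p. g (snd (snd p))) z"
      by (rule step_add[OF z h bnd _ gb]) measurable
    also have "step (\<lambda>p. g (snd (snd p))) z = (\<integral>y. joint_tail z y 0 * g y \<partial>\<mu>)"
      using gD by (intro step_target[OF z g, of D]) auto
    also have "step (\<lambda>p. g (fst p) + c) z = g z + c"
      using step_source[OF z, of "\<lambda>z. g z + c"] .
    finally show ?thesis using bspec[OF poisson, of z] z by simp
  qed
  define \<Delta> where "\<Delta> i \<omega> = k (Z i \<omega>, S (Suc i) \<omega>, Z (Suc i) \<omega>)" for i \<omega>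
  define B where "B = C + D + (D + \<bar>c\<bar>)"
  have \<Delta>m: "\<Delta> i \<in> borel_measurable (past (P x) Z S (Suc i))" for i
    unfolding \<Delta>_def using past_measurable[OF x, of i "Suc i"] past_measurable[OF x, of "Suc i" "Suc i"] by measurable
  have \<Delta>b: "\<bar>\<Delta> i \<omega>\<bar> \<le> B" if "\<omega> \<in> space (P x)" for i \<omega>
    using kb Z_in_E[OF x that] by (simp add: \<Delta>_def B_def bounded_on_E_def)
  have \<Delta>c: "AE \<omega> in P x. real_cond_exp (P x) (past (P x) Z S i) (\<Delta> i) \<omega> = 0" for i
    unfolding \<Delta>_def using cond_exp_one_step[OF x km kb, of i] k0[OF Z_in_E[OF x]]
    by (auto elim!: AE_mp intro!: AE_I2)
  note moment = second_moment_past_differences[OF x \<Delta>m \<Delta>b \<Delta>c]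
  let ?W = "\<lambda>n \<omega>. \<Sum>i<n. \<Delta> i \<omega>"
  let ?A = "\<lambda>n \<omega>. (\<Sum>i<n. h (Z i \<omega>, S (Suc i) \<omega>, Z (Suc i) \<omega>)) / real n - c"
  have [measurable]: "\<Delta> i \<in> borel_measurable (P x)" for i
    by (rule measurable_from_subalg[OF subalgebra_past(1)[OF x] \<Delta>m])
  \<comment> \<open>The terms in \<open>g\<close> telescope, so the martingale differs from the
    centred sum by at most \<open>2 * D\<close>.\<close>
  have W: "?W n \<omega> = (\<Sum>i<n. h (Z i \<omega>, S (Suc i) \<omega>, Z (Suc i) \<omega>)) - real n * c + (g (Z n \<omega>) - g (Z 0 \<omega>))" for n \<omega>
    by (induction n) (auto simp: \<Delta>_def k_def algebra_simps)
  \<comment> \<open>A deviation of the average beyond \<open>\<epsilon>\<close> leaves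
    \<open>\<epsilon> * real n / 2\<close> for Chebyshev's inequality, once the telescoped error
    \<open>2 * D\<close> fits into the other half.\<close>
  have le: "measure (P x) {\<omega> \<in> space (P x). \<epsilon> < \<bar>?A n \<omega>\<bar>} \<le> 4 * B\<^sup>2 / (\<epsilon>\<^sup>2 * real n)"
    if n: "0 < n" "4 * D \<le> \<epsilon> * real n" for n
  proof -
    have sub: "{\<omega> \<in> space (P x). \<epsilon> < \<bar>?A n \<omega>\<bar>} \<subseteq> {\<omega> \<in> space (P x). (\<epsilon> * real n / 2)\<^sup>2 \<le> (?W n \<omega>)\<^sup>2}"
    proof safe
      fix \<omega> assume w: "\<omega> \<in> space (P x)" and A: "\<epsilon> < \<bar>?A n \<omega>\<bar>"
      have "\<bar>g (Z n \<omega>) - g (Z 0 \<omega>)\<bar> \<le> 2 * D"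
        using gE[OF Z_in_E[OF x w, of n]] gE[OF Z_in_E[OF x w, of 0]] by linarith
      moreover have "?W n \<omega> = real n * ?A n \<omega> + (g (Z n \<omega>) - g (Z 0 \<omega>))"
        unfolding W using n(1) by (simp add: field_simps)
      moreover have "\<epsilon> * real n < \<bar>real n * ?A n \<omega>\<bar>"
        using A n(1) by (simp add: abs_mult mult.commute)
      moreover have "e / 2 \<le> \<bar>w\<bar>" if "\<bar>d\<bar> \<le> 2 * D" "w = q + d" "e < \<bar>q\<bar>" "4 * D \<le> e" for w q d e :: real
        using that by linarith
      ultimately have "\<epsilon> * real n / 2 \<le> \<bar>?W n \<omega>\<bar>" using n(2) by blast
      then have "(\<epsilon> * real n / 2)\<^sup>2 \<le> \<bar>?W n \<omega>\<bar>\<^sup>2"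
        using \<epsilon> by (intro power_mono) auto
      then show "(\<epsilon> * real n / 2)\<^sup>2 \<le> (?W n \<omega>)\<^sup>2" by (simp only: power2_abs)
    qed
    have "measure (P x) {\<omega> \<in> space (P x). \<epsilon> < \<bar>?A n \<omega>\<bar>}
        \<le> measure (P x) {\<omega> \<in> space (P x). (\<epsilon> * real n / 2)\<^sup>2 \<le> (?W n \<omega>)\<^sup>2}"
      by (intro finite_measure_mono sub) measurable
    also have "\<dots> \<le> (\<integral>\<omega>. (?W n \<omega>)\<^sup>2 \<partial>P x) / (\<epsilon> * real n / 2)\<^sup>2"
      using \<epsilon> n(1) moment(1) by (intro integral_Markov_inequality_measure[where A="{}"]) auto
    also have "\<dots> \<le> (real n * B\<^sup>2) / (\<epsilon> * real n / 2)\<^sup>2"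
      by (intro divide_right_mono moment(2)) auto
    also have "\<dots> = 4 * B\<^sup>2 / (\<epsilon>\<^sup>2 * real n)"
      using n(1) by (simp add: power2_eq_square field_simps)
    finally show ?thesis .
  qed
  obtain N where N: "4 * D / \<epsilon> \<le> real N" using real_arch_simple by blast
  have "(\<lambda>n. measure (P x) {\<omega> \<in> space (P x). \<epsilon> < \<bar>?A n \<omega>\<bar>}) \<longlonglongrightarrow> 0"
  proof (rule tendsto_sandwich[OF _ _ tendsto_const])
    show "\<forall>\<^sub>F n in sequentially. 0 \<le> measure (P x) {\<omega> \<in> space (P x). \<epsilon> < \<bar>?A n \<omega>\<bar>}" by simp
    show "\<forall>\<^sub>F n in sequentially. measure (P x) {\<omega> \<in> space (P x). \<epsilon> < \<bar>?A n \<omega>\<bar>} \<le> 4 * B\<^sup>2 / (\<epsilon>\<^sup>2 * real n)"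
      using eventually_ge_at_top[of "max 1 N"]
    proof eventually_elim
      case (elim n)
      have "4 * D / \<epsilon> \<le> real n" using N elim by linarith
      then show ?case using elim \<epsilon> by (intro le) (auto simp: field_simps)
    qed
    have "(\<lambda>n. (4 * B\<^sup>2 / \<epsilon>\<^sup>2) * (1 / real n)) \<longlonglongrightarrow> (4 * B\<^sup>2 / \<epsilon>\<^sup>2) * 0"
      by (intro tendsto_intros lim_1_over_n)
    then show "(\<lambda>n. 4 * B\<^sup>2 / (\<epsilon>\<^sup>2 * real n)) \<longlonglongrightarrow> 0" by simp
  qed
  then show ?thesis by (simp add: c)
qed

end

section \<open>Stationary means of the counting processes\<close>

lemma continuous_on_integral_bounded:
  fixes h :: "'b \<Rightarrow> 'c::metric_space \<Rightarrow> real"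
  assumes "finite_measure M" and h: "\<And>u. u \<in> U \<Longrightarrow> (\<lambda>p. h p u) \<in> borel_measurable M"
    and bnd: "\<And>p u. p \<in> space M \<Longrightarrow> u \<in> U \<Longrightarrow> \<bar>h p u\<bar> \<le> C"
    and cont: "\<And>p. p \<in> space M \<Longrightarrow> continuous_on U (h p)"
  shows "continuous_on U (\<lambda>u. \<integral>p. h p u \<partial>M)"
proof -
  interpret finite_measure M by fact
  show ?thesis
    unfolding continuous_on_sequentially
  proof (intro allI ballI impI, elim conjE)
    fix v a assume a: "a \<in> U" and v: "\<forall>n. v n \<in> U" "v \<longlonglongrightarrow> a"
    show "((\<lambda>u. \<integral>p. h p u \<partial>M) \<circ> v) \<longlonglongrightarrow> (\<integral>p. h p a \<partial>M)"
      unfolding comp_def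
    proof (rule integral_dominated_convergence[where w="\<lambda>_. C"])
      show "AE p in M. (\<lambda>n. h p (v n)) \<longlonglongrightarrow> h p a"
        using cont a v by (intro AE_I2) (auto simp: continuous_on_sequentially comp_def)
    qed (use h bnd a v in auto)
  qed
qed

section \<open>Bounds for the joint density and monotonicity of its tail\<close>

context regular_pdmp
begin

definition Qd_up :: real where
  "Qd_up = (SOME C. \<forall>x\<in>E. \<forall>s\<ge>0. \<forall>y\<in>E. \<bar>Qd x s y\<bar> \<le> C)"

lemma Qd_up: "x \<in> E \<Longrightarrow> 0 \<le> s \<Longrightarrow> y \<in> E \<Longrightarrow> \<bar>Qd x s y\<bar> \<le> Qd_up"
  using someI_ex[OF Qd_bounded] unfolding Qd_up_def by blast

definition f_up :: real where
  "f_up = (SOME C. \<forall>\<xi>\<in>E. \<forall>t\<ge>0. \<bar>f \<xi> t\<bar> \<le> C)"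

lemma f_up: "x \<in> E \<Longrightarrow> 0 \<le> s \<Longrightarrow> \<bar>f x s\<bar> \<le> f_up"
  using someI_ex[OF f_bounded] unfolding f_up_def by blast

lemma f_Qd_bound: "x \<in> E \<Longrightarrow> 0 \<le> s \<Longrightarrow> y \<in> E \<Longrightarrow> \<bar>f x s * Qd x s y\<bar> \<le> f_up * Qd_up"
  unfolding abs_mult using f_up[of x s] by (intro mult_mono f_up Qd_up) auto

lemma joint_le:
  assumes x: "x \<in> E" and y: "y \<in> E"
  shows "joint x s y \<le> dens x s * Qd_up"
proof -
  have "Qd x (max 0 (min s (exit x))) y \<le> Qd_up"
    using Qd_up[OF x _ y, of "max 0 (min s (exit x))"] by simp
  then show ?thesis
    unfolding joint_def by (rule mult_left_mono) (rule dens_nonneg[OF x])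
qed

lemma joint_slice_integrable:
  assumes x: "x \<in> E" and y: "y \<in> E"
    and [measurable]: "\<phi> \<in> borel_measurable borel" and \<phi>: "\<And>s. \<bar>\<phi> s\<bar> \<le> C"
  shows "integrable lborel (\<lambda>s. joint x s y * \<phi> s)"
proof -
  have [measurable]: "(\<lambda>s. joint x s y) \<in> borel_measurable borel"
    using x y by (intro measurable_joint) auto
  have C: "0 \<le> C" using \<phi>[of 0] by linarith
  have i: "integrable lborel (\<lambda>s. dens x s * Qd_up * C)"
    using dens_total[OF x] by (simp add: has_bochner_integral_iff)
  have "\<bar>joint x s y * \<phi> s\<bar> \<le> dens x s * Qd_up * C" for s
    unfolding abs_mult using joint_le[OF x y, of s] joint_nonneg[OF x y, of s] \<phi> C
    by (intro mult_mono) auto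
  then show ?thesis
    by (intro Bochner_Integration.integrable_bound[OF i]) (auto intro!: AE_I2 order_trans[OF _ abs_ge_self])
qed

lemma joint_tail_antimono:
  assumes x: "x \<in> E" and y: "y \<in> E" and "u \<le> v"
  shows "joint_tail x y v \<le> joint_tail x y u"
  unfolding joint_tail_def using assms(3) joint_nonneg[OF x y]
  by (intro integral_mono joint_slice_integrable[OF x y, where C=1]) (auto intro!: mult_left_mono)

lemma joint_tail_bounds:
  assumes x: "x \<in> E" and y: "y \<in> E"
  shows "0 \<le> joint_tail x y u" "joint_tail x y u \<le> Qd_up" "\<bar>joint_tail x y u\<bar> \<le> Qd_up"
proof -
  show 1: "0 \<le> joint_tail x y u"
    unfolding joint_tail_def using joint_nonneg[OF x y] by (intro Bochner_Integration.integral_nonneg) auto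
  have "joint_tail x y u \<le> (\<integral>s. dens x s * Qd_up \<partial>lborel)"
    unfolding joint_tail_def
  proof (rule integral_mono)
    show "integrable lborel (\<lambda>s. dens x s * Qd_up)"
      using dens_total[OF x] by (simp add: has_bochner_integral_iff)
    show "joint x s y * of_bool (u \<le> min s (exit x)) \<le> dens x s * Qd_up" for s
      using joint_le[OF x y, of s] joint_nonneg[OF x y, of s] by (auto simp: of_bool_def)
  qed (auto intro!: joint_slice_integrable[OF x y, where C=1])
  also have "\<dots> = Qd_up"
    using dens_total[OF x] by (simp add: has_bochner_integral_iff)
  finally show 2: "joint_tail x y u \<le> Qd_up" .
  show "\<bar>joint_tail x y u\<bar> \<le> Qd_up" using 1 2 by simp
qed

end

section \<open>Integrals over stationary pairs of consecutive locations\<close>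

context embedded_chain
begin

abbreviation \<nu>\<mu> :: "('a \<times> 'a) measure" where "\<nu>\<mu> \<equiv> \<nu> \<Otimes>\<^sub>M \<mu>"

sublocale \<nu>\<mu>: pair_sigma_finite \<nu> \<mu> ..

lemma finite_\<nu>\<mu>: "finite_measure \<nu>\<mu>"
  by (rule finite_measure_pair_measure) unfold_locales

lemma \<nu>\<mu>_integrable:
  assumes "w \<in> borel_measurable \<nu>\<mu>" "\<And>x y. x \<in> E \<Longrightarrow> y \<in> E \<Longrightarrow> \<bar>w (x, y)\<bar> \<le> (C::real)"
  shows "integrable \<nu>\<mu> w"
proof -
  interpret finite_measure \<nu>\<mu> by (rule finite_\<nu>\<mu>)
  show ?thesis using assms by (intro integrable_const_bound[where B=C]) (auto simp: space_pair_measure)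
qed

lemma measurable_R: "R \<in> \<mu> \<rightarrow>\<^sub>M subprob_algebra \<mu>"
proof (rule measurable_subprob_algebra)
  fix B assume [measurable]: "B \<in> sets \<mu>"
  have "(\<lambda>x. \<integral>\<^sup>+y. ennreal (joint_tail x y 0) * indicator B y \<partial>\<mu>) \<in> borel_measurable \<mu>"
    by measurable
  then show "(\<lambda>x. emeasure (R x) B) \<in> borel_measurable \<mu>"
    by (rule measurable_cong[THEN iffD2, rotated]) (simp add: R_density emeasure_density measurable_joint_tail)
next
  fix x assume x: "x \<in> space \<mu>"
  then have "prob_space (R x)"
    unfolding R_def using Z_measurable[of x 1] P_prob[of x] by (intro prob_space.prob_space_distr) auto
  then show "subprob_space (R x)" by (rule prob_space_imp_subprob_space)
qed (rule sets_R)

text \<open>Since \<open>R x\<close> has density \<open>joint_tail x y 0\<close>, the pair law has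
  this density with respect to the product \<open>\<nu>\<mu>\<close>. The quotient defining
  \<open>l\<close> is evaluated in this form.\<close>

lemma integral_\<nu>2:
  assumes w[measurable]: "w \<in> borel_measurable (\<mu> \<Otimes>\<^sub>M \<mu>)" and bnd: "\<And>x y. x \<in> E \<Longrightarrow> y \<in> E \<Longrightarrow> \<bar>w (x, y)\<bar> \<le> (C::real)"
  shows "(\<integral>p. w p \<partial>\<nu>2) = (\<integral>p. joint_tail (fst p) (snd p) 0 * w p \<partial>\<nu>\<mu>)"
proof -
  let ?K = "\<lambda>x. distr (R x) (\<mu> \<Otimes>\<^sub>M \<mu>) (Pair x)"
  have "sets (restrict_space borel E \<Otimes>\<^sub>M restrict_space borel E) = sets (\<mu> \<Otimes>\<^sub>M \<mu>)"
    by (intro sets_pair_measure_cong) (simp_all add: sets_\<mu>)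
  then have \<nu>2: "\<nu>2 = \<nu> \<bind> ?K"
    unfolding \<nu>2_def by (intro bind_cong_All ballI distr_cong) auto
  have K[measurable]: "?K \<in> \<nu> \<rightarrow>\<^sub>M subprob_algebra (\<mu> \<Otimes>\<^sub>M \<mu>)"
    by (rule measurable_distr2[where M=\<mu>]) (use measurable_R in \<open>auto simp: measurable_cong_sets[OF sets_\<nu> refl]\<close>)
  have inner: "(\<integral>p. w p \<partial>?K x) = (\<integral>y. joint_tail x y 0 * w (x, y) \<partial>\<mu>)" if x: "x \<in> E" for x
  proof -
    have x': "x \<in> space \<mu>" using x by simp
    have "(\<integral>p. w p \<partial>?K x) = (\<integral>y. w (x, y) \<partial>R x)"
      using x' by (subst integral_distr) (auto simp: measurable_cong_sets[OF sets_R refl])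
    also have "\<dots> = (\<integral>y. joint_tail x y 0 * w (x, y) \<partial>\<mu>)"
      unfolding R_density[OF x] using x' doeblin.kernel_nonneg[of x] by (subst integral_density) auto
    finally show ?thesis .
  qed
  have "(\<integral>p. w p \<partial>\<nu>2) = (\<integral>x. (\<integral>p. w p \<partial>?K x) \<partial>\<nu>)"
    unfolding \<nu>2
  proof (rule integral_bind[OF w _ K, where B=C and B'=1])
    show "AE x in \<nu>. emeasure (?K x) (space (?K x)) \<le> ennreal 1"
    proof (rule AE_I2)
      fix x assume "x \<in> space \<nu>"
      then have "subprob_space (?K x)"
        using measurable_space[OF K] by (simp add: space_subprob_algebra)
      then show "emeasure (?K x) (space (?K x)) \<le> ennreal 1"
        using subprob_space.emeasure_space_le_1 by (simp only: ennreal_1)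
    qed
  qed (use bnd \<nu>.finite_measure_axioms in \<open>auto simp: space_pair_measure\<close>)
  also have "\<dots> = (\<integral>x. (\<integral>y. joint_tail x y 0 * w (x, y) \<partial>\<mu>) \<partial>\<nu>)"
    by (rule Bochner_Integration.integral_cong[OF refl]) (simp add: inner)
  also have "\<dots> = (\<integral>p. joint_tail (fst p) (snd p) 0 * w p \<partial>\<nu>\<mu>)"
  proof -
    have "integrable \<nu>\<mu> (\<lambda>p. joint_tail (fst p) (snd p) 0 * w p)"
    proof (rule \<nu>\<mu>_integrable[where C="Qd_up * C"])
      fix x y assume "x \<in> E" "y \<in> E"
      then show "\<bar>joint_tail (fst (x, y)) (snd (x, y)) 0 * w (x, y)\<bar> \<le> Qd_up * C"
        using joint_tail_bounds[of x y 0] bnd[of x y] by (auto simp: abs_mult intro!: mult_mono)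
    qed measurable
    from \<nu>\<mu>.integral_fst'[OF this] show ?thesis by simp
  qed
  finally show ?thesis .
qed

text \<open>The common form of all averages over triples:
  \<open>\<phi> = (\<lambda>s. of_bool (u \<le> s))\<close> counts those at risk at
  \<open>u\<close>, and a rescaled kernel divided by \<open>mean_at_risk\<close> gives the
  linearized estimator.\<close>

definition cell_fun :: "(real \<Rightarrow> real) \<Rightarrow> 'a set \<Rightarrow> 'a set \<Rightarrow> 'a \<times> real \<times> 'a \<Rightarrow> real" where
  "cell_fun \<phi> A B = (\<lambda>(x, s, y). \<phi> s * of_bool (x \<in> A) * of_bool (y \<in> B))"

definition mean_at_risk :: "'a set \<Rightarrow> 'a set \<Rightarrow> real \<Rightarrow> real" where
  "mean_at_risk A B u = (\<integral>p. of_bool (fst p \<in> A) * of_bool (snd p \<in> B) * joint_tail (fst p) (snd p) u \<partial>\<nu>\<mu>)"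

definition mean_intensity :: "'a set \<Rightarrow> 'a set \<Rightarrow> real \<Rightarrow> real" where
  "mean_intensity A B u = (\<integral>p. of_bool (fst p \<in> A) * of_bool (snd p \<in> B)
     * (f (fst p) (max 0 u) * Qd (fst p) (max 0 u) (snd p)) \<partial>\<nu>\<mu>)"

context
  fixes A B :: "'a set" and t :: real
  assumes A[measurable]: "A \<in> sets \<mu>" and B[measurable]: "B \<in> sets \<mu>"
    and A_interior: "interior A \<noteq> {}" and B_interior: "interior B \<noteq> {}"
    and t_pos: "0 < t" and t_exit: "\<And>x. x \<in> A \<Longrightarrow> t < exit x"
begin

lemma A_sub: "x \<in> A \<Longrightarrow> x \<in> E" and B_sub: "y \<in> B \<Longrightarrow> y \<in> E"
  using sets.sets_into_space[OF A] sets.sets_into_space[OF B] by auto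

lemma measurable_cell_fun:
  assumes [measurable]: "\<phi> \<in> borel_measurable borel"
  shows "cell_fun \<phi> A B \<in> borel_measurable \<Theta>"
  unfolding cell_fun_def by measurable

lemma cell_fun_bounded: "(\<And>s. \<bar>\<phi> s\<bar> \<le> C) \<Longrightarrow> bounded_on_E (cell_fun \<phi> A B) C"
  using order_trans[OF abs_ge_zero, of "\<phi> _" C] by (auto simp: cell_fun_def bounded_on_E_def of_bool_def)

lemma integral_step_cell_fun:
  assumes [measurable]: "\<phi> \<in> borel_measurable borel" and \<phi>: "\<And>s. \<bar>\<phi> s\<bar> \<le> C"
  shows "(\<integral>x. step (cell_fun \<phi> A B) x \<partial>\<nu>)
    = (\<integral>p. of_bool (fst p \<in> A) * of_bool (snd p \<in> B)
        * (\<integral>s. joint (fst p) s (snd p) * \<phi> (min s (exit (fst p))) \<partial>lborel) \<partial>\<nu>\<mu>)"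
proof -
  have C: "0 \<le> C" using \<phi>[of 0] by linarith
  let ?w = "\<lambda>p. of_bool (fst p \<in> A) * of_bool (snd p \<in> B)
        * (\<integral>s. joint (fst p) s (snd p) * \<phi> (min s (exit (fst p))) \<partial>lborel)"
  have "(\<integral>x. step (cell_fun \<phi> A B) x \<partial>\<nu>) = (\<integral>x. (\<integral>y. ?w (x, y) \<partial>\<mu>) \<partial>\<nu>)"
  proof (rule Bochner_Integration.integral_cong[OF refl])
    fix x assume "x \<in> space \<nu>"
    then have x: "x \<in> E" by simp
    have "step (cell_fun \<phi> A B) x
        = (\<integral>y. (\<integral>s. joint x s y * cell_fun \<phi> A B (x, min s (exit x), y) \<partial>lborel) \<partial>\<mu>)"
      using lborel_\<mu>.integral_snd[of "\<lambda>s y. joint x s y * cell_fun \<phi> A B (x, min s (exit x), y)"]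
        step_integrable[OF x measurable_cell_fun[OF assms(1)] cell_fun_bounded[OF \<phi>]]
      by (simp add: step_def case_prod_beta')
    also have "\<dots> = (\<integral>y. ?w (x, y) \<partial>\<mu>)"
      by (intro Bochner_Integration.integral_cong refl) (auto simp: cell_fun_def of_bool_def)
    finally show "step (cell_fun \<phi> A B) x = (\<integral>y. ?w (x, y) \<partial>\<mu>)" .
  qed
  also have "\<dots> = (\<integral>p. ?w p \<partial>\<nu>\<mu>)"
  proof (rule \<nu>\<mu>.integral_fst'[OF \<nu>\<mu>_integrable[where C="Qd_up * C"]])
    fix x y assume x: "x \<in> E" and y: "y \<in> E"
    have i: "integrable lborel (\<lambda>s. joint x s y * \<phi> (min s (exit x)))"
      using \<phi> by (intro joint_slice_integrable[OF x y, where C=C]) auto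
    have "\<bar>\<integral>s. joint x s y * \<phi> (min s (exit x)) \<partial>lborel\<bar> \<le> (\<integral>s. \<bar>joint x s y * \<phi> (min s (exit x))\<bar> \<partial>lborel)"
      by (rule integral_abs_bound)
    also have "\<dots> \<le> (\<integral>s. joint x s y * C \<partial>lborel)"
      using i joint_nonneg[OF x y] \<phi>
      by (intro integral_mono integrable_abs joint_slice_integrable[OF x y, where C=C])
        (auto simp: abs_mult C intro!: mult_left_mono)
    also have "\<dots> = joint_tail x y 0 * C"
    proof -
      have "(\<lambda>s. joint x s y * of_bool (0 \<le> min s (exit x))) = (\<lambda>s. joint x s y)"
        using exit_nonneg[OF x] by (auto simp: joint_def dens_def fun_eq_iff)
      then show ?thesis by (simp add: joint_tail_def)
    qed
    also have "\<dots> \<le> Qd_up * C"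
      using joint_tail_bounds(2)[OF x y] C by (rule mult_right_mono)
    finally show "\<bar>?w (x, y)\<bar> \<le> Qd_up * C"
      using order_trans[OF abs_ge_zero] by (auto simp: of_bool_def)
  qed measurable
  finally show ?thesis .
qed

lemma mean_at_risk_eq: "(\<integral>x. step (cell_fun (\<lambda>s. of_bool (u \<le> s)) A B) x \<partial>\<nu>) = mean_at_risk A B u"
  unfolding mean_at_risk_def joint_tail_def
  by (rule integral_step_cell_fun[where C=1]) auto

text \<open>Exit times on \<open>A\<close> exceed \<open>t\<close> and \<open>\<phi>\<close>
  vanishes above \<open>t\<close>, so neither the spread atom nor later times contribute. Up to
  \<open>t\<close>, folding does nothing and \<open>joint\<close> is \<open>f\<close> times
  \<open>Qd\<close>.\<close>

lemma mean_jump_eq: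
  assumes \<phi>m[measurable]: "\<phi> \<in> borel_measurable borel" and \<phi>: "\<And>s. \<bar>\<phi> s\<bar> \<le> C"
    and \<phi>_supp: "\<And>s. t < s \<Longrightarrow> \<phi> s = 0"
  shows "(\<integral>x. step (cell_fun \<phi> A B) x \<partial>\<nu>) = (\<integral>s. of_bool (0 \<le> s \<and> s \<le> t) * \<phi> s * mean_intensity A B s \<partial>lborel)"
proof -
  interpret N: finite_measure \<nu>\<mu> by (rule finite_\<nu>\<mu>)
  interpret N: pair_sigma_finite \<nu>\<mu> "lborel :: real measure" ..
  have C: "0 \<le> C" using \<phi>[of 0] by linarith
  let ?w = "\<lambda>(p, s). of_bool (0 \<le> s \<and> s \<le> t) * \<phi> s * (of_bool (fst p \<in> A) * of_bool (snd p \<in> B)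
     * (f (fst p) (max 0 s) * Qd (fst p) (max 0 s) (snd p)))"
  have wm: "?w \<in> borel_measurable (\<nu>\<mu> \<Otimes>\<^sub>M lborel)" by measurable
  \<comment> \<open>Lebesgue measure is infinite, but the cut-off confines the integrand to a set of
    finite measure, on which it is bounded; this permits Fubini below.\<close>
  have wi: "integrable (\<nu>\<mu> \<Otimes>\<^sub>M lborel) ?w"
  proof (rule integrableI_bounded_set[where A="(E \<times> E) \<times> {0..t}" and B="C * (f_up * Qd_up)", OF _ wm])
    have E2: "E \<times> E \<in> sets \<nu>\<mu>" using sets.top[of \<nu>\<mu>] by (simp add: space_pair_measure)
    then show "(E \<times> E) \<times> {0..t} \<in> sets (\<nu>\<mu> \<Otimes>\<^sub>M lborel)" by simp
    show "emeasure (\<nu>\<mu> \<Otimes>\<^sub>M lborel) ((E \<times> E) \<times> {0..t}) < \<infinity>"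
      using E2 t_pos by (subst lborel.emeasure_pair_measure_Times) (auto simp: N.emeasure_eq_measure ennreal_mult_less_top)
    show "AE z in \<nu>\<mu> \<Otimes>\<^sub>M lborel. z \<in> (E \<times> E) \<times> {0..t} \<longrightarrow> norm (?w z) \<le> C * (f_up * Qd_up)"
    proof (rule AE_I2, rule impI)
      fix z assume "z \<in> (E \<times> E) \<times> {0..t}"
      then obtain x y s where z: "z = ((x, y), s)" and xy: "x \<in> E" "y \<in> E" and s: "s \<in> {0..t}"
        by auto
      have "\<bar>\<phi> s * (f x s * Qd x s y)\<bar> \<le> C * (f_up * Qd_up)"
        unfolding abs_mult[of "\<phi> s"] using \<phi> f_Qd_bound[OF xy(1) _ xy(2), of s] s C by (intro mult_mono) auto
      then show "norm (?w z) \<le> C * (f_up * Qd_up)"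
        unfolding z using s order_trans[OF abs_ge_zero] by (auto simp: of_bool_def max_def)
    qed
    show "AE z in \<nu>\<mu> \<Otimes>\<^sub>M lborel. z \<notin> (E \<times> E) \<times> {0..t} \<longrightarrow> ?w z = 0"
      by (rule AE_I2) (auto simp: space_pair_measure)
  qed
  have "(\<integral>x. step (cell_fun \<phi> A B) x \<partial>\<nu>) = (\<integral>p. (\<integral>s. ?w (p, s) \<partial>lborel) \<partial>\<nu>\<mu>)"
    unfolding integral_step_cell_fun[OF \<phi>m \<phi>]
  proof (rule Bochner_Integration.integral_cong[OF refl])
    fix p :: "'a \<times> 'a"
    obtain x y where p: "p = (x, y)" by (cases p)
    show "of_bool (fst p \<in> A) * of_bool (snd p \<in> B)
        * (\<integral>s. joint (fst p) s (snd p) * \<phi> (min s (exit (fst p))) \<partial>lborel) = (\<integral>s. ?w (p, s) \<partial>lborel)"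
    proof (cases "x \<in> A \<and> y \<in> B")
      case True
      have "joint x s y * \<phi> (min s (exit x))
          = of_bool (0 \<le> s \<and> s \<le> t) * \<phi> s * (f x (max 0 s) * Qd x (max 0 s) y)" for s
      proof (cases "s \<le> t")
        case True
        then show ?thesis
          using t_exit[of x] \<open>x \<in> A \<and> y \<in> B\<close> by (auto simp: joint_def dens_def max_def min_def)
      next
        case False
        then have "t < min s (exit x)" using t_exit[of x] \<open>x \<in> A \<and> y \<in> B\<close> by auto
        then show ?thesis using \<phi>_supp False by simp
      qed
      then show ?thesis using True by (simp add: p)
    qed (auto simp: p)
  qed
  also have "\<dots> = (\<integral>s. (\<integral>p. ?w (p, s) \<partial>\<nu>\<mu>) \<partial>lborel)"
    using N.Fubini_integral[of "\<lambda>p s. ?w (p, s)"] wi by (simp add: case_prod_beta')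
  also have "\<dots> = (\<integral>s. of_bool (0 \<le> s \<and> s \<le> t) * \<phi> s * mean_intensity A B s \<partial>lborel)"
    by (simp add: mean_intensity_def)
  finally show ?thesis .
qed

text \<open>Hazard times survival and survival itself both carry the factor
  \<open>1 / joint_tail x y 0\<close>, which the density of \<open>\<nu>2\<close> cancels.\<close>

lemma l_eq:
  assumes u: "0 \<le> u" "u \<le> t"
  shows "l A B u = mean_intensity A B u / mean_at_risk A B u"
proof -
  have ex: "u \<in> {0..exit x}" if "x \<in> A" for x using t_exit[OF that] u by auto
  \<comment> \<open>Closed forms, measurable and bounded on all of \<open>E \<times> E\<close>, that
    agree with the expressions in \<open>l\<close> on \<open>A \<times> B\<close>, where
    \<open>u\<close> precedes the exit time.\<close>
  let ?h = "\<lambda>p. of_bool (fst p \<in> A) * of_bool (snd p \<in> B)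
      * (f (fst p) (max 0 u) * Qd (fst p) (max 0 u) (snd p) / joint_tail (fst p) (snd p) 0)"
  let ?s = "\<lambda>p. of_bool (fst p \<in> A) * of_bool (snd p \<in> B)
      * (joint_tail (fst p) (snd p) u / joint_tail (fst p) (snd p) 0)"
  have sp: "space \<nu>2 = E \<times> E"
    unfolding \<nu>2_def using \<nu>.not_empty
    by (subst space_bind[where N="restrict_space borel E \<Otimes>\<^sub>M restrict_space borel E"])
      (auto simp: space_pair_measure space_restrict_space)
  have pos: "0 < joint_tail x y 0" if "x \<in> E" "y \<in> E" for x y
    using joint_tail_0_lower[OF that] Qd_low(1) by linarith
  have pos0: "joint_tail x y 0 \<noteq> 0" if "x \<in> A" "y \<in> B" for x y
    using pos[OF A_sub B_sub] that by force
  have pos_u: "0 < joint_tail x y u" if "x \<in> A" "y \<in> B" for x y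
    using joint_tail_pos[OF A_sub B_sub] ex that by auto
  have sv: "survival x y u = joint_tail x y u / joint_tail x y 0" if "x \<in> A" "y \<in> B" for x y
    using survival_eq[OF A_sub B_sub ex] that by simp
  have hz: "hazard x y u * survival x y u = f x u * Qd x u y / joint_tail x y 0" if "x \<in> A" "y \<in> B" for x y
    using hazard_eq[OF A_sub B_sub ex, of x y] sv[OF that] pos_u[OF that] that by simp
  have "(LINT (x, y):A \<times> B|\<nu>2. hazard x y u * survival x y u) = (\<integral>p. ?h p \<partial>\<nu>2)"
    unfolding set_lebesgue_integral_def
  proof (rule Bochner_Integration.integral_cong[OF refl])
    fix p assume "p \<in> space \<nu>2"
    show "indicator (A \<times> B) p *\<^sub>R (case p of (x, y) \<Rightarrow> hazard x y u * survival x y u) = ?h p"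
      using u by (cases p) (auto simp: indicator_def hz)
  qed
  also have "\<dots> = (\<integral>p. joint_tail (fst p) (snd p) 0 * ?h p \<partial>\<nu>\<mu>)"
  proof (rule integral_\<nu>2[where C="f_up * Qd_up / Qd_low"])
    fix x y assume xy: "x \<in> E" "y \<in> E"
    have "\<bar>f x u * Qd x u y\<bar> / joint_tail x y 0 \<le> f_up * Qd_up / Qd_low"
      using f_Qd_bound[OF xy(1) u(1) xy(2)] joint_tail_0_lower[OF xy] Qd_low(1)
      by (intro frac_le) (auto intro: order_trans[OF abs_ge_zero])
    then show "\<bar>?h (x, y)\<bar> \<le> f_up * Qd_up / Qd_low"
      using u pos[OF xy] order_trans[OF abs_ge_zero f_Qd_bound[OF xy(1) u(1) xy(2)]] Qd_low(1)
      by (auto simp: of_bool_def abs_mult max_def)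
  qed measurable
  also have "\<dots> = mean_intensity A B u"
    unfolding mean_intensity_def
    by (intro Bochner_Integration.integral_cong refl) (auto simp: of_bool_def pos0)
  finally have num: "(LINT (x, y):A \<times> B|\<nu>2. hazard x y u * survival x y u) = mean_intensity A B u" .
  have "(LINT (x, y):A \<times> B|\<nu>2. survival x y u) = (\<integral>p. ?s p \<partial>\<nu>2)"
    unfolding set_lebesgue_integral_def
  proof (rule Bochner_Integration.integral_cong[OF refl])
    fix p assume "p \<in> space \<nu>2"
    show "indicator (A \<times> B) p *\<^sub>R (case p of (x, y) \<Rightarrow> survival x y u) = ?s p"
      by (cases p) (auto simp: indicator_def sv)
  qed
  also have "\<dots> = (\<integral>p. joint_tail (fst p) (snd p) 0 * ?s p \<partial>\<nu>\<mu>)"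
  proof (rule integral_\<nu>2[where C=1])
    fix x y assume xy: "x \<in> E" "y \<in> E"
    show "\<bar>?s (x, y)\<bar> \<le> 1"
      using joint_tail_antimono[OF xy u(1)] joint_tail_bounds(1)[OF xy, of u] pos[OF xy] by (auto simp: of_bool_def)
  qed measurable
  also have "\<dots> = mean_at_risk A B u"
    unfolding mean_at_risk_def
    by (intro Bochner_Integration.integral_cong refl) (auto simp: of_bool_def pos0)
  finally show ?thesis using num by (simp add: l_def)
qed

text \<open>Because of the atom, \<open>joint_tail x y\<close> jumps to 0 just after the exit time.
  On \<open>A\<close> this happens beyond \<open>t\<close>, so the integrand is continuous on
  \<open>{0..t}\<close>.\<close>

lemma mean_at_risk_continuous: "continuous_on {0..t} (mean_at_risk A B)"
  unfolding mean_at_risk_def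
proof (rule continuous_on_integral_bounded[OF finite_\<nu>\<mu>, where C=Qd_up])
  fix p u assume p: "p \<in> space \<nu>\<mu>"
  show "\<bar>of_bool (fst p \<in> A) * of_bool (snd p \<in> B) * joint_tail (fst p) (snd p) u\<bar> \<le> Qd_up"
    using p joint_tail_bounds[of "fst p" "snd p" u] by (auto simp: space_pair_measure of_bool_def)
next
  fix p assume p: "p \<in> space \<nu>\<mu>"
  show "continuous_on {0..t} (\<lambda>u. of_bool (fst p \<in> A) * of_bool (snd p \<in> B) * joint_tail (fst p) (snd p) u)"
  proof (cases "fst p \<in> A")
    case True
    then show ?thesis
      using p t_exit[OF True]
      by (intro continuous_intros continuous_on_subset[OF joint_tail_continuous]) (auto simp: space_pair_measure)
  qed auto
qed measurable

lemma mean_intensity_continuous: "continuous_on {0..t} (mean_intensity A B)"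
  unfolding mean_intensity_def
proof (rule continuous_on_integral_bounded[OF finite_\<nu>\<mu>, where C="f_up * Qd_up"])
  fix p u assume p: "p \<in> space \<nu>\<mu>" and u: "u \<in> {0..t}"
  then show "\<bar>of_bool (fst p \<in> A) * of_bool (snd p \<in> B) * (f (fst p) (max 0 u) * Qd (fst p) (max 0 u) (snd p))\<bar>
      \<le> f_up * Qd_up"
    using f_Qd_bound[of "fst p" "max 0 u" "snd p"] order_trans[OF abs_ge_zero]
    by (auto simp: space_pair_measure of_bool_def)
next
  fix p assume p: "p \<in> space \<nu>\<mu>"
  then have p': "fst p \<in> E" "snd p \<in> E" by (auto simp: space_pair_measure)
  show "continuous_on {0..t} (\<lambda>u. of_bool (fst p \<in> A) * of_bool (snd p \<in> B)
      * (f (fst p) (max 0 u) * Qd (fst p) (max 0 u) (snd p)))"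
    by (intro continuous_intros continuous_on_compose2[OF f_continuous[OF p'(1)]]
        continuous_on_compose2[OF Qd_continuous[OF p']]) auto
qed measurable

lemma mean_at_risk_integrable:
  "integrable \<nu>\<mu> (\<lambda>p. of_bool (fst p \<in> A) * of_bool (snd p \<in> B) * joint_tail (fst p) (snd p) u)"
proof (rule \<nu>\<mu>_integrable[where C=Qd_up])
  fix x y assume "x \<in> E" "y \<in> E"
  then show "\<bar>of_bool (fst (x, y) \<in> A) * of_bool (snd (x, y) \<in> B) * joint_tail (fst (x, y)) (snd (x, y)) u\<bar> \<le> Qd_up"
    using joint_tail_bounds[of x y u] by (auto simp: of_bool_def)
qed measurable

lemma mean_at_risk_antimono:
  assumes "u \<le> v"
  shows "mean_at_risk A B v \<le> mean_at_risk A B u"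
  unfolding mean_at_risk_def
proof (intro integral_mono mean_at_risk_integrable)
  fix p assume "p \<in> space \<nu>\<mu>"
  then show "of_bool (fst p \<in> A) * of_bool (snd p \<in> B) * joint_tail (fst p) (snd p) v
      \<le> of_bool (fst p \<in> A) * of_bool (snd p \<in> B) * joint_tail (fst p) (snd p) u"
    using joint_tail_antimono[OF _ _ assms, of "fst p" "snd p"] by (auto simp: space_pair_measure of_bool_def)
qed

text \<open>The integrand is strictly positive on \<open>A \<times> B\<close>, a set of positive
  mass because both factors have interior. This is what allows division by the at-risk mean.\<close>

lemma mean_at_risk_pos:
  assumes u: "0 \<le> u" "u \<le> t"
  shows "0 < mean_at_risk A B u"
proof -
  let ?w = "\<lambda>p. of_bool (fst p \<in> A) * of_bool (snd p \<in> B) * joint_tail (fst p) (snd p) u"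
  have i: "integrable \<nu>\<mu> ?w" by (rule mean_at_risk_integrable)
  have nn: "AE p in \<nu>\<mu>. 0 \<le> ?w p"
    using joint_tail_bounds(1) by (intro AE_I2) (auto simp: space_pair_measure)
  have "mean_at_risk A B u \<noteq> 0"
  proof
    assume "mean_at_risk A B u = 0"
    then have "AE p in \<nu>\<mu>. ?w p = 0"
      using integral_nonneg_eq_0_iff_AE[OF i nn] by (simp add: mean_at_risk_def)
    then have "AE p in \<nu>\<mu>. p \<notin> A \<times> B"
    proof eventually_elim
      case (elim p)
      then show ?case
        using joint_tail_pos[OF A_sub B_sub, of "fst p" "snd p" u] t_exit[of "fst p"] u
        by (cases p) (auto simp: of_bool_def split: if_splits)
    qed
    moreover have AB: "A \<times> B \<in> sets \<nu>\<mu>" by simp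
    ultimately have "emeasure \<nu>\<mu> (A \<times> B) = 0"
      using AE_iff_measurable[OF AB, of "\<lambda>p. p \<notin> A \<times> B"] sets.sets_into_space[OF AB] by auto
    moreover have "emeasure \<nu>\<mu> (A \<times> B) = emeasure \<nu> A * emeasure \<mu> B"
      by (rule \<mu>.emeasure_pair_measure_Times) auto
    ultimately show False
      using \<nu>_pos[OF A A_interior] \<mu>_pos[OF B B_interior] by auto
  qed
  moreover have "0 \<le> mean_at_risk A B u"
    unfolding mean_at_risk_def using nn by (rule integral_nonneg_AE)
  ultimately show ?thesis by simp
qed

end

end

section \<open>Consistency\<close>

context embedded_chain
begin

definition sup_error ::
  "'a set \<Rightarrow> 'a set \<Rightarrow> real \<Rightarrow> (real \<Rightarrow> real) \<Rightarrow> real \<Rightarrow> real \<Rightarrow> nat \<Rightarrow> real \<Rightarrow> 'w \<Rightarrow> ereal"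
where
  "sup_error A B t K r1 r2 n b \<omega> = (SUP s\<in>{r1..r2}. ereal \<bar>l_hat K Z S n b t A B s \<omega> - l A B s\<bar>)"

context
  fixes A B :: "'a set" and t :: real and K :: "real \<Rightarrow> real" and r1 r2 :: real and x :: 'a
  assumes A[measurable]: "A \<in> sets \<mu>" and B[measurable]: "B \<in> sets \<mu>"
    and interiors: "interior A \<noteq> {}" "interior B \<noteq> {}"
    and t_exit: "\<And>x. x \<in> A \<Longrightarrow> t < exit x"
    and K: "smoothing_kernel K"
    and r: "0 < r1" "r1 < r2" "r2 < t"
    and x: "x \<in> E"
begin

private lemma t_pos: "0 < t" using r by linarith

private lemmas cell = A B interiors t_pos t_exit

private abbreviation "Y \<equiv> mean_at_risk A B"
private abbreviation "N \<equiv> mean_intensity A B"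
private abbreviation "err \<equiv> sup_error A B t K r1 r2"

lemma Y_lower: "u \<le> t \<Longrightarrow> Y t \<le> Y u"
  by (rule mean_at_risk_antimono[OF cell])

lemma Y_pos: "0 < Y t"
  using t_pos by (intro mean_at_risk_pos[OF cell]) auto

lemma l_continuous: "continuous_on {0..t} (l A B)"
proof -
  have "Y u \<noteq> 0" if "u \<in> {0..t}" for u
    using Y_pos Y_lower[of u] that by auto
  then have "continuous_on {0..t} (\<lambda>u. N u / Y u)"
    by (intro continuous_on_divide mean_at_risk_continuous[OF cell] mean_intensity_continuous[OF cell]) auto
  then show ?thesis
    by (rule continuous_on_eq) (simp add: l_eq[OF cell])
qed

lemma K_continuous: "continuous_on UNIV K"
  using K by (simp add: smoothing_kernel_def)

lemma measurable_K: "K \<in> borel_measurable borel"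
  using K_continuous by (rule borel_measurable_continuous_onI)

lemma measurable_sup_error: "err n b \<in> borel_measurable (P x)"
proof -
  note [measurable] = Z_measurable_\<mu>[OF x] S_measurable[OF x] measurable_K
  have "continuous_on {r1..r2} (\<lambda>s. l_hat K Z S n b t A B s \<omega> - l A B s)" for \<omega>
    unfolding l_hat_def using r
    by (cases "b = 0") (auto intro!: continuous_intros continuous_on_compose2[OF K_continuous]
        continuous_on_subset[OF l_continuous])
  then have "err n b \<omega> = (SUP s\<in>{r1<..<r2} \<inter> \<rat>. ereal \<bar>l_hat K Z S n b t A B s \<omega> - l A B s\<bar>)" for \<omega>
    unfolding sup_error_def by (rule SUP_abs_continuous_rationals[OF r(2)])
  moreover have "(\<lambda>\<omega>. l_hat K Z S n b t A B s \<omega>) \<in> borel_measurable (P x)" for s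
    unfolding l_hat_def at_risk_inv_def at_risk_def by measurable
  moreover have "countable ({r1<..<r2} \<inter> \<rat>)"
    by (intro countable_Int2 countable_rat)
  ultimately show ?thesis
    by (subst measurable_cong) (auto intro!: borel_measurable_SUP)
qed

text \<open>Five errors are balanced: \<open>\<epsilon> / 4\<close> for replacing the at-risk
  process, \<open>\<epsilon> / 8\<close> for moving \<open>s\<close> to a grid point
  \<open>v\<close>, \<open>\<epsilon> / 8\<close> for the weak law at \<open>v\<close>,
  \<open>\<epsilon> / 4\<close> for the smoothing bias and \<open>\<epsilon> / 8\<close> for moving
  \<open>l\<close> back to \<open>s\<close>.\<close>

lemma fixed_bandwidth_consistency:
  assumes \<epsilon>: "0 < \<epsilon>"
  shows "\<exists>b0>0. \<forall>b. 0 < b \<longrightarrow> b < b0 \<longrightarrow>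
    (\<lambda>n. measure (P x) {\<omega> \<in> space (P x). ereal \<epsilon> < err n b \<omega>}) \<longlonglongrightarrow> 0"
proof -
  interpret prob_space "P x" using P_prob[OF x] .
  note [measurable] = Z_measurable_\<mu>[OF x] S_measurable[OF x] measurable_K
  define c where "c = Y t"
  have c: "0 < c" "\<And>u. u \<le> t \<Longrightarrow> c \<le> Y u" using Y_pos Y_lower by (auto simp: c_def)
  obtain \<kappa> where \<kappa>: "0 < \<kappa>" "\<And>u. \<bar>K u\<bar> \<le> \<kappa>" using smoothing_kernel_bounded[OF K] by blast
  have "0 < \<epsilon> / 4" using \<epsilon> by simp
  then obtain b0 where b0: "0 < b0" "\<And>b s. 0 < b \<Longrightarrow> b < b0 \<Longrightarrow> s \<in> {r1..r2} \<Longrightarrow>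
    \<bar>(\<integral>u. of_bool (0 \<le> u \<and> u \<le> t) * (K ((s - u) / b) / b) * l A B u \<partial>lborel) - l A B s\<bar> \<le> \<epsilon> / 4"
    using kernel_smoothing_converges[OF K l_continuous r(1,3)] by blast
  have "(\<lambda>n. measure (P x) {\<omega> \<in> space (P x). ereal \<epsilon> < err n b \<omega>}) \<longlonglongrightarrow> 0" if b: "0 < b" "b < b0" for b
  proof -
    \<comment> \<open>Clamping makes the denominator continuous and at least \<open>c\<close> on the
      whole line; times in \<open>{0..t}\<close> are not affected.\<close>
    define Yc where "Yc u = Y (max 0 (min t u))" for u
    have "continuous_on UNIV Yc"
      unfolding Yc_def using t_pos
      by (intro continuous_on_compose2[OF mean_at_risk_continuous[OF cell]] continuous_intros) auto
    then have [measurable]: "Yc \<in> borel_measurable borel" by (rule borel_measurable_continuous_onI)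
    have Yc: "c \<le> Yc u" for u unfolding Yc_def using t_pos by (intro c(2)) auto
    \<comment> \<open>One summand of the estimator, with the at-risk count divided by
      \<open>n\<close> replaced by its stationary mean. It is a fixed function, so the weak law
      applies to it.\<close>
    define \<psi> where "\<psi> s u = K ((s - u) / b) / b / Yc u * of_bool (u \<le> t)" for s u
    have \<psi>m[measurable]: "\<psi> s \<in> borel_measurable borel" for s unfolding \<psi>_def by measurable
    have \<psi>b: "\<bar>\<psi> s u\<bar> \<le> \<kappa> / b / c" for s u
    proof -
      have "\<bar>K ((s - u) / b) / b / Yc u\<bar> \<le> \<kappa> / b / c"
        using Yc[of u] c(1) b \<kappa> by (auto simp: abs_divide intro!: frac_le divide_right_mono)
      moreover have "0 \<le> \<kappa> / b / c" using c(1) b \<kappa>(1) by simp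
      ultimately show ?thesis by (auto simp: \<psi>_def of_bool_def)
    qed
    define avg where "avg \<phi> n \<omega> = (\<Sum>i<n. cell_fun \<phi> A B (Z i \<omega>, S (Suc i) \<omega>, Z (Suc i) \<omega>)) / real n" for \<phi> n \<omega>
    define target where "target s = (\<integral>z. step (cell_fun (\<psi> s) A B) z \<partial>\<nu>)" for s
    have target: "\<bar>target s - l A B s\<bar> \<le> \<epsilon> / 4" if s: "s \<in> {r1..r2}" for s
    proof -
      have "target s = (\<integral>u. of_bool (0 \<le> u \<and> u \<le> t) * \<psi> s u * N u \<partial>lborel)"
        unfolding target_def by (rule mean_jump_eq[OF cell \<psi>m \<psi>b]) (auto simp: \<psi>_def of_bool_def)
      also have "\<dots> = (\<integral>u. of_bool (0 \<le> u \<and> u \<le> t) * (K ((s - u) / b) / b) * l A B u \<partial>lborel)"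
        by (intro Bochner_Integration.integral_cong refl) (auto simp: \<psi>_def Yc_def l_eq[OF cell] of_bool_def)
      finally show ?thesis using b0(2)[OF b s] by simp
    qed
    \<comment> \<open>The first entry meets the hypothesis of \<open>nelson_aalen_deviation\<close>;
      the second brings its bound, with \<open>\<kappa> / b\<close> for the kernel, down to
      \<open>\<epsilon> / 4\<close>.\<close>
    define \<eta> where "\<eta> = min (c / 2) (\<epsilon> * b * c\<^sup>2 / (8 * \<kappa>))"
    have \<eta>: "0 < \<eta>" "\<eta> \<le> c / 2" "\<kappa> / b * (2 * \<eta> / c\<^sup>2) \<le> \<epsilon> / 4"
    proof -
      show "0 < \<eta>" "\<eta> \<le> c / 2" using c(1) \<epsilon> b \<kappa>(1) by (auto simp: \<eta>_def)
      have "\<eta> \<le> \<epsilon> * b * c\<^sup>2 / (8 * \<kappa>)" by (simp add: \<eta>_def)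
      then have "\<kappa> / b * (2 * \<eta> / c\<^sup>2) \<le> \<kappa> / b * (2 * (\<epsilon> * b * c\<^sup>2 / (8 * \<kappa>)) / c\<^sup>2)"
        using b \<kappa>(1) by (intro mult_left_mono divide_right_mono) auto
      also have "\<dots> = \<epsilon> / 4" using c(1) b \<kappa>(1) by simp
      finally show "\<kappa> / b * (2 * \<eta> / c\<^sup>2) \<le> \<epsilon> / 4" .
    qed
    obtain U where U: "finite U" "U \<subseteq> {0..t}"
      and U_approx: "\<And>y u. antimono y \<Longrightarrow> (\<And>v. v \<in> U \<Longrightarrow> \<bar>y v - Y v\<bar> \<le> \<eta> / 2) \<Longrightarrow> u \<in> {0..t}
        \<Longrightarrow> \<bar>y u - Y u\<bar> \<le> 2 * (\<eta> / 2)"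
      using antimono_uniform_approx[OF mean_at_risk_continuous[OF cell], of "\<eta> / 2"] t_pos \<eta>(1)
      by (metis half_gt_zero less_imp_le)
    \<comment> \<open>This tolerance becomes \<open>\<epsilon> / 8\<close> after division by
      \<open>b\<close> and by \<open>Yc\<close>, which is at least \<open>c\<close>.\<close>
    have "0 < \<epsilon> * b * c / 8" using \<epsilon> b c(1) by simp
    then obtain \<delta>1 where \<delta>1: "0 < \<delta>1" "\<And>u v. \<bar>u - v\<bar> < \<delta>1 \<Longrightarrow> \<bar>K u - K v\<bar> < \<epsilon> * b * c / 8"
      using smoothing_kernel_uniformly_continuous[OF K]
      unfolding uniformly_continuous_on_def dist_real_def by (metis UNIV_I)
    have "uniformly_continuous_on {0..t} (l A B)"
      using l_continuous by (intro compact_uniformly_continuous) auto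
    moreover have "0 < \<epsilon> / 8" using \<epsilon> by simp
    ultimately obtain \<delta>2 where \<delta>2: "0 < \<delta>2"
      "\<And>u v. u \<in> {0..t} \<Longrightarrow> v \<in> {0..t} \<Longrightarrow> \<bar>u - v\<bar> < \<delta>2 \<Longrightarrow> \<bar>l A B u - l A B v\<bar> < \<epsilon> / 8"
      unfolding uniformly_continuous_on_def dist_real_def by metis
    \<comment> \<open>The kernel argument is divided by \<open>b\<close>, so points closer than
      \<open>\<delta>1 * b\<close> have arguments closer than \<open>\<delta>1\<close>.\<close>
    have "0 < min (\<delta>1 * b) \<delta>2" using \<delta>1(1) \<delta>2(1) b by simp
    then obtain V where V: "finite V" "V \<subseteq> {r1..r2}"
      "\<And>s. s \<in> {r1..r2} \<Longrightarrow> \<exists>v\<in>V. \<exists>w\<in>V. v \<le> s \<and> s \<le> w \<and> w - v < min (\<delta>1 * b) \<delta>2"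
      using finite_bracketing_grid[of r1 r2 "min (\<delta>1 * b) \<delta>2"] r(2) by (metis less_imp_le)
    \<comment> \<open>Finitely many exceptional events, each of vanishing probability; outside them
      the error bound is deterministic and holds for all \<open>s\<close> at once. The threshold
      here is \<open>\<eta> / 2\<close> because passing from the grid \<open>U\<close> to all times
      doubles it.\<close>
    define bad1 where "bad1 u n = {\<omega> \<in> space (P x). \<eta> / 2 < \<bar>avg (\<lambda>s. of_bool (u \<le> s)) n \<omega> - Y u\<bar>}" for u n
    define bad2 where "bad2 v n = {\<omega> \<in> space (P x). \<epsilon> / 8 < \<bar>avg (\<psi> v) n \<omega> - target v\<bar>}" for v n
    have avg_m: "avg \<phi> n \<in> borel_measurable (P x)" if [measurable]: "\<phi> \<in> borel_measurable borel" for \<phi> n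
    proof -
      note [measurable] = measurable_cell_fun[OF cell that]
      show ?thesis unfolding avg_def by measurable
    qed
    have bad_sets: "bad1 u n \<in> sets (P x)" "bad2 v n \<in> sets (P x)" for u v n
      unfolding bad1_def bad2_def using avg_m[of "\<lambda>s. of_bool (u \<le> s)" n] avg_m[OF \<psi>m, of v n] by measurable
    have bad1_lim: "(\<lambda>n. measure (P x) (bad1 u n)) \<longlonglongrightarrow> 0" for u
    proof -
      have "bounded_on_E (cell_fun (\<lambda>s. of_bool (u \<le> s)) A B) 1"
        by (rule cell_fun_bounded[OF cell]) auto
      from weak_law[OF x measurable_cell_fun[OF cell] this, of "\<eta> / 2"] \<eta>(1)
      show ?thesis
        unfolding bad1_def avg_def using mean_at_risk_eq[OF cell, of u] by simp
    qed
    have bad2_lim: "(\<lambda>n. measure (P x) (bad2 v n)) \<longlonglongrightarrow> 0" for v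
      using weak_law[OF x measurable_cell_fun[OF cell \<psi>m] cell_fun_bounded[OF cell \<psi>b], of "\<epsilon> / 8" v] \<epsilon>
      unfolding bad2_def avg_def target_def by simp
    have good: "\<bar>l_hat K Z S n b t A B s \<omega> - l A B s\<bar> \<le> \<epsilon>"
      if \<omega>: "\<omega> \<in> space (P x)" and g1: "\<And>u. u \<in> U \<Longrightarrow> \<omega> \<notin> bad1 u n" and g2: "\<And>v. v \<in> V \<Longrightarrow> \<omega> \<notin> bad2 v n"
        and s: "s \<in> {r1..r2}" for \<omega> n s
    proof -
      define \<tau> where "\<tau> i = S (Suc i) \<omega>" for i
      define w :: "nat \<Rightarrow> real" where "w i = of_bool (Z i \<omega> \<in> A) * of_bool (Z (Suc i) \<omega> \<in> B)" for i
      have w: "0 \<le> w i" "w i \<le> 1" for i by (auto simp: w_def)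
      have \<tau>: "0 \<le> \<tau> i" for i using S_nonneg[OF x \<omega>] by (simp add: \<tau>_def)
      have avg_eq: "avg \<phi> n \<omega> = (\<Sum>i<n. \<phi> (\<tau> i) * w i) / real n" for \<phi>
        by (simp add: avg_def cell_fun_def \<tau>_def w_def mult.assoc)
      define y where "y u = at_risk Z S n A B u \<omega>" for u
      have y_avg: "y u / real n = avg (\<lambda>s. of_bool (u \<le> s)) n \<omega>" for u
        by (simp add: y_def at_risk_def avg_def cell_fun_def)
      have "antimono (\<lambda>u. y u / real n)"
        unfolding y_def at_risk_def by (intro antimonoI divide_right_mono sum_mono) auto
      then have dev: "\<bar>y u / real n - Y u\<bar> \<le> \<eta>" if "u \<in> {0..t}" for u
        using U_approx[of "\<lambda>u. y u / real n" u] that g1 \<omega>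
        by (auto simp: y_avg bad1_def not_less)
      define k where "k i = K ((s - \<tau> i) / b) / b" for i
      have kb: "\<bar>k i\<bar> \<le> \<kappa> / b" for i
        using \<kappa>(2) b by (auto simp: k_def abs_divide intro!: divide_right_mono)
      have l_hat: "l_hat K Z S n b t A B s \<omega>
          = (\<Sum>i<n. k i * (if y (\<tau> i) \<noteq> 0 then 1 / y (\<tau> i) else 0) * of_bool (\<tau> i \<le> t) * w i)"
        unfolding l_hat_def at_risk_inv_def sum_distrib_left
        by (intro sum.cong refl) (simp add: k_def y_def \<tau>_def w_def)
      have "(\<Sum>i<n. k i / Y (\<tau> i) * of_bool (\<tau> i \<le> t) * w i) / real n = avg (\<psi> s) n \<omega>"
        unfolding avg_eq using \<tau>
        by (intro arg_cong2[where f="(/)"] sum.cong refl) (auto simp: \<psi>_def k_def Yc_def of_bool_def)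
      then have 1: "\<bar>l_hat K Z S n b t A B s \<omega> - avg (\<psi> s) n \<omega>\<bar> \<le> \<epsilon> / 4"
        using nelson_aalen_deviation[of w \<tau> t c Y \<eta> y n k "\<kappa> / b", OF w \<tau> _ c(1) _ \<eta>(2) dev kb] c(2) \<eta>(1,3)
        unfolding l_hat by (simp del: sum_divide_distrib)
      obtain v where v: "v \<in> V" "\<bar>s - v\<bar> < \<delta>1 * b" "\<bar>s - v\<bar> < \<delta>2"
        using V(3)[OF s] by fastforce
      have v': "v \<in> {r1..r2}" using v(1) V(2) by auto
      have \<psi>_close: "\<bar>\<psi> s u - \<psi> v u\<bar> \<le> \<epsilon> / 8" for u
      proof -
        have "\<bar>(s - u) / b - (v - u) / b\<bar> = \<bar>s - v\<bar> / b"
          using b by (simp add: diff_divide_distrib[symmetric] abs_divide)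
        also have "\<dots> < \<delta>1" using v(2) b by (simp add: field_simps)
        finally have "\<bar>K ((s - u) / b) - K ((v - u) / b)\<bar> < \<epsilon> * b * c / 8" by (rule \<delta>1(2))
        then have "\<bar>K ((s - u) / b) - K ((v - u) / b)\<bar> / b / Yc u \<le> (\<epsilon> * b * c / 8) / b / c"
          using Yc[of u] c(1) b \<epsilon> by (intro frac_le divide_right_mono) auto
        also have "\<dots> = \<epsilon> / 8" using b c(1) by simp
        finally have "\<bar>K ((s - u) / b) - K ((v - u) / b)\<bar> / b / Yc u \<le> \<epsilon> / 8" .
        moreover have "\<bar>K ((s - u) / b) / b / Yc u - K ((v - u) / b) / b / Yc u\<bar>
            = \<bar>K ((s - u) / b) - K ((v - u) / b)\<bar> / b / Yc u"
          using Yc[of u] c(1) b by (simp add: diff_divide_distrib[symmetric] abs_divide)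
        ultimately show ?thesis using \<epsilon> by (auto simp: \<psi>_def of_bool_def)
      qed
      have 2: "\<bar>avg (\<psi> s) n \<omega> - avg (\<psi> v) n \<omega>\<bar> \<le> \<epsilon> / 8"
      proof (cases "n = 0")
        case False
        have "\<bar>\<Sum>i<n. (\<psi> s (\<tau> i) - \<psi> v (\<tau> i)) * w i\<bar> \<le> (\<Sum>i<n. \<bar>(\<psi> s (\<tau> i) - \<psi> v (\<tau> i)) * w i\<bar>)"
          by (rule sum_abs)
        also have "\<dots> \<le> of_nat (card {..<n}) * (\<epsilon> / 8)"
        proof (rule sum_bounded_above)
          fix i
          have "\<bar>\<psi> s (\<tau> i) - \<psi> v (\<tau> i)\<bar> * w i \<le> \<epsilon> / 8 * 1"
            using \<psi>_close w \<epsilon> by (intro mult_mono) auto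
          then show "\<bar>(\<psi> s (\<tau> i) - \<psi> v (\<tau> i)) * w i\<bar> \<le> \<epsilon> / 8" using w by (simp add: abs_mult)
        qed
        finally have "\<bar>\<Sum>i<n. (\<psi> s (\<tau> i) - \<psi> v (\<tau> i)) * w i\<bar> / real n \<le> \<epsilon> / 8"
          using False by (simp add: field_simps)
        moreover have "avg (\<psi> s) n \<omega> - avg (\<psi> v) n \<omega> = (\<Sum>i<n. (\<psi> s (\<tau> i) - \<psi> v (\<tau> i)) * w i) / real n"
          unfolding avg_eq by (simp add: left_diff_distrib sum_subtractf diff_divide_distrib)
        ultimately show ?thesis by (simp add: abs_divide)
      qed (use \<epsilon> in \<open>simp add: avg_def\<close>)
      have 3: "\<bar>avg (\<psi> v) n \<omega> - target v\<bar> \<le> \<epsilon> / 8"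
        using g2[OF v(1)] \<omega> by (simp add: bad2_def)
      have 4: "\<bar>l A B v - l A B s\<bar> < \<epsilon> / 8"
        using v(3) v' s r by (intro \<delta>2(2)) auto
      show ?thesis using 1 2 3 4 target[OF v'] \<epsilon> by linarith
    qed
    have sub: "{\<omega> \<in> space (P x). ereal \<epsilon> < err n b \<omega>} \<subseteq> (\<Union>u\<in>U. bad1 u n) \<union> (\<Union>v\<in>V. bad2 v n)" for n
      using good[of _ n] unfolding sup_error_def by (force simp: less_SUP_iff not_le)
    have le: "measure (P x) {\<omega> \<in> space (P x). ereal \<epsilon> < err n b \<omega>}
        \<le> (\<Sum>u\<in>U. measure (P x) (bad1 u n)) + (\<Sum>v\<in>V. measure (P x) (bad2 v n))" for n
    proof -
      have s1: "(\<Union>u\<in>U. bad1 u n) \<in> sets (P x)" and s2: "(\<Union>v\<in>V. bad2 v n) \<in> sets (P x)"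
        using U(1) V(1) bad_sets by auto
      have "measure (P x) {\<omega> \<in> space (P x). ereal \<epsilon> < err n b \<omega>}
          \<le> measure (P x) ((\<Union>u\<in>U. bad1 u n) \<union> (\<Union>v\<in>V. bad2 v n))"
        using s1 s2 by (intro finite_measure_mono sub) auto
      also have "\<dots> \<le> measure (P x) (\<Union>u\<in>U. bad1 u n) + measure (P x) (\<Union>v\<in>V. bad2 v n)"
        using s1 s2 by (rule measure_Un_le)
      also have "\<dots> \<le> (\<Sum>u\<in>U. measure (P x) (bad1 u n)) + (\<Sum>v\<in>V. measure (P x) (bad2 v n))"
        using U(1) V(1) bad_sets by (intro add_mono measure_UNION_le) auto
      finally show ?thesis .
    qed
    have lim: "(\<lambda>n. (\<Sum>u\<in>U. measure (P x) (bad1 u n)) + (\<Sum>v\<in>V. measure (P x) (bad2 v n))) \<longlonglongrightarrow> (\<Sum>u\<in>U. 0) + (\<Sum>v\<in>V. 0)"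
      by (intro tendsto_add tendsto_sum bad1_lim bad2_lim)
    show ?thesis
    proof (rule tendsto_sandwich[OF _ _ tendsto_const])
      show "\<forall>\<^sub>F n in sequentially. measure (P x) {\<omega> \<in> space (P x). ereal \<epsilon> < err n b \<omega>}
          \<le> (\<Sum>u\<in>U. measure (P x) (bad1 u n)) + (\<Sum>v\<in>V. measure (P x) (bad2 v n))"
        by (rule always_eventually, rule allI, rule le)
    qed (use lim in simp_all)
  qed
  with b0(1) show ?thesis by blast
qed

lemma slow_bandwidth_consistency:
  "\<exists>\<beta> :: nat \<Rightarrow> real. (\<forall>n. 0 < \<beta> n) \<and> \<beta> \<longlonglongrightarrow> 0 \<and>
    (\<forall>\<epsilon>>0. (\<lambda>n. measure (P x) {\<omega> \<in> space (P x). ereal \<epsilon> < err n (\<beta> n) \<omega>}) \<longlonglongrightarrow> 0)"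
proof -
  interpret prob_space "P x" using P_prob[OF x] .
  define e where "e j = 1 / real (Suc j)" for j
  have e: "0 < e j" for j by (simp add: e_def)
  have e_lim: "e \<longlonglongrightarrow> 0"
    unfolding e_def using LIMSEQ_inverse_real_of_nat by (simp add: inverse_eq_divide)
  \<comment> \<open>One level \<open>e j\<close> bounds both the bandwidth and the tolerated error,
    so that both vanish as \<open>j\<close> grows.\<close>
  define Q where "Q j b \<longleftrightarrow> 0 < b \<and> b < e j \<and>
    (\<lambda>n. measure (P x) {\<omega> \<in> space (P x). ereal (e j) < err n b \<omega>}) \<longlonglongrightarrow> 0" for j b
  have "\<exists>b. Q j b" for j
  proof -
    obtain b0 where b0: "0 < b0" "\<And>b. 0 < b \<Longrightarrow> b < b0 \<Longrightarrow>
      (\<lambda>n. measure (P x) {\<omega> \<in> space (P x). ereal (e j) < err n b \<omega>}) \<longlonglongrightarrow> 0"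
      using fixed_bandwidth_consistency[OF e[of j]] by blast
    obtain b where b: "0 < b" "b < min b0 (e j)" using dense[of 0 "min b0 (e j)"] b0(1) e[of j] by auto
    then have "Q j b" unfolding Q_def using b0(2)[of b] by simp
    then show ?thesis ..
  qed
  then have "Q j (SOME b. Q j b)" for j by (rule someI_ex)
  then obtain b where "\<And>j. Q j (b j)" by (rule that[of "\<lambda>j. SOME b. Q j b"])
  then have b: "\<And>j. 0 < b j" "\<And>j. b j < e j"
    "\<And>j. (\<lambda>n. measure (P x) {\<omega> \<in> space (P x). ereal (e j) < err n (b j) \<omega>}) \<longlonglongrightarrow> 0"
    unfolding Q_def by simp_all
  obtain J where J: "filterlim J at_top sequentially"
    and lim: "(\<lambda>n. measure (P x) {\<omega> \<in> space (P x). ereal (e (J n)) < err n (b (J n)) \<omega>}) \<longlonglongrightarrow> 0"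
    by (rule diagonal_tendsto_zero[of "\<lambda>j n. measure (P x) {\<omega> \<in> space (P x). ereal (e j) < err n (b j) \<omega>}", OF b(3)])
  have eJ: "(\<lambda>n. e (J n)) \<longlonglongrightarrow> 0" by (rule filterlim_compose[OF e_lim J])
  have bJ: "(\<lambda>n. b (J n)) \<longlonglongrightarrow> 0"
    using b(1,2) by (intro tendsto_sandwich[OF _ _ tendsto_const eJ] always_eventually allI) (simp_all add: less_imp_le)
  have "(\<lambda>n. measure (P x) {\<omega> \<in> space (P x). ereal \<epsilon> < err n (b (J n)) \<omega>}) \<longlonglongrightarrow> 0" if \<epsilon>: "0 < \<epsilon>" for \<epsilon>
  proof (rule tendsto_sandwich[OF _ _ tendsto_const lim])
    \<comment> \<open>Once \<open>e (J n)\<close> is below \<open>\<epsilon>\<close>, an error above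
      \<open>\<epsilon>\<close> is also above \<open>e (J n)\<close>, and that event is already
      controlled.\<close>
    show "\<forall>\<^sub>F n in sequentially. measure (P x) {\<omega> \<in> space (P x). ereal \<epsilon> < err n (b (J n)) \<omega>}
        \<le> measure (P x) {\<omega> \<in> space (P x). ereal (e (J n)) < err n (b (J n)) \<omega>}"
      using order_tendstoD(2)[OF eJ \<epsilon>]
    proof eventually_elim
      case (elim n)
      then show ?case
        using measurable_sup_error[of n "b (J n)"]
        by (intro finite_measure_mono) (auto intro: less_trans[of "ereal (e (J n))" "ereal \<epsilon>"])
    qed
  qed simp
  with b(1) bJ show ?thesis by (intro exI[of _ "\<lambda>n. b (J n)"]) auto
qed

end

end

theorem proposition2p5:
  fixes E :: "'a :: {metric_space, second_countable_topology} set"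
    and P :: "'a \<Rightarrow> 'w measure"
    and B :: "nat \<Rightarrow> 'a set"
    and r1 r2 t :: real
  assumes "embedded_chain E \<Phi> rate Q \<mu> Qd P Z S"
    and "smoothing_kernel K"
    and "A \<in> pdmp.C2 E"
    and "pdmp.admissible E \<Phi> Q p B"
    and "k \<in> {1..p}"
    and "0 < r1" and "r1 < r2" and "r2 < t"
    and "ereal t < pdmp.exit_time_set E \<Phi> A"
    and "x \<in> E"
  shows "\<exists>\<beta> :: nat \<Rightarrow> 'w \<Rightarrow> real.
    (\<forall>n. \<beta> n \<in> borel_measurable (P x)) \<and>
    (\<forall>n. \<forall>\<omega>\<in>space (P x). 0 < \<beta> n \<omega>) \<and>
    (AE \<omega> in P x. (\<lambda>n. \<beta> n \<omega>) \<longlonglongrightarrow> 0) \<and>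
    tendsto_zero_in_prob (P x)
      (\<lambda>n \<omega>. SUP s\<in>{r1..r2}.
         ereal \<bar>l_hat K Z S n (\<beta> n \<omega>) t A (B k) s \<omega>
                - embedded_chain.l E \<Phi> rate Qd P Z A (B k) s\<bar>)"
proof -
  interpret embedded_chain E \<Phi> rate Q \<mu> Qd P Z S by fact
  have A: "A \<in> sets \<mu>" "interior A \<noteq> {}"
    using assms(3) by (auto simp: C2_def C1_def sets_\<mu>_iff)
  have "B k \<in> C1"
    using assms(4,5) by (auto simp: admissible_def fine_family_def)
  then have B: "B k \<in> sets \<mu>" "interior (B k) \<noteq> {}"
    by (auto simp: C1_def sets_\<mu>_iff)
  have t_exit: "t < exit y" if "y \<in> A" for y
  proof -
    have "y \<in> E" using A(1) that by (auto simp: sets_\<mu>_iff)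
    moreover have "exit_time_set A \<le> exit_time y"
      unfolding exit_time_set_def using that by (rule INF_lower)
    ultimately show ?thesis
      using assms(9) exit_time_eq[of y] by (auto dest: less_le_trans)
  qed
  note setting = A(1) B(1) A(2) B(2) t_exit assms(2,6-8,10)
  obtain \<beta> where \<beta>: "\<And>n. 0 < \<beta> n" "\<beta> \<longlonglongrightarrow> 0"
    and lim: "\<And>\<epsilon>. 0 < \<epsilon> \<Longrightarrow> (\<lambda>n. measure (P x) {\<omega> \<in> space (P x).
      ereal \<epsilon> < sup_error A (B k) t K r1 r2 n (\<beta> n) \<omega>}) \<longlonglongrightarrow> 0"
    using slow_bandwidth_consistency[OF setting] by blast
  \<comment> \<open>Nonnegativity disposes of the absolute value in
    \<open>tendsto_zero_in_prob\<close>.\<close>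
  have nonneg: "0 \<le> sup_error A (B k) t K r1 r2 n b \<omega>" for n b \<omega>
    unfolding sup_error_def using assms(7) by (intro SUP_upper2[of r1]) auto
  have "tendsto_zero_in_prob (P x) (\<lambda>n \<omega>. sup_error A (B k) t K r1 r2 n (\<beta> n) \<omega>)"
    unfolding tendsto_zero_in_prob_def
    using measurable_sup_error[OF setting] lim nonneg by simp
  \<comment> \<open>The bandwidths do not depend on \<open>\<omega>\<close>, so their measurability
    and almost sure convergence are immediate.\<close>
  then show ?thesis
    using \<beta> unfolding sup_error_def
    by (intro exI[of _ "\<lambda>n _. \<beta> n"]) auto
qed

end
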